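(* Let $n \geq 1$. The subgroup $P_{n+1}^* \cong \mathrm{Inn}(F_n)\,P_n$ of $IA_n$ satisfies the Andreadakis equality.
   Context: Let $F_n$ be the free group on $x_1,\dots,x_n$ and $\partial_n := x_1\cdots x_n$. The pure braid group $P_n$ is identified, via Artin's faithful action on $F_n$, with the group of all automorphisms of $F_n$ sending each $x_i$ to one of its conjugates and fixing $\partial_n$. $\mathrm{Inn}(F_n)$ is the group of inner automorphisms of $F_n$, and $\mathrm{Inn}(F_n)P_n=\{\iota\beta : \iota\in \mathrm{Inn}(F_n),\ \beta\in P_n\}$. $IA_n$ is the group of automorphisms of $F_n$ acting trivially on $F_n^{ab}\cong\mathbb{Z}^n$; it contains $\mathrm{Inn}(F_n)P_n$. $P_{n+1}^* := P_{n+1}/\mathcal{Z}(P_{n+1})$, where $\mathcal{Z}$ denotes the center. The Artin action of $P_{n+1}$ on $F_{n+1}$ induces an action on the quotient of $F_{n+1}$ by the normal closure of $\partial_{n+1}$, which is free on $x_1,\dots,x_n$ and is identified with $F_n$; this induces an isomorphism from $P_{n+1}^*$ onto the subgroup $\mathrm{Inn}(F_n)P_n$ of $IA_n$ (Magnus). The lower central series of a group $K$ is $\Gamma_1(K)=K$, $\Gamma_{j+1}(K)=[K,\Gamma_j(K)]$. The Andreadakis filtration on $IA_n$ is $\mathcal{A}_j=\{\varphi\in \mathrm{Aut}(F_n) : \forall i\geq 1,\ \forall g\in\Gamma_i(F_n),\ \varphi(g)g^{-1}\in\Gamma_{i+j}(F_n)\}$ for $j\ge1$, so that $\mathcal{A}_1=IA_n$.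 A subgroup $K\subseteq IA_n$ satisfies the Andreadakis equality if the inclusions $\Gamma_j(K)\subseteq K\cap\Gamma_j(IA_n)\subseteq K\cap\mathcal{A}_j$ are equalities for all $j\geq 1$. *)

theory Defs
  imports "HOL-Algebra.Generated_Groups" "HOL-Algebra.Bij"
begin

section \<open>Free groups of finite rank\<close>

text \<open>
  Elements are freely reduced words. The letter \<open>(i, True)\<close> stands for \<open>x\<^sub>i\<close> and
  \<open>(i, False)\<close> for its inverse; generators are numbered from 1. With this model the underlying
  set of \<open>F\<^sub>n\<close> is contained in that of \<open>F\<^sub>n\<^sub>+\<^sub>1\<close>, and the inclusion is the homomorphism
  sending each \<open>x\<^sub>i\<close> to \<open>x\<^sub>i\<close>.
\<close>

type_synonym letter = "nat \<times> bool"
type_synonym word = "letter list"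

definition inv_letter :: "letter \<Rightarrow> letter"
  where "inv_letter a = (fst a, \<not> snd a)"

definition reduced :: "word \<Rightarrow> bool"
  where "reduced w \<longleftrightarrow> successively (\<lambda>a b. b \<noteq> inv_letter a) w"

fun push :: "letter \<Rightarrow> word \<Rightarrow> word" where
  "push a [] = [a]"
| "push a (b # w) = (if b = inv_letter a then w else a # b # w)"

definition free_group :: "nat \<Rightarrow> word monoid"
  where "free_group n =
    \<lparr>carrier = {w. reduced w \<and> fst ` set w \<subseteq> {1..n}},
     monoid.mult = \<lambda>u v. foldr push u v,
     one = []\<rparr>"

definition gen :: "nat \<Rightarrow> word"
  where "gen i = [(i, True)]"

lemma inv_letter_inv_letter [simp]: "inv_letter (inv_letter a) = a"
  by (simp add: inv_letter_def)

lemma inv_letter_neq [simp]: "inv_letter a \<noteq> a" "a \<noteq> inv_letter a"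
  by (auto simp: inv_letter_def prod_eq_iff)

lemma fst_inv_letter [simp]: "fst (inv_letter a) = fst a"
  by (simp add: inv_letter_def)

lemma reduced_Nil [simp]: "reduced []"
  by (simp add: reduced_def)

lemma reduced_Cons:
  "reduced (a # w) \<longleftrightarrow> reduced w \<and> (w = [] \<or> hd w \<noteq> inv_letter a)"
  by (cases w) (auto simp: reduced_def)

lemma reduced_push: "reduced w \<Longrightarrow> reduced (push a w)"
  by (cases w) (auto simp: reduced_Cons)

lemma reduced_foldr_push: "reduced v \<Longrightarrow> reduced (foldr push u v)"
  by (induction u) (auto simp: reduced_push)

lemma push_inv_letter: "reduced w \<Longrightarrow> push a (push (inv_letter a) w) = w"
  by (cases w; cases "tl w") (auto simp: reduced_Cons)

lemma set_push: "set (push a w) \<subseteq> insert a (set w)"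
  by (cases w) auto

lemma set_foldr_push: "set (foldr push u v) \<subseteq> set u \<union> set v"
  using set_push by (induction u) (simp, fastforce)

lemma push_reduced: "reduced (a # w) \<Longrightarrow> push a w = a # w"
  by (cases w) (auto simp: reduced_Cons)

lemma foldr_push_Nil: "reduced u \<Longrightarrow> foldr push u [] = u"
  by (induction u) (auto simp: push_reduced reduced_Cons)

lemma foldr_push_push:
  assumes "reduced z" "reduced w"
  shows "foldr push (push a z) w = push a (foldr push z w)"
proof (cases z)
  case (Cons b z')
  show ?thesis
    using Cons push_inv_letter[OF reduced_foldr_push[OF assms(2)], of a z'] by auto
qed simp

lemma foldr_push_assoc:
  assumes "reduced v" "reduced w"
  shows "foldr push (foldr push u v) w = foldr push u (foldr push v w)"
  by (induction u) (simp_all add: foldr_push_push reduced_foldr_push assms)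

lemma foldr_push_inverse: "foldr push (rev (map inv_letter u)) u = []"
  by (induction u) auto

lemma reduced_inverse: "reduced u \<Longrightarrow> reduced (rev (map inv_letter u))"
proof -
  assume "reduced u"
  then have "successively (\<lambda>a b. b \<noteq> inv_letter a) u" by (simp add: reduced_def)
  then have "successively (\<lambda>a b. inv_letter a \<noteq> inv_letter (inv_letter b)) u"
    by (rule successively_mono) auto
  then show ?thesis
    by (simp add: reduced_def successively_rev successively_map)
qed

theorem group_free_group: "group (free_group n)"
proof (rule groupI)
  fix x y assume "x \<in> carrier (free_group n)" "y \<in> carrier (free_group n)"
  then show "x \<otimes>\<^bsub>free_group n\<^esub> y \<in> carrier (free_group n)"
    using set_foldr_push[of x y] by (fastforce simp: free_group_def reduced_foldr_push)
next
  fix x assume x: "x \<in> carrier (free_group n)"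
  then have "rev (map inv_letter x) \<in> carrier (free_group n)"
    by (auto simp: free_group_def reduced_inverse)
  moreover have "rev (map inv_letter x) \<otimes>\<^bsub>free_group n\<^esub> x = \<one>\<^bsub>free_group n\<^esub>"
    by (simp add: free_group_def foldr_push_inverse)
  ultimately show "\<exists>y\<in>carrier (free_group n). y \<otimes>\<^bsub>free_group n\<^esub> x = \<one>\<^bsub>free_group n\<^esub>"
    by blast
qed (auto simp: free_group_def foldr_push_assoc)

text \<open>The universal property: \<^term>\<open>free_group n\<close> is free on \<open>x\<^sub>1, \<dots>, x\<^sub>n\<close>.\<close>

theorem free_group_universal:
  assumes "group H" and f: "f \<in> {1..n} \<rightarrow> carrier H"
  shows "\<exists>!h. h \<in> hom (free_group n) H \<inter> extensional (carrier (free_group n)) \<and>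
              (\<forall>i\<in>{1..n}. h (gen i) = f i)"
proof -
  interpret H: group H by fact
  interpret F: group "free_group n" by (rule group_free_group)
  define l where "l a = (if snd a then f (fst a) else inv\<^bsub>H\<^esub> f (fst a))" for a :: letter
  define e where "e w = foldr (\<lambda>a y. l a \<otimes>\<^bsub>H\<^esub> y) w \<one>\<^bsub>H\<^esub>" for w
  define L where "L = {a :: letter. fst a \<in> {1..n}}"
  have carr: "w \<in> carrier (free_group n) \<longleftrightarrow> reduced w \<and> set w \<subseteq> L" for w
    by (auto simp: free_group_def L_def)
  have fL: "f (fst a) \<in> carrier H" if "a \<in> L" for a
    using that f by (auto simp: L_def)
  have lc: "l a \<in> carrier H" if "a \<in> L" for a
    using fL[OF that] by (simp add: l_def)
  have li: "l a \<otimes>\<^bsub>H\<^esub> l (inv_letter a) = \<one>\<^bsub>H\<^esub>" if "a \<in> L" for a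
    using fL[OF that] by (simp add: l_def inv_letter_def)
  have ec: "e w \<in> carrier H" if "set w \<subseteq> L" for w
    using that by (induction w) (auto simp: e_def lc)
  have eCons: "e (a # w) = l a \<otimes>\<^bsub>H\<^esub> e w" for a w
    by (simp add: e_def)
  have epush: "e (push a w) = l a \<otimes>\<^bsub>H\<^esub> e w" if "a \<in> L" "set w \<subseteq> L" for a w
  proof (cases w)
    case (Cons b w')
    then have "l a \<otimes>\<^bsub>H\<^esub> (l (inv_letter a) \<otimes>\<^bsub>H\<^esub> e w') = e w'" if "b = inv_letter a"
      using that \<open>a \<in> L\<close> \<open>set w \<subseteq> L\<close> li[of a] lc[of a] lc[of b] ec[of w']
      by (simp flip: H.m_assoc)
    with Cons show ?thesis by (auto simp: eCons)
  qed (simp add: eCons)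
  have emult: "e (foldr push u v) = e u \<otimes>\<^bsub>H\<^esub> e v" if "set u \<subseteq> L" "set v \<subseteq> L" for u v
    using that
  proof (induction u)
    case Nil
    then show ?case using ec[of v] by (simp add: e_def)
  next
    case (Cons a u)
    then have "set (foldr push u v) \<subseteq> L" using set_foldr_push[of u v] by auto
    with Cons show ?case by (simp add: epush eCons H.m_assoc lc ec)
  qed
  have e_hom: "restrict e (carrier (free_group n)) \<in> hom (free_group n) H"
  proof (rule homI)
    fix u v assume "u \<in> carrier (free_group n)" "v \<in> carrier (free_group n)"
    moreover from this have "u \<otimes>\<^bsub>free_group n\<^esub> v \<in> carrier (free_group n)" by simp
    ultimately show "restrict e (carrier (free_group n)) (u \<otimes>\<^bsub>free_group n\<^esub> v) =
        restrict e (carrier (free_group n)) u \<otimes>\<^bsub>H\<^esub> restrict e (carrier (free_group n)) v"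
      by (simp add: carr emult) (simp add: free_group_def emult)
  qed (simp add: carr ec)
  have gen_carr: "gen i \<in> carrier (free_group n)" if "i \<in> {1..n}" for i
    using that by (simp add: carr L_def gen_def reduced_Cons)
  show ?thesis
  proof (rule ex1I)
    show "restrict e (carrier (free_group n))
            \<in> hom (free_group n) H \<inter> extensional (carrier (free_group n)) \<and>
          (\<forall>i\<in>{1..n}. restrict e (carrier (free_group n)) (gen i) = f i)"
      using e_hom gen_carr funcset_mem[OF f] by (auto simp: gen_def e_def l_def)
  next
    fix h
    assume h: "h \<in> hom (free_group n) H \<inter> extensional (carrier (free_group n)) \<and>
               (\<forall>i\<in>{1..n}. h (gen i) = f i)"
    then have hh: "h \<in> hom (free_group n) H" and hg: "\<And>i. i \<in> {1..n} \<Longrightarrow> h (gen i) = f i"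
      by auto
    interpret h: group_hom "free_group n" H h
      by unfold_locales (rule hh)
    have hl: "[a] \<in> carrier (free_group n) \<and> h [a] = l a" if a: "a \<in> L" for a
    proof (cases "snd a")
      case True
      then have "[a] = gen (fst a)" by (simp add: gen_def prod_eq_iff)
      with a True show ?thesis using gen_carr hg by (simp add: L_def l_def)
    next
      case False
      have i: "fst a \<in> {1..n}" using a by (simp add: L_def)
      have ac: "[a] \<in> carrier (free_group n)" using a by (simp add: carr reduced_Cons)
      have "[a] \<otimes>\<^bsub>free_group n\<^esub> gen (fst a) = \<one>\<^bsub>free_group n\<^esub>"
        using False by (simp add: free_group_def gen_def inv_letter_def)
      then have "[a] = inv\<^bsub>free_group n\<^esub> gen (fst a)"
        using ac gen_carr[OF i] by (simp add: F.inv_equality)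
      with ac False show ?thesis using gen_carr[OF i] hg[OF i] by (simp add: l_def)
    qed
    have hw: "h w = e w" if "w \<in> carrier (free_group n)" for w
      using that
    proof (induction w)
      case Nil
      then show ?case using h.hom_one by (simp add: e_def free_group_def)
    next
      case (Cons a w)
      then have a: "a \<in> L" and w: "w \<in> carrier (free_group n)" and r: "reduced (a # w)"
        by (auto simp: carr reduced_Cons)
      have "a # w = [a] \<otimes>\<^bsub>free_group n\<^esub> w"
        using push_reduced[OF r] by (simp add: free_group_def)
      then have "h (a # w) = h [a] \<otimes>\<^bsub>H\<^esub> h w"
        using hl[OF a] w by simp
      then show ?case using hl[OF a] Cons.IH[OF w] by (simp add: eCons)
    qed
    show "h = restrict e (carrier (free_group n))"
      using h hw by (intro extensionalityI[of _ "carrier (free_group n)"]) auto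
  qed
qed


section \<open>General group theory\<close>

definition center :: "('a, 'b) monoid_scheme \<Rightarrow> 'a set"
  where "center G = {z \<in> carrier G. \<forall>g\<in>carrier G. z \<otimes>\<^bsub>G\<^esub> g = g \<otimes>\<^bsub>G\<^esub> z}"

definition normal_closure :: "('a, 'b) monoid_scheme \<Rightarrow> 'a set \<Rightarrow> 'a set"
  where "normal_closure G S = \<Inter>{N. N \<lhd> G \<and> S \<subseteq> N}"

definition inner :: "('a, 'b) monoid_scheme \<Rightarrow> 'a \<Rightarrow> 'a \<Rightarrow> 'a"
  where "inner G g = (\<lambda>x\<in>carrier G. g \<otimes>\<^bsub>G\<^esub> x \<otimes>\<^bsub>G\<^esub> inv\<^bsub>G\<^esub> g)"

definition Inn :: "('a, 'b) monoid_scheme \<Rightarrow> ('a \<Rightarrow> 'a) set"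
  where "Inn G = inner G ` carrier G"

definition commutator_subgroup :: "('a, 'b) monoid_scheme \<Rightarrow> 'a set \<Rightarrow> 'a set \<Rightarrow> 'a set"
  where "commutator_subgroup G H K =
    generate G {h \<otimes>\<^bsub>G\<^esub> k \<otimes>\<^bsub>G\<^esub> inv\<^bsub>G\<^esub> h \<otimes>\<^bsub>G\<^esub> inv\<^bsub>G\<^esub> k | h k. h \<in> H \<and> k \<in> K}"

text \<open>
  The lower central series of a subgroup \<open>K\<close> of \<open>G\<close>, computed inside \<open>G\<close>. Its indices start at 1;
  the value at 0 is a dummy.
\<close>

fun lower_central :: "('a, 'b) monoid_scheme \<Rightarrow> 'a set \<Rightarrow> nat \<Rightarrow> 'a set" where
  "lower_central G K 0 = K"
| "lower_central G K (Suc 0) = K"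
| "lower_central G K (Suc (Suc j)) = commutator_subgroup G K (lower_central G K (Suc j))"


section \<open>Automorphisms of the free group\<close>

text \<open>Automorphisms are those of \<^const>\<open>AutoGroup\<close>; the product is composition, right factor first.\<close>

abbreviation Aut_free :: "nat \<Rightarrow> (word \<Rightarrow> word) monoid"
  where "Aut_free n \<equiv> AutoGroup (free_group n)"

definition boundary :: "nat \<Rightarrow> word"
  where "boundary n = foldr (\<lambda>i w. gen i \<otimes>\<^bsub>free_group n\<^esub> w) [1..<Suc n] \<one>\<^bsub>free_group n\<^esub>"

definition pure_braids :: "nat \<Rightarrow> (word \<Rightarrow> word) set"
  where "pure_braids n =
    {\<beta> \<in> carrier (Aut_free n).
       (\<forall>i\<in>{1..n}. \<exists>w\<in>carrier (free_group n).
          \<beta> (gen i) = w \<otimes>\<^bsub>free_group n\<^esub> gen i \<otimes>\<^bsub>free_group n\<^esub> inv\<^bsub>free_group n\<^esub> w) \<and>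
       \<beta> (boundary n) = boundary n}"

definition pure_braid_group :: "nat \<Rightarrow> (word \<Rightarrow> word) monoid"
  where "pure_braid_group n = Aut_free n\<lparr>carrier := pure_braids n\<rparr>"

definition Inn_pure_braids :: "nat \<Rightarrow> (word \<Rightarrow> word) set"
  where "Inn_pure_braids n = Inn (free_group n) <#>\<^bsub>Aut_free n\<^esub> pure_braids n"

text \<open>Trivial action on the abelianization, expressed on cosets of the derived subgroup.\<close>

definition IA :: "nat \<Rightarrow> (word \<Rightarrow> word) set"
  where "IA n =
    {\<phi> \<in> carrier (Aut_free n). \<forall>w\<in>carrier (free_group n).
       derived (free_group n) (carrier (free_group n)) #>\<^bsub>free_group n\<^esub> \<phi> w =
       derived (free_group n) (carrier (free_group n)) #>\<^bsub>free_group n\<^esub> w}"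

text \<open>
  Let \<open>N\<close> be the normal closure of \<open>boundary (Suc n)\<close> in \<open>free_group (Suc n)\<close>. The map
  \<open>w \<mapsto> N w\<close> is an isomorphism from \<open>free_group n\<close> onto the quotient \<open>free_group (Suc n) Mod N\<close>.
  Every \<open>\<beta>\<close> in \<open>pure_braids (Suc n)\<close> preserves \<open>N\<close> and so acts on this quotient by
  \<open>N w \<mapsto> N (\<beta> w)\<close>; the automorphism defined here is that action, transported to \<open>free_group n\<close>.
\<close>

definition induced_action :: "nat \<Rightarrow> (word \<Rightarrow> word) \<Rightarrow> (word \<Rightarrow> word)"
  where "induced_action n \<beta> =
    (let N = normal_closure (free_group (Suc n)) {boundary (Suc n)} in
     THE \<phi>. \<phi> \<in> carrier (Aut_free n) \<and>
       (\<forall>w\<in>carrier (free_group n).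
          N #>\<^bsub>free_group (Suc n)\<^esub> \<phi> w = N #>\<^bsub>free_group (Suc n)\<^esub> \<beta> w))"

definition pure_braid_mod_center :: "nat \<Rightarrow> (word \<Rightarrow> word) set monoid"
  where "pure_braid_mod_center n = pure_braid_group n Mod center (pure_braid_group n)"


section \<open>The Andreadakis equality\<close>

definition andreadakis :: "nat \<Rightarrow> nat \<Rightarrow> (word \<Rightarrow> word) set"
  where "andreadakis n j =
    {\<phi> \<in> carrier (Aut_free n).
       \<forall>i\<ge>1. \<forall>g\<in>lower_central (free_group n) (carrier (free_group n)) i.
         \<phi> g \<otimes>\<^bsub>free_group n\<^esub> inv\<^bsub>free_group n\<^esub> g
           \<in> lower_central (free_group n) (carrier (free_group n)) (i + j)}"

definition andreadakis_equality :: "nat \<Rightarrow> (word \<Rightarrow> word) set \<Rightarrow> bool"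
  where "andreadakis_equality n K \<longleftrightarrow>
    subgroup K (Aut_free n) \<and> K \<subseteq> IA n \<and>
    (\<forall>j\<ge>1. lower_central (Aut_free n) K j = K \<inter> lower_central (Aut_free n) (IA n) j \<and>
            K \<inter> lower_central (Aut_free n) (IA n) j = K \<inter> andreadakis n j)"

end

theory Submission
  imports Defs "HOL-Library.List_Lexorder"
begin

text \<open>
  An automorphism \<open>\<phi>\<close> lies in \<open>Inn(F\<^sub>n)P\<^sub>n\<close> iff it sends every \<open>x\<^sub>i\<close>, and also \<open>\<partial>\<^sub>n\<close>, to a conjugate.
  If moreover \<open>\<phi> \<in> \<A>\<^sub>j\<close> and \<open>\<phi>(\<partial>\<^sub>n) = w \<partial>\<^sub>n w\<^sup>-\<^sup>1\<close>, then \<open>[w, \<partial>\<^sub>n] \<in> \<Gamma>\<^sub>j\<^sub>+\<^sub>1\<close>. In the graded Lie ring of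
  a free group the centralizer of a basis element consists of its multiples, so \<open>w\<close> can be taken in
  \<open>\<Gamma>\<^sub>j\<close>, which reduces the problem to \<open>P\<^sub>n\<close>. There the same argument, applied to the image of \<open>x\<^sub>n\<close>
  and to the combing \<open>P\<^sub>n = F\<^sub>n\<^sub>-\<^sub>1 \<rtimes> P\<^sub>n\<^sub>-\<^sub>1\<close>, gives an induction on \<open>n\<close>. The centralizer is computed in the
  Magnus algebra, whose filtration induces the lower central series because the Lyndon brackets span
  the graded pieces and have distinct leading words.

  That the automorphism group \<open>P\<^sub>n\<close> admits the combing is Artin's theorem: a Hurwitz move shortens any
  nontrivial tuple of conjugates with product \<open>\<partial>\<^sub>n\<close>. For Magnus' isomorphism, the rotation of the
  \<open>n + 2\<close> punctures of the sphere turns capping the boundary into forgetting a strand, where combing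
  identifies the kernel.
\<close>

section \<open>Commutator calculus\<close>

text \<open>The obstacle is that both groups are given by conditions on automorphisms, not by
  generators: nothing says a priori that an element deep in the filtration is a product of
  commutators. Combing supplies such elements, since it writes a pure braid as the image of a word
  of F_n times a braid on fewer strands, and homomorphic images of Gamma_j(F_n) lie in Gamma_j of
  the target. What remains is to read off the depth of that word from the action, and a single test
  element suffices: the word is visible in the conjugator of x_{n+1}, up to a power of x_{n+1} that
  disappears when x_{n+1} is killed. For inner automorphisms the test element is \<partial>_n, and
  the ambiguity, a power of \<partial>_n, does not change the conjugate. The test needs the
  centralizer modulo Gamma_{j+1}, which Magnus series give only for the filtration by degree; hence
  the effort to identify that filtration with the lower central series. Artin's theorem has to pass
  through the full braid group because Hurwitz moves permute the strands; purity returns at the end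
  as the triviality of one coset index.\<close>

definition comm :: "('a, 'b) monoid_scheme \<Rightarrow> 'a \<Rightarrow> 'a \<Rightarrow> 'a"
  where "comm G x y = x \<otimes>\<^bsub>G\<^esub> y \<otimes>\<^bsub>G\<^esub> inv\<^bsub>G\<^esub> x \<otimes>\<^bsub>G\<^esub> inv\<^bsub>G\<^esub> y"

abbreviation lcs :: "('a, 'b) monoid_scheme \<Rightarrow> nat \<Rightarrow> 'a set"
  where "lcs G \<equiv> lower_central G (carrier G)"

lemma commutator_subgroup_comm:
  "commutator_subgroup G H K = generate G {comm G h k | h k. h \<in> H \<and> k \<in> K}"
  by (simp add: commutator_subgroup_def comm_def)

lemma lower_central_Suc:
  "j \<ge> 1 \<Longrightarrow> lower_central G K (Suc j) = commutator_subgroup G K (lower_central G K j)"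
  by (cases j) auto

context group
begin

lemma inv_mult_cancel [simp]: "\<lbrakk>x \<in> carrier G; y \<in> carrier G\<rbrakk> \<Longrightarrow> inv x \<otimes> (x \<otimes> y) = y"
  by (simp flip: m_assoc)

lemma mult_inv_cancel [simp]: "\<lbrakk>x \<in> carrier G; y \<in> carrier G\<rbrakk> \<Longrightarrow> x \<otimes> (inv x \<otimes> y) = y"
  by (simp flip: m_assoc)

lemmas word_simps = m_assoc inv_mult_group

lemma comm_closed [simp]: "\<lbrakk>x \<in> carrier G; y \<in> carrier G\<rbrakk> \<Longrightarrow> comm G x y \<in> carrier G"
  by (simp add: comm_def)

lemma inv_of_comm: "\<lbrakk>x \<in> carrier G; y \<in> carrier G\<rbrakk> \<Longrightarrow> inv (comm G x y) = comm G y x"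
  by (simp add: comm_def word_simps)

lemma comm_self [simp]: "x \<in> carrier G \<Longrightarrow> comm G x x = \<one>"
  by (simp add: comm_def word_simps)

lemma conj_eq_comm: "\<lbrakk>x \<in> carrier G; y \<in> carrier G\<rbrakk> \<Longrightarrow> x \<otimes> y \<otimes> inv x = comm G x y \<otimes> y"
  by (simp add: comm_def word_simps)

lemma comm_eq_one_iff:
  assumes "x \<in> carrier G" "y \<in> carrier G"
  shows "comm G x y = \<one> \<longleftrightarrow> x \<otimes> y = y \<otimes> x"
proof
  assume "comm G x y = \<one>"
  then have "comm G x y \<otimes> (y \<otimes> x) = y \<otimes> x" using assms by simp
  then show "x \<otimes> y = y \<otimes> x" using assms by (simp add: comm_def word_simps)
next
  assume "x \<otimes> y = y \<otimes> x"
  then have "comm G x y = y \<otimes> x \<otimes> inv x \<otimes> inv y" by (simp add: comm_def)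
  then show "comm G x y = \<one>" using assms by (simp add: word_simps)
qed

lemma comm_mult_commuting:
  assumes G: "w \<in> carrier G" "t \<in> carrier G" "y \<in> carrier G" and ty: "t \<otimes> y = y \<otimes> t"
  shows "comm G (w \<otimes> t) y = comm G w y"
proof -
  have "comm G (w \<otimes> t) y = w \<otimes> (t \<otimes> y) \<otimes> inv t \<otimes> inv w \<otimes> inv y"
    using G by (simp add: comm_def word_simps)
  then show ?thesis using G unfolding ty by (simp add: comm_def word_simps)
qed

text \<open>This is the preimage of the centralizer of the class of \<open>b\<close> in G/N. Being a
  subgroup, it reduces commutator estimates to generators, as \<open>comm_generate_mem\<close>
  records.\<close>

lemma subgroup_centralizer_mod:
  assumes N: "N \<lhd> G" and b: "b \<in> carrier G"
  shows "subgroup {a \<in> carrier G. comm G a b \<in> N} G"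
proof -
  interpret N: normal N G by fact
  show ?thesis
  proof
    show "\<one> \<in> {a \<in> carrier G. comm G a b \<in> N}"
      using b by (simp add: comm_def)
  next
    fix x y assume xy: "x \<in> {a \<in> carrier G. comm G a b \<in> N}" "y \<in> {a \<in> carrier G. comm G a b \<in> N}"
    then have "comm G (x \<otimes> y) b = (x \<otimes> comm G y b \<otimes> inv x) \<otimes> comm G x b"
      using b by (simp add: comm_def word_simps)
    then show "x \<otimes> y \<in> {a \<in> carrier G. comm G a b \<in> N}"
      using xy N.inv_op_closed2[of x "comm G y b"] by auto
  next
    fix x assume x: "x \<in> {a \<in> carrier G. comm G a b \<in> N}"
    then have "comm G (inv x) b = inv x \<otimes> inv (comm G x b) \<otimes> x"
      using b by (simp add: comm_def word_simps)
    then show "inv x \<in> {a \<in> carrier G. comm G a b \<in> N}"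
      using x N.inv_op_closed1[of x "inv (comm G x b)"] by auto
  qed auto
qed

lemma comm_generate_mem:
  assumes "N \<lhd> G" "b \<in> carrier G" "S \<subseteq> carrier G" "a \<in> generate G S"
    and "\<And>s. s \<in> S \<Longrightarrow> comm G s b \<in> N"
  shows "comm G a b \<in> N"
proof -
  have "generate G S \<subseteq> {a \<in> carrier G. comm G a b \<in> N}"
    using assms by (intro generate_subgroup_incl subgroup_centralizer_mod) auto
  then show ?thesis using assms(4) by blast
qed

lemma comm_swap_mem:
  assumes "subgroup N G" "comm G a b \<in> N" "a \<in> carrier G" "b \<in> carrier G"
  shows "comm G b a \<in> N"
  using assms inv_of_comm[of a b] by (metis subgroup.m_inv_closed)

text \<open>Conjugation by \<open>c\<close> turns \<open>a\<close> into \<open>a \<otimes> e\<close>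
  and \<open>b\<close> into \<open>b \<otimes> f\<close>. The three commutation hypotheses cancel
  \<open>e\<close> and \<open>f\<close> from the commutator, so \<open>c\<close> fixes it. This
  replaces the Hall-Witt identity and involves no conjugated commutators.\<close>

lemma commutes_with_commutator:
  assumes G: "a \<in> carrier G" "b \<in> carrier G" "c \<in> carrier G"
    and e: "e = inv a \<otimes> c \<otimes> a \<otimes> inv c" and f: "f = inv b \<otimes> c \<otimes> b \<otimes> inv c"
    and eb: "e \<otimes> b = b \<otimes> e" and fa: "f \<otimes> a = a \<otimes> f" and ef: "e \<otimes> f = f \<otimes> e"
  shows "comm G a b \<otimes> c = c \<otimes> comm G a b"
proof -
  have ec: "e \<in> carrier G" and fc: "f \<in> carrier G" using G e f by auto
  have ca: "c \<otimes> a \<otimes> inv c = a \<otimes> e" and cb: "c \<otimes> b \<otimes> inv c = b \<otimes> f"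
    using G e f by (simp_all add: word_simps)
  have "c \<otimes> comm G a b \<otimes> inv c = comm G (c \<otimes> a \<otimes> inv c) (c \<otimes> b \<otimes> inv c)"
    using G by (simp add: comm_def word_simps)
  also have "\<dots> = comm G (a \<otimes> e) (b \<otimes> f)" by (simp add: ca cb)
  also have "\<dots> = a \<otimes> (e \<otimes> b) \<otimes> f \<otimes> inv e \<otimes> inv a \<otimes> inv f \<otimes> inv b"
    using G ec fc by (simp add: comm_def word_simps)
  also have "\<dots> = a \<otimes> b \<otimes> (e \<otimes> f) \<otimes> inv e \<otimes> inv a \<otimes> inv f \<otimes> inv b"
    unfolding eb using G ec fc by (simp add: word_simps)
  also have "\<dots> = a \<otimes> b \<otimes> f \<otimes> inv (f \<otimes> a) \<otimes> inv b"
    unfolding ef using G ec fc by (simp add: word_simps)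
  also have "\<dots> = comm G a b"
    unfolding fa using G ec fc by (simp add: comm_def word_simps)
  finally have "c \<otimes> comm G a b \<otimes> inv c = comm G a b" .
  then have "c \<otimes> comm G a b \<otimes> inv c \<otimes> c = comm G a b \<otimes> c" by simp
  then show ?thesis using G by (simp add: m_assoc)
qed

text \<open>The preceding lemma in the quotient by \<open>N\<close>, where membership in
  \<open>N\<close> becomes commutation. It serves as three subgroups lemma for the lower central
  series and as Jacobi identity for the brackets of trees.\<close>

lemma comm_comm_mem:
  assumes N: "N \<lhd> G" and G: "a \<in> carrier G" "b \<in> carrier G" "c \<in> carrier G"
    and eb: "comm G (comm G (inv a) c) b \<in> N"
    and fa: "comm G (comm G (inv b) c) a \<in> N"
    and ef: "comm G (comm G (inv a) c) (comm G (inv b) c) \<in> N"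
  shows "comm G (comm G a b) c \<in> N"
proof -
  interpret N: normal N G by fact
  interpret Q: group "G Mod N" by (rule N.factorgroup_is_group)
  define p where "p = (\<lambda>x. N #> x)"
  have pc: "p x \<in> carrier (G Mod N)" if "x \<in> carrier G" for x
    using that by (auto simp: p_def FactGroup_def RCOSETS_def)
  have pm: "p (x \<otimes> y) = p x \<otimes>\<^bsub>G Mod N\<^esub> p y" if "x \<in> carrier G" "y \<in> carrier G" for x y
    using that by (simp add: p_def FactGroup_def N.rcos_sum)
  interpret p: group_hom G "G Mod N" p
    by unfold_locales (auto simp: hom_def pc pm)
  have pcomm: "p (comm G x y) = comm (G Mod N) (p x) (p y)" if "x \<in> carrier G" "y \<in> carrier G" for x y
    using that by (simp add: comm_def pm)
  have one: "p x = \<one>\<^bsub>G Mod N\<^esub> \<longleftrightarrow> x \<in> N" if "x \<in> carrier G" for x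
    using coset_join1[OF _ that N.subgroup_axioms] coset_join2[OF that N.subgroup_axioms]
    by (auto simp add: p_def FactGroup_def)
  have iff: "comm G x y \<in> N \<longleftrightarrow> p x \<otimes>\<^bsub>G Mod N\<^esub> p y = p y \<otimes>\<^bsub>G Mod N\<^esub> p x"
    if "x \<in> carrier G" "y \<in> carrier G" for x y
    using that one[of "comm G x y"] Q.comm_eq_one_iff[of "p x" "p y"] by (simp add: pcomm pc)
  have "comm (G Mod N) (p a) (p b) \<otimes>\<^bsub>G Mod N\<^esub> p c = p c \<otimes>\<^bsub>G Mod N\<^esub> comm (G Mod N) (p a) (p b)"
  proof (rule Q.commutes_with_commutator[OF _ _ _ refl refl])
    have e: "inv\<^bsub>G Mod N\<^esub> p x \<otimes>\<^bsub>G Mod N\<^esub> p c \<otimes>\<^bsub>G Mod N\<^esub> p x \<otimes>\<^bsub>G Mod N\<^esub> inv\<^bsub>G Mod N\<^esub> p c = p (comm G (inv x) c)"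
      if "x \<in> carrier G" for x
      using that G by (simp add: comm_def pm)
    show "inv\<^bsub>G Mod N\<^esub> p a \<otimes>\<^bsub>G Mod N\<^esub> p c \<otimes>\<^bsub>G Mod N\<^esub> p a \<otimes>\<^bsub>G Mod N\<^esub> inv\<^bsub>G Mod N\<^esub> p c \<otimes>\<^bsub>G Mod N\<^esub> p b =
       p b \<otimes>\<^bsub>G Mod N\<^esub> (inv\<^bsub>G Mod N\<^esub> p a \<otimes>\<^bsub>G Mod N\<^esub> p c \<otimes>\<^bsub>G Mod N\<^esub> p a \<otimes>\<^bsub>G Mod N\<^esub> inv\<^bsub>G Mod N\<^esub> p c)"
      unfolding e[OF G(1)] using iff[of "comm G (inv a) c" b] eb G by simp
    show "inv\<^bsub>G Mod N\<^esub> p b \<otimes>\<^bsub>G Mod N\<^esub> p c \<otimes>\<^bsub>G Mod N\<^esub> p b \<otimes>\<^bsub>G Mod N\<^esub> inv\<^bsub>G Mod N\<^esub> p c \<otimes>\<^bsub>G Mod N\<^esub> p a =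
       p a \<otimes>\<^bsub>G Mod N\<^esub> (inv\<^bsub>G Mod N\<^esub> p b \<otimes>\<^bsub>G Mod N\<^esub> p c \<otimes>\<^bsub>G Mod N\<^esub> p b \<otimes>\<^bsub>G Mod N\<^esub> inv\<^bsub>G Mod N\<^esub> p c)"
      unfolding e[OF G(2)] using iff[of "comm G (inv b) c" a] fa G by simp
    show "inv\<^bsub>G Mod N\<^esub> p a \<otimes>\<^bsub>G Mod N\<^esub> p c \<otimes>\<^bsub>G Mod N\<^esub> p a \<otimes>\<^bsub>G Mod N\<^esub> inv\<^bsub>G Mod N\<^esub> p c \<otimes>\<^bsub>G Mod N\<^esub>
       (inv\<^bsub>G Mod N\<^esub> p b \<otimes>\<^bsub>G Mod N\<^esub> p c \<otimes>\<^bsub>G Mod N\<^esub> p b \<otimes>\<^bsub>G Mod N\<^esub> inv\<^bsub>G Mod N\<^esub> p c) =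
       (inv\<^bsub>G Mod N\<^esub> p b \<otimes>\<^bsub>G Mod N\<^esub> p c \<otimes>\<^bsub>G Mod N\<^esub> p b \<otimes>\<^bsub>G Mod N\<^esub> inv\<^bsub>G Mod N\<^esub> p c) \<otimes>\<^bsub>G Mod N\<^esub>
       (inv\<^bsub>G Mod N\<^esub> p a \<otimes>\<^bsub>G Mod N\<^esub> p c \<otimes>\<^bsub>G Mod N\<^esub> p a \<otimes>\<^bsub>G Mod N\<^esub> inv\<^bsub>G Mod N\<^esub> p c)"
      unfolding e[OF G(1)] e[OF G(2)] using iff[of "comm G (inv a) c" "comm G (inv b) c"] ef G by simp
  qed (use G pc in auto)
  then show ?thesis using iff[of "comm G a b" c] G by (simp add: pcomm)
qed

end

section \<open>The lower central series of a subgroup\<close>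

lemma (in group) commutator_subgroup_subgroup:
  assumes "H \<subseteq> carrier G" "K \<subseteq> carrier G"
  shows "subgroup (commutator_subgroup G H K) G"
  unfolding commutator_subgroup_comm using assms comm_closed
  by (intro generate_is_subgroup) blast

lemma (in group) lower_central_subgroup:
  assumes "subgroup K G"
  shows "subgroup (lower_central G K j) G"
proof (induction j)
  case (Suc j)
  show ?case
  proof (cases "j = 0")
    case False
    then show ?thesis using Suc assms
      by (auto simp: lower_central_Suc intro!: commutator_subgroup_subgroup dest: subgroup.subset)
  qed (use assms in simp)
qed (use assms in simp)

lemma (in group) comm_mem_commutator_subgroup:
  "\<lbrakk>h \<in> H; k \<in> K\<rbrakk> \<Longrightarrow> comm G h k \<in> commutator_subgroup G H K"
  unfolding commutator_subgroup_comm by (rule generate.incl) auto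

lemma (in group_hom) hom_comm:
  "\<lbrakk>x \<in> carrier G; y \<in> carrier G\<rbrakk> \<Longrightarrow> h (comm G x y) = comm H (h x) (h y)"
  by (simp add: comm_def)

text \<open>Functoriality is used with inclusions for monotonicity, with conjugations for normality,
  and with \<open>kill\<close>, \<open>ext\<close>, \<open>push_hom\<close> and \<open>inner\<close>
  to carry depth between free groups and groups of automorphisms.\<close>

lemma (in group_hom) lower_central_image:
  assumes K: "subgroup K G" and L: "subgroup L H" and "h ` K \<subseteq> L"
  shows "h ` lower_central G K j \<subseteq> lower_central H L j"
proof (induction j)
  case (Suc j)
  show ?case
  proof (cases "j = 0")
    case False
    have Kc: "K \<subseteq> carrier G" "lower_central G K j \<subseteq> carrier G"
      using K G.lower_central_subgroup[OF K, of j] by (auto dest: subgroup.subset)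
    have "{comm G a b | a b. a \<in> K \<and> b \<in> lower_central G K j} \<subseteq> carrier G"
      using Kc G.comm_closed by blast
    then have "h ` lower_central G K (Suc j) = generate H (h ` {comm G a b | a b. a \<in> K \<and> b \<in> lower_central G K j})"
      using False by (simp add: lower_central_Suc commutator_subgroup_comm generate_img)
    also have "\<dots> \<subseteq> lower_central H L (Suc j)"
    proof (rule H.generate_subgroup_incl)
      show "h ` {comm G a b | a b. a \<in> K \<and> b \<in> lower_central G K j} \<subseteq> lower_central H L (Suc j)"
      proof clarify
        fix a b assume ab: "a \<in> K" "b \<in> lower_central G K j"
        then have "h a \<in> L" "h b \<in> lower_central H L j" using Suc assms(3) by auto
        then have "comm H (h a) (h b) \<in> lower_central H L (Suc j)"
          using False by (simp add: lower_central_Suc H.comm_mem_commutator_subgroup)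
        then show "h (comm G a b) \<in> lower_central H L (Suc j)"
          using ab Kc by (simp add: hom_comm subset_iff)
      qed
    qed (rule H.lower_central_subgroup[OF L])
    finally show ?thesis .
  qed (use assms in simp)
qed (use assms in simp)

context group
begin

lemma lower_central_mono:
  assumes "subgroup K G" "subgroup L G" "K \<subseteq> L"
  shows "lower_central G K j \<subseteq> lower_central G L j"
proof -
  interpret group_hom G G "\<lambda>x. x" by unfold_locales (auto simp: hom_def)
  show ?thesis using lower_central_image[OF assms(1,2), of j] assms(3) by simp
qed

lemma lcs_subgroup: "subgroup (lcs G k) G"
  by (rule lower_central_subgroup) (rule subgroup_self)

lemma lcs_carrier: "lcs G k \<subseteq> carrier G"
  using lcs_subgroup by (rule subgroup.subset)

lemma lcs_in_carrier [dest]: "x \<in> lcs G k \<Longrightarrow> x \<in> carrier G"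
  using lcs_carrier by blast

lemma comm_lcs_Suc: "\<lbrakk>g \<in> carrier G; a \<in> lcs G k; k \<ge> 1\<rbrakk> \<Longrightarrow> comm G g a \<in> lcs G (Suc k)"
  by (simp add: lower_central_Suc comm_mem_commutator_subgroup)

lemma lcs_normal: "lcs G k \<lhd> G"
proof (rule normal_invI)
  show "subgroup (lcs G k) G" by (rule lcs_subgroup)
next
  fix x h assume x: "x \<in> carrier G" and h: "h \<in> lcs G k"
  interpret c: group_hom G G "\<lambda>y. x \<otimes> y \<otimes> inv x"
    using x by unfold_locales (auto simp: hom_def word_simps)
  have "(\<lambda>y. x \<otimes> y \<otimes> inv x) ` lcs G k \<subseteq> lcs G k"
    by (rule c.lower_central_image) (use x subgroup_self in auto)
  then show "x \<otimes> h \<otimes> inv x \<in> lcs G k" using h by blast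
qed

lemma lcs_Suc_subset: "lcs G (Suc k) \<subseteq> lcs G k"
proof (cases "k = 0")
  case False
  interpret N: normal "lcs G k" G by (rule lcs_normal)
  show ?thesis
    using False unfolding lower_central_Suc[of k] commutator_subgroup_comm
  proof (simp add: lower_central_Suc commutator_subgroup_comm, intro generate_subgroup_incl lcs_subgroup, clarify)
    fix a b assume ab: "a \<in> carrier G" "b \<in> lcs G k"
    have "comm G a b = (a \<otimes> b \<otimes> inv a) \<otimes> inv b" by (simp add: comm_def)
    also have "\<dots> \<in> lcs G k"
      using ab N.inv_op_closed2[of a b] by simp
    finally show "comm G a b \<in> lcs G k" .
  qed
qed simp

lemma lcs_antimono: "i \<le> j \<Longrightarrow> lcs G j \<subseteq> lcs G i"
  using lcs_Suc_subset lift_Suc_antimono_le[of "lcs G"] by blast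

text \<open>Write \<open>a\<close> through commutators [g, c] with c in Gamma_i. Then
  \<open>comm_comm_mem\<close> asks for brackets of [g^-1, b] and [c^-1, b], all covered by
  induction on \<open>i\<close>; the index \<open>j\<close> stays arbitrary because the hypothesis
  is used at \<open>Suc j\<close>. Index 0 is the dummy value G, so those cases only express
  normality.\<close>

lemma comm_lcs:
  "\<lbrakk>a \<in> lcs G i; b \<in> lcs G j\<rbrakk> \<Longrightarrow> comm G a b \<in> lcs G (i + j)"
proof (induction i arbitrary: j a b)
  case 0
  show ?case
  proof (cases "j = 0")
    case False
    then show ?thesis using 0 comm_lcs_Suc[of a b j] lcs_Suc_subset[of j] by auto
  qed (use 0 in simp)
next
  case (Suc i)
  show ?case
  proof (cases "j = 0")
    case True
    then have "b \<in> carrier G" using Suc by auto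
    then have "comm G b a \<in> lcs G (Suc (Suc i))"
      using comm_lcs_Suc[of b a "Suc i"] Suc.prems by simp
    then have "comm G b a \<in> lcs G (Suc i)" using lcs_Suc_subset by blast
    then show ?thesis
      using True Suc.prems \<open>b \<in> carrier G\<close> by (auto intro: comm_swap_mem[OF lcs_subgroup])
  next
    case j: False
    have b: "b \<in> carrier G" using Suc.prems by auto
    show ?thesis
    proof (cases "i = 0")
      case True
      then show ?thesis using j Suc.prems comm_lcs_Suc[of a b j] by simp
    next
      case i: False
      have a: "a \<in> generate G {comm G g c | g c. g \<in> carrier G \<and> c \<in> lcs G i}"
        using Suc.prems i by (simp add: lower_central_Suc commutator_subgroup_comm)
      show ?thesis
      proof (rule comm_generate_mem[OF lcs_normal b _ a])
        fix s assume "s \<in> {comm G g c | g c. g \<in> carrier G \<and> c \<in> lcs G i}"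
        then obtain g c where s: "s = comm G g c" and g: "g \<in> carrier G" and c: "c \<in> lcs G i" by blast
        have cG: "c \<in> carrier G" using c by auto
        have ci: "inv c \<in> lcs G i" using c lcs_subgroup by (simp add: subgroup.m_inv_closed)
        have e: "comm G (inv g) b \<in> lcs G (Suc j)"
          using g Suc.prems j by (simp add: comm_lcs_Suc)
        have f: "comm G (inv c) b \<in> lcs G (i + j)"
          using ci Suc.prems by (intro Suc.IH)
        have "comm G c (comm G (inv g) b) \<in> lcs G (i + Suc j)"
          using c e by (rule Suc.IH)
        then have 1: "comm G (comm G (inv g) b) c \<in> lcs G (Suc i + j)"
          using cG e by (auto intro: comm_swap_mem[OF lcs_subgroup])
        have "comm G g (comm G (inv c) b) \<in> lcs G (Suc (i + j))"
          using g f i by (simp add: comm_lcs_Suc)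
        then have 2: "comm G (comm G (inv c) b) g \<in> lcs G (Suc i + j)"
          using g f by (auto intro: comm_swap_mem[OF lcs_subgroup])
        have "comm G (comm G (inv g) b) (comm G (inv c) b) \<in> lcs G (Suc (i + j))"
          using e f i by (intro comm_lcs_Suc) auto
        then show "comm G s b \<in> lcs G (Suc i + j)"
          unfolding s by (intro comm_comm_mem[OF lcs_normal g cG b 1 2]) simp
      qed (use lcs_in_carrier in auto)
    qed
  qed
qed

text \<open>Gamma_m is central modulo Gamma_{m+1}, so every subgroup in between is normal.\<close>

lemma normal_between_lcs:
  assumes H: "subgroup H G" and "lcs G (Suc m) \<subseteq> H" "H \<subseteq> lcs G m" "m \<ge> 1"
  shows "H \<lhd> G"
proof (rule normal_invI[OF H])
  fix x h assume xh: "x \<in> carrier G" "h \<in> H"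
  then have "comm G x h \<in> H" using assms comm_lcs_Suc[of x h m] by blast
  then show "x \<otimes> h \<otimes> inv x \<in> H"
    using xh H by (simp add: conj_eq_comm subgroup.m_closed subgroup.mem_carrier)
qed

end


section \<open>Words\<close>

abbreviation wmult :: "word \<Rightarrow> word \<Rightarrow> word" (infixr "\<star>" 70)
  where "u \<star> v \<equiv> foldr push u v"

definition winv :: "word \<Rightarrow> word"
  where "winv u = rev (map inv_letter u)"

global_interpretation F: group "free_group n" for n
  by (rule group_free_group)

lemma mult_free_group [simp]: "x \<otimes>\<^bsub>free_group n\<^esub> y = x \<star> y"
  by (simp add: free_group_def)

lemma one_free_group [simp]: "\<one>\<^bsub>free_group n\<^esub> = []"
  by (simp add: free_group_def)

lemma mem_free_group: "w \<in> carrier (free_group n) \<longleftrightarrow> reduced w \<and> fst ` set w \<subseteq> {1..n}"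
  by (simp add: free_group_def)

lemma winv_closed: "w \<in> carrier (free_group n) \<Longrightarrow> winv w \<in> carrier (free_group n)"
  by (force simp: winv_def mem_free_group reduced_inverse image_iff)

lemma inv_free_group:
  assumes "w \<in> carrier (free_group n)"
  shows "inv\<^bsub>free_group n\<^esub> w = winv w"
  using assms winv_closed[OF assms] foldr_push_inverse[of w]
  by (intro F.inv_equality) (auto simp: winv_def)

lemma free_group_mono: "m \<le> n \<Longrightarrow> carrier (free_group m) \<subseteq> carrier (free_group n)"
  by (fastforce simp: mem_free_group)

lemma gen_closed [simp]: "gen i \<in> carrier (free_group n) \<longleftrightarrow> i \<in> {1..n}"
  by (simp add: mem_free_group gen_def reduced_Cons)

lemma winv_gen: "winv (gen i) = [(i, False)]"
  by (simp add: winv_def gen_def inv_letter_def)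

lemma free_group_Cons:
  assumes "a # w \<in> carrier (free_group n)"
  shows "[a] \<in> carrier (free_group n)" "w \<in> carrier (free_group n)" "a # w = [a] \<star> w"
  using assms push_reduced[of a w] by (auto simp: mem_free_group reduced_Cons)

lemma free_group_induct [consumes 1, case_names one gen inv mult]:
  assumes "w \<in> carrier (free_group n)"
    and one: "P []" and gen: "\<And>i. i \<in> {1..n} \<Longrightarrow> P (gen i)"
    and inv: "\<And>x. \<lbrakk>x \<in> carrier (free_group n); P x\<rbrakk> \<Longrightarrow> P (inv\<^bsub>free_group n\<^esub> x)"
    and mult: "\<And>x y. \<lbrakk>x \<in> carrier (free_group n); y \<in> carrier (free_group n); P x; P y\<rbrakk> \<Longrightarrow> P (x \<otimes>\<^bsub>free_group n\<^esub> y)"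
  shows "P w"
  using assms(1)
proof (induction w)
  case Nil
  show ?case by (rule one)
next
  case (Cons a w)
  note aw = free_group_Cons[OF Cons.prems]
  have i: "fst a \<in> {1..n}" using Cons.prems by (simp add: mem_free_group)
  have "P [a]"
  proof (cases "snd a")
    case True
    then have "[a] = gen (fst a)" by (simp add: gen_def prod_eq_iff)
    then show ?thesis using gen[OF i] by simp
  next
    case False
    then have "[a] = inv\<^bsub>free_group n\<^esub> (gen (fst a))"
      using i by (simp add: inv_free_group winv_gen prod_eq_iff)
    then show ?thesis using gen[OF i] inv[of "gen (fst a)"] i by simp
  qed
  then show ?case using mult[OF aw(1,2)] Cons.IH aw by simp
qed

lemma generate_gens: "generate (free_group n) (gen ` {1..n}) = carrier (free_group n)"
proof
  show "generate (free_group n) (gen ` {1..n}) \<subseteq> carrier (free_group n)"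
    by (rule F.generate_incl) auto
  show "carrier (free_group n) \<subseteq> generate (free_group n) (gen ` {1..n})"
  proof
    fix w assume "w \<in> carrier (free_group n)"
    then show "w \<in> generate (free_group n) (gen ` {1..n})"
    proof (induction rule: free_group_induct)
      case one
      then show ?case using generate.one[of "free_group n"] by simp
    next
      case (inv x)
      then show ?case by (intro F.generate_m_inv_closed) auto
    next
      case (mult x y)
      then show ?case by (intro generate.eng)
    qed (auto intro: generate.intros)
  qed
qed

lemma free_group_hom_eq:
  assumes "group H" "f \<in> hom (free_group n) H" "g \<in> hom (free_group n) H"
    and "\<And>i. i \<in> {1..n} \<Longrightarrow> f (gen i) = g (gen i)" and w: "w \<in> carrier (free_group n)"
  shows "f w = g w"
proof -
  interpret f: group_hom "free_group n" H f using assms(1,2) by (simp add: group_hom_def group_hom_axioms_def group_free_group)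
  interpret g: group_hom "free_group n" H g
    using assms(1,3) by (simp add: group_hom_def group_hom_axioms_def group_free_group)
  show ?thesis using w
  proof (induction rule: free_group_induct)
    case one
    then show ?case using f.hom_one g.hom_one by simp
  next
    case (gen i) then show ?case by (rule assms(4))
  next
    case (inv x) then show ?case by (simp only: f.hom_inv g.hom_inv)
  next
    case (mult x y) then show ?case by (simp only: f.hom_mult g.hom_mult)
  qed
qed


section \<open>The Magnus expansion\<close>

text \<open>Noncommutative power series over the integers, by their coefficients on words.\<close>

typedef ncps = "UNIV :: (nat list \<Rightarrow> int) set"
  morphisms coef Ncps by simp

setup_lifting type_definition_ncps

lemma ncps_eqI: "(\<And>u. coef f u = coef g u) \<Longrightarrow> f = g"
  by (metis coef_inject ext)

text \<open>The Cauchy product on the free monoid, a sum over all ways of cutting the word in two.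
  Recursion on the first letter replaces \<open>f\<close> by its left derivative, so that the ring
  laws become inductions on the word.\<close>

fun conv :: "(nat list \<Rightarrow> int) \<Rightarrow> (nat list \<Rightarrow> int) \<Rightarrow> nat list \<Rightarrow> int" where
  "conv f g [] = f [] * g []"
| "conv f g (a # u) = f [] * g (a # u) + conv (\<lambda>v. f (a # v)) g u"

lemma conv_add_left: "conv (\<lambda>u. f u + f' u) g u = conv f g u + conv f' g u"
  by (induction u arbitrary: f f') (auto simp: algebra_simps)

lemma conv_add_right: "conv f (\<lambda>u. g u + g' u) u = conv f g u + conv f g' u"
  by (induction u arbitrary: f) (auto simp: algebra_simps)

lemma conv_scale_left: "conv (\<lambda>u. c * f u) g u = c * conv f g u"
  by (induction u arbitrary: f) (auto simp: algebra_simps)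

lemma conv_zero_left: "conv (\<lambda>u. 0) g u = 0"
  by (induction u) auto

lemma conv_assoc: "conv (conv f g) h u = conv f (conv g h) u"
proof (induction u arbitrary: f)
  case (Cons a u)
  have "conv (\<lambda>v. conv f g (a # v)) h u
      = conv (\<lambda>v. f [] * g (a # v)) h u + conv (conv (\<lambda>v. f (a # v)) g) h u"
    by (simp add: conv_add_left)
  then show ?case using Cons.IH[of "\<lambda>v. f (a # v)"]
    by (simp add: conv_scale_left algebra_simps)
qed simp

definition unit_coef :: "nat list \<Rightarrow> int"
  where "unit_coef u = (if u = [] then 1 else 0)"

lemma conv_unit_left: "conv unit_coef g u = g u"
  by (cases u) (auto simp: unit_coef_def conv_zero_left)

lemma conv_unit_right: "conv f unit_coef u = f u"
  by (induction u arbitrary: f) (auto simp: unit_coef_def)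

instantiation ncps :: ring_1
begin
lift_definition zero_ncps :: ncps is "\<lambda>u. 0" .
lift_definition one_ncps :: ncps is unit_coef .
lift_definition plus_ncps :: "ncps \<Rightarrow> ncps \<Rightarrow> ncps" is "\<lambda>f g u. f u + g u" .
lift_definition minus_ncps :: "ncps \<Rightarrow> ncps \<Rightarrow> ncps" is "\<lambda>f g u. f u - g u" .
lift_definition uminus_ncps :: "ncps \<Rightarrow> ncps" is "\<lambda>f u. - f u" .
lift_definition times_ncps :: "ncps \<Rightarrow> ncps \<Rightarrow> ncps" is conv .
instance
  by standard
    (transfer; auto simp: fun_eq_iff conv_assoc conv_add_left conv_add_right
      conv_unit_left conv_unit_right unit_coef_def)+
end

lemma coef_simps [simp]:
  "coef 0 u = 0" "coef (f + g) u = coef f u + coef g u" "coef (f - g) u = coef f u - coef g u"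
  "coef (- f) u = - coef f u"
  by (transfer; simp)+

lemma coef_one: "coef 1 u = (if u = [] then 1 else 0)"
  by transfer (simp add: unit_coef_def)

lemma coef_mult: "coef (f * g) u = conv (coef f) (coef g) u"
  by transfer simp

text \<open>\<open>aug k\<close> is the \<open>k\<close>-th power of the augmentation ideal.\<close>

definition aug :: "nat \<Rightarrow> ncps set"
  where "aug k = {f. \<forall>u. length u < k \<longrightarrow> coef f u = 0}"

lemma conv_vanish:
  "\<lbrakk>\<forall>u. length u < i \<longrightarrow> f u = 0; \<forall>u. length u < j \<longrightarrow> g u = 0; length u < i + j\<rbrakk> \<Longrightarrow> conv f g u = 0"
proof (induction u arbitrary: f i)
  case Nil then show ?case by (cases i) auto
next
  case (Cons a u)
  show ?case
  proof (cases i)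
    case 0
    then show ?thesis using Cons.IH[of 0 "\<lambda>v. f (a # v)"] Cons.prems by auto
  next
    case (Suc i')
    then have "conv (\<lambda>v. f (a # v)) g u = 0" using Cons.prems by (intro Cons.IH[of i']) auto
    then show ?thesis using Suc Cons.prems(1) by simp
  qed
qed

text \<open>In total degree \<open>i + j\<close> every cut other than the one after \<open>i\<close>
  letters leaves a factor in a degree where it vanishes.\<close>

lemma conv_lead:
  "\<lbrakk>\<forall>u. length u < i \<longrightarrow> f u = 0; \<forall>u. length u < j \<longrightarrow> g u = 0; length u = i + j\<rbrakk>
    \<Longrightarrow> conv f g u = f (take i u) * g (drop i u)"
proof (induction u arbitrary: f i)
  case Nil then show ?case by auto
next
  case (Cons a u)
  show ?case
  proof (cases i)
    case 0
    then have "conv (\<lambda>v. f (a # v)) g u = 0"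
      using Cons.prems by (intro conv_vanish[of 0 _ j]) auto
    then show ?thesis using 0 by simp
  next
    case (Suc i')
    then have "conv (\<lambda>v. f (a # v)) g u = f (a # take i' u) * g (drop i' u)"
      using Cons.prems by (intro Cons.IH[of i' "\<lambda>v. f (a # v)"]) auto
    then show ?thesis using Suc Cons.prems(1) by simp
  qed
qed

lemma aug_mult: "\<lbrakk>f \<in> aug i; g \<in> aug j\<rbrakk> \<Longrightarrow> f * g \<in> aug (i + j)"
  using conv_vanish[of i "coef f" j "coef g"] by (simp add: aug_def coef_mult)

lemma aug_lead: "\<lbrakk>f \<in> aug i; g \<in> aug j; length u = i + j\<rbrakk>
    \<Longrightarrow> coef (f * g) u = coef f (take i u) * coef g (drop i u)"
  using conv_lead[of i "coef f" j "coef g"] by (simp add: aug_def coef_mult)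

lemma aug_0 [simp]: "f \<in> aug 0"
  by (simp add: aug_def)

lemma aug_closed:
  "0 \<in> aug k" "\<lbrakk>f \<in> aug k; g \<in> aug k\<rbrakk> \<Longrightarrow> f + g \<in> aug k" "\<lbrakk>f \<in> aug k; g \<in> aug k\<rbrakk> \<Longrightarrow> f - g \<in> aug k"
  "f \<in> aug k \<Longrightarrow> f * g \<in> aug k" "f \<in> aug k \<Longrightarrow> g * f \<in> aug k"
  using aug_mult[of f k g 0] aug_mult[of g 0 f k] by (auto simp: aug_def)

lemma aug_antimono: "i \<le> j \<Longrightarrow> aug j \<subseteq> aug i"
  by (auto simp: aug_def)

section \<open>The Magnus embedding of the free group\<close>

lift_definition var :: "nat \<Rightarrow> ncps" is "\<lambda>i u. if u = [i] then 1 else 0" .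

text \<open>The geometric series 1 - X_i + X_i^2 - ..., inverse to 1 + X_i, which is where the
  inverse of a generator goes.\<close>

lift_definition geom :: "nat \<Rightarrow> ncps" is "\<lambda>i u. if set u \<subseteq> {i} then (-1) ^ length u else 0" .

lemma coef_var: "coef (var i) u = (if u = [i] then 1 else 0)"
  by transfer simp

lemma coef_geom: "coef (geom i) u = (if set u \<subseteq> {i} then (-1) ^ length u else 0)"
  by transfer simp

lemma coef_var_mult: "coef (var i * f) (a # u) = (if a = i then coef f u else 0)" "coef (var i * f) [] = 0"
proof -
  have "(\<lambda>v. coef (var i) (i # v)) = unit_coef" by (auto simp: coef_var unit_coef_def)
  then show "coef (var i * f) (a # u) = (if a = i then coef f u else 0)"
    by (auto simp: coef_mult coef_var conv_zero_left conv_unit_left)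
qed (simp add: coef_mult coef_var)

lemma coef_mult_var: "coef (f * var i) (u @ [a]) = (if a = i then coef f u else 0)" "coef (f * var i) [] = 0"
proof -
  have "conv c (coef (var i)) (u @ [a]) = (if a = i then c u else 0)" for c
    by (induction u arbitrary: c) (auto simp: coef_var)
  then show "coef (f * var i) (u @ [a]) = (if a = i then coef f u else 0)"
    by (simp add: coef_mult)
qed (simp add: coef_mult coef_var)

lemma var_geom: "(1 + var i) * geom i = 1"
proof (rule ncps_eqI)
  fix u show "coef ((1 + var i) * geom i) u = coef 1 u"
    by (cases u) (auto simp: distrib_right coef_var_mult coef_geom coef_one)
qed

lemma geom_var: "geom i * (1 + var i) = 1"
proof (rule ncps_eqI)
  fix u show "coef (geom i * (1 + var i)) u = coef 1 u"
    by (cases u rule: rev_cases) (auto simp: distrib_left coef_mult_var coef_geom coef_one)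
qed

definition letter_exp :: "letter \<Rightarrow> ncps"
  where "letter_exp a = (if snd a then 1 + var (fst a) else geom (fst a))"

definition magnus :: "word \<Rightarrow> ncps"
  where "magnus w = foldr (\<lambda>a f. letter_exp a * f) w 1"

lemma magnus_simps [simp]: "magnus [] = 1" "magnus (a # w) = letter_exp a * magnus w"
  by (simp_all add: magnus_def)

lemma letter_exp_inverse: "letter_exp a * letter_exp (inv_letter a) = 1"
  by (simp add: letter_exp_def inv_letter_def var_geom geom_var)

lemma magnus_push: "magnus (push a w) = letter_exp a * magnus w"
proof (cases w)
  case (Cons b v)
  then show ?thesis using letter_exp_inverse[of a] by (auto simp flip: mult.assoc)
qed simp

lemma magnus_mult: "magnus (u \<star> v) = magnus u * magnus v"
  by (induction u) (auto simp: magnus_push mult.assoc)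

lemma magnus_inverse_left:
  assumes "x \<in> carrier (free_group n)"
  shows "magnus (inv\<^bsub>free_group n\<^esub> x) * magnus x = 1"
  using magnus_mult[of "inv\<^bsub>free_group n\<^esub> x" x] F.l_inv[OF assms] by simp

lemma magnus_inverse_right:
  assumes "x \<in> carrier (free_group n)"
  shows "magnus x * magnus (inv\<^bsub>free_group n\<^esub> x) = 1"
  using magnus_mult[of x "inv\<^bsub>free_group n\<^esub> x"] F.r_inv[OF assms] by simp

lemma magnus_aug_1: "magnus w - 1 \<in> aug 1"
proof -
  have "coef (magnus w) [] = 1"
    by (induction w) (auto simp: coef_mult letter_exp_def coef_one coef_var coef_geom)
  then show ?thesis by (simp add: aug_def coef_one)
qed

text \<open>Write x and y for the two series. Then x y - y x = (x - 1)(y - 1) - (y - 1)(x - 1), and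
  right multiplication by the inverse of y x turns the left side into [x, y] - 1.\<close>

lemma magnus_comm:
  assumes "x \<in> carrier (free_group n)" "y \<in> carrier (free_group n)"
  shows "magnus (comm (free_group n) x y) - 1
    = ((magnus x - 1) * (magnus y - 1) - (magnus y - 1) * (magnus x - 1))
      * (magnus (inv\<^bsub>free_group n\<^esub> x) * magnus (inv\<^bsub>free_group n\<^esub> y))"
proof -
  have "magnus y * magnus x * (magnus (inv\<^bsub>free_group n\<^esub> x) * magnus (inv\<^bsub>free_group n\<^esub> y))
      = magnus y * (magnus x * magnus (inv\<^bsub>free_group n\<^esub> x)) * magnus (inv\<^bsub>free_group n\<^esub> y)"
    by (simp add: mult.assoc)
  also have "\<dots> = 1" using assms by (simp add: magnus_inverse_right)
  finally show ?thesis
    by (simp add: comm_def magnus_mult algebra_simps)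
qed

text \<open>The elements congruent to 1 modulo a power of the augmentation ideal. Depth is measured
  here by coefficients; \<open>dimension_subgroup_eq_lcs\<close> identifies these subgroups with the
  lower central series.\<close>

definition dimension_subgroup :: "nat \<Rightarrow> nat \<Rightarrow> word set"
  where "dimension_subgroup n k = {w \<in> carrier (free_group n). magnus w - 1 \<in> aug k}"

lemma dimension_subgroup_is_subgroup: "subgroup (dimension_subgroup n k) (free_group n)"
proof
  fix x y assume xy: "x \<in> dimension_subgroup n k" "y \<in> dimension_subgroup n k"
  have "magnus (x \<star> y) - 1 = (magnus x - 1) * magnus y + (magnus y - 1)"
    by (simp add: magnus_mult algebra_simps)
  also have "\<dots> \<in> aug k" using xy by (intro aug_closed(2)[OF aug_closed(4)]) (auto simp: dimension_subgroup_def)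
  finally show "x \<otimes>\<^bsub>free_group n\<^esub> y \<in> dimension_subgroup n k"
    using xy F.m_closed[of x n y] by (simp add: dimension_subgroup_def)
next
  fix x assume x: "x \<in> dimension_subgroup n k"
  then have "magnus (inv\<^bsub>free_group n\<^esub> x) - 1 = 0 - magnus (inv\<^bsub>free_group n\<^esub> x) * (magnus x - 1)"
    using magnus_inverse_left[of x n] by (auto simp: dimension_subgroup_def algebra_simps)
  then show "inv\<^bsub>free_group n\<^esub> x \<in> dimension_subgroup n k"
    using x unfolding dimension_subgroup_def by (auto simp: aug_closed simp del: diff_0)
qed (auto simp: dimension_subgroup_def aug_closed mem_free_group)

lemma comm_dimension_subgroup:
  assumes "x \<in> dimension_subgroup n i" "y \<in> dimension_subgroup n j"
  shows "comm (free_group n) x y \<in> dimension_subgroup n (i + j)"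
proof -
  have xy: "x \<in> carrier (free_group n)" "y \<in> carrier (free_group n)"
    "magnus x - 1 \<in> aug i" "magnus y - 1 \<in> aug j"
    using assms by (auto simp: dimension_subgroup_def)
  have "magnus (comm (free_group n) x y) - 1 \<in> aug (i + j)"
    using aug_mult[OF xy(3,4)] aug_mult[OF xy(4,3)] unfolding magnus_comm[OF xy(1,2)]
    by (auto intro!: aug_closed(4)[OF aug_closed(3)[of "_ * _" _ "_ * _"]] simp: add.commute)
  then show ?thesis using xy by (simp add: dimension_subgroup_def)
qed

lemma lcs_subset_dimension: "lcs (free_group n) k \<subseteq> dimension_subgroup n k"
proof (induction k)
  case (Suc k)
  show ?case
  proof (cases "k = 0")
    case True
    then show ?thesis using magnus_aug_1 by (auto simp: dimension_subgroup_def)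
  next
    case False
    have "comm (free_group n) a b \<in> dimension_subgroup n (Suc k)"
      if "a \<in> carrier (free_group n)" "b \<in> lcs (free_group n) k" for a b
    proof -
      have "a \<in> dimension_subgroup n 1"
        using that magnus_aug_1 by (simp add: dimension_subgroup_def)
      then show ?thesis using that Suc comm_dimension_subgroup[of a n 1 b k] by auto
    qed
    then have "{comm (free_group n) a b | a b. a \<in> carrier (free_group n) \<and> b \<in> lcs (free_group n) k}
        \<subseteq> dimension_subgroup n (Suc k)"
      by blast
    then show ?thesis
      using False by (simp add: lower_central_Suc commutator_subgroup_comm
          F.generate_subgroup_incl dimension_subgroup_is_subgroup)
  qed
qed (simp add: dimension_subgroup_def)

text \<open>The lowest part of a group commutator is the Lie bracket of the lowest parts: the right
  factor in \<open>magnus_comm\<close> has constant term 1 and does not affect degree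
  \<open>i + j\<close>.\<close>

lemma coef_comm_lead:
  assumes "x \<in> dimension_subgroup n i" "y \<in> dimension_subgroup n j" "length u = i + j" "i \<ge> 1" "j \<ge> 1"
  shows "coef (magnus (comm (free_group n) x y)) u
    = coef (magnus x) (take i u) * coef (magnus y) (drop i u)
      - coef (magnus y) (take j u) * coef (magnus x) (drop j u)"
proof -
  have xy: "x \<in> carrier (free_group n)" "y \<in> carrier (free_group n)"
    "magnus x - 1 \<in> aug i" "magnus y - 1 \<in> aug j"
    using assms by (auto simp: dimension_subgroup_def)
  define c where "c = (magnus x - 1) * (magnus y - 1) - (magnus y - 1) * (magnus x - 1)"
  define r where "r = magnus (inv\<^bsub>free_group n\<^esub> x) * magnus (inv\<^bsub>free_group n\<^esub> y)"
  have c: "c \<in> aug (i + j)"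
    unfolding c_def using xy aug_mult[of "magnus x - 1" i "magnus y - 1" j] aug_mult[of "magnus y - 1" j "magnus x - 1" i]
    by (auto simp: add.commute intro!: aug_closed)
  have r: "coef r [] = 1"
    using magnus_aug_1[of "inv\<^bsub>free_group n\<^esub> x"] magnus_aug_1[of "inv\<^bsub>free_group n\<^esub> y"]
    by (auto simp: r_def coef_mult aug_def coef_one)
  have "coef (magnus (comm (free_group n) x y) - 1) u = coef (c * r) u"
    using xy by (simp add: magnus_comm c_def r_def)
  also have "\<dots> = coef c u"
    using aug_lead[of c "i + j" r 0 u] c r assms by simp
  also have "\<dots> = coef (magnus x - 1) (take i u) * coef (magnus y - 1) (drop i u)
      - coef (magnus y - 1) (take j u) * coef (magnus x - 1) (drop j u)"
    unfolding c_def using xy assms aug_lead[of "magnus x - 1" i "magnus y - 1" j u]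
      aug_lead[of "magnus y - 1" j "magnus x - 1" i u] by simp
  finally have "coef (magnus (comm (free_group n) x y) - 1) u = \<dots>" .
  moreover have "u \<noteq> []" "take i u \<noteq> []" "take j u \<noteq> []" "drop i u \<noteq> []" "drop j u \<noteq> []"
    using assms(3-5) by auto
  ultimately show ?thesis by (simp add: coef_one)
qed

text \<open>The mixed term (x - 1)(y - 1) starts in degree 2k > k, so coefficients in degree k are
  additive.\<close>

lemma coef_mult_lead:
  assumes "x \<in> dimension_subgroup n k" "y \<in> dimension_subgroup n k" "length u = k" "k \<ge> 1"
  shows "coef (magnus (x \<star> y)) u = coef (magnus x) u + coef (magnus y) u"
proof -
  have "magnus (x \<star> y) = (magnus x - 1) * (magnus y - 1) + magnus x + magnus y - 1"
    by (simp add: magnus_mult algebra_simps)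
  moreover have "(magnus x - 1) * (magnus y - 1) \<in> aug (k + k)"
    using assms by (intro aug_mult) (auto simp: dimension_subgroup_def)
  ultimately show ?thesis using assms by (auto simp: coef_one aug_def)
qed


section \<open>Lyndon words and the lower central series of a free group\<close>

text \<open>The length bound excludes that \<open>a\<close> is a proper prefix of \<open>b\<close>,
  so the comparison is decided at a letter and survives any continuation.\<close>

lemma lex_append_less: "\<lbrakk>(a :: nat list) < b; length b \<le> length a\<rbrakk> \<Longrightarrow> a @ x < b @ y"
proof (induction a arbitrary: b)
  case (Cons c a)
  then show ?case by (cases b) (auto simp: Cons_less_Cons)
qed auto

lemma lex_append_mono [simp]: "(u :: nat list) @ s < u @ t \<longleftrightarrow> s < t"
  by (induction u) (auto simp: Cons_less_Cons)

lemma lex_prefix_less: "s \<noteq> [] \<Longrightarrow> (u :: nat list) < u @ s"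
  using lex_append_mono[of u "[]" s] by (cases s) auto

lemma lex_prefix_le: "(u :: nat list) \<le> u @ s"
  using lex_prefix_less[of s u] by (cases "s = []") auto

definition lyndon :: "nat list \<Rightarrow> bool"
  where "lyndon w \<longleftrightarrow> w \<noteq> [] \<and> (\<forall>s t. w = s @ t \<longrightarrow> s \<noteq> [] \<longrightarrow> t \<noteq> [] \<longrightarrow> w < t)"

text \<open>The delicate case is v = u v2, where the comparison of \<open>u\<close> with
  \<open>v\<close> is not decided at a letter. There v < v2 because \<open>v\<close> is Lyndon, and
  prefixing \<open>u\<close> gives the claim.\<close>

lemma lyndon_append_less:
  assumes u: "lyndon u" and v: "lyndon v" and less: "u < v"
  shows "u @ v < v"
proof (cases "length v \<le> length u")
  case True
  then show ?thesis using lex_append_less[OF less, of v "[]"] by simp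
next
  case False
  define v1 where "v1 = take (length u) v"
  define v2 where "v2 = drop (length u) v"
  have v12: "v = v1 @ v2" "length v1 = length u" "v2 \<noteq> []"
    using False by (auto simp: v1_def v2_def)
  show ?thesis
  proof (cases "v1 = u")
    case True
    have "u \<noteq> []" using u by (simp add: lyndon_def)
    then have "v < v2" using v v12 True unfolding lyndon_def by blast
    then have "u @ v < u @ v2" by simp
    then show ?thesis using v12 True by simp
  next
    case neq: False
    have "\<not> v1 < u"
      using lex_append_less[of v1 u v2 "[]"] v12 less by auto
    then have "u < v1" using neq by simp
    then have "u @ v < v1 @ v2" using v12 by (intro lex_append_less) auto
    then show ?thesis using v12 by simp
  qed
qed

text \<open>A proper suffix either lies in \<open>v\<close>, hence is at least \<open>v\<close> and
  exceeds \<open>u @ v\<close> by the previous lemma, or is \<open>r @ v\<close> with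
  \<open>r\<close> a proper suffix of \<open>u\<close>; then \<open>u < r\<close> is decided at a
  letter because \<open>r\<close> is shorter.\<close>

lemma lyndon_append:
  assumes u: "lyndon u" and v: "lyndon v" and less: "u < v"
  shows "lyndon (u @ v)"
  unfolding lyndon_def
proof (intro conjI allI impI)
  show "u @ v \<noteq> []" using u by (simp add: lyndon_def)
next
  fix s t assume st: "u @ v = s @ t" "s \<noteq> []" "t \<noteq> []"
  note uv = lyndon_append_less[OF assms]
  from st(1) consider (1) r where "u = s @ r" "t = r @ v" | (2) r where "s = u @ r" "v = r @ t"
    by (auto simp: append_eq_append_conv2)
  then show "u @ v < t"
  proof cases
    case 1
    show ?thesis
    proof (cases "r = []")
      case False
      then have "u < r" using u 1 st unfolding lyndon_def by blast
      then show ?thesis using lex_append_less[of u r v v] 1 by simp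
    qed (use 1 uv in simp)
  next
    case 2
    show ?thesis
    proof (cases "r = []")
      case False
      then have "v < t" using v 2 st unfolding lyndon_def by blast
      then show ?thesis using uv by simp
    qed (use 2 uv in simp)
  qed
qed

section \<open>Standard bracketings of Lyndon words and their leading words\<close>

datatype tree = Leaf nat | Br tree tree

primrec foliage :: "tree \<Rightarrow> nat list" where
  "foliage (Leaf i) = [i]"
| "foliage (Br s t) = foliage s @ foliage t"

text \<open>The standard bracketings of Lyndon words: the right factor is the longest proper Lyndon suffix.\<close>

primrec std :: "tree \<Rightarrow> bool" where
  "std (Leaf i) = True"
| "std (Br s t) = (std s \<and> std t \<and> foliage s < foliage t \<and>
    (case s of Leaf _ \<Rightarrow> True | Br _ s' \<Rightarrow> foliage t \<le> foliage s'))"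

lemma lyndon_foliage: "std t \<Longrightarrow> lyndon (foliage t)"
proof (induction t)
  case (Leaf i)
  then show ?case by (auto simp: lyndon_def Cons_eq_append_conv)
next
  case (Br s t)
  then show ?case by (auto intro: lyndon_append)
qed

lemma foliage_nonempty [simp]: "foliage t \<noteq> []"
  by (induction t) auto

text \<open>A cut inside the left tree leaves \<open>r @ foliage t\<close>, with \<open>r\<close> at
  least the right factor of the left tree by induction, and the condition on standard trees makes
  that at least \<open>foliage t\<close>. A cut further right leaves a suffix of the Lyndon word
  \<open>foliage t\<close>.\<close>

lemma std_min_suffix:
  "\<lbrakk>std (Br s t); foliage (Br s t) = p @ q; p \<noteq> []; q \<noteq> []\<rbrakk> \<Longrightarrow> foliage t \<le> q"
proof (induction s arbitrary: t p q)
  case (Leaf i)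
  then obtain r where r: "foliage t = r @ q" by (cases p) auto
  show ?case
  proof (cases "r = []")
    case False
    then show ?thesis using Leaf r lyndon_foliage[of t] unfolding lyndon_def by fastforce
  qed (use r in simp)
next
  case (Br s1 s2)
  let ?s = "Br s1 s2"
  have le: "foliage t \<le> foliage s2" and std: "std ?s" "std t" using Br.prems by auto
  from Br.prems(2) consider (1) r where "foliage ?s = p @ r" "q = r @ foliage t"
    | (2) r where "p = foliage ?s @ r" "foliage t = r @ q"
    by (auto simp: append_eq_append_conv2 simp del: foliage.simps(2) simp: foliage.simps(2)[of ?s])
  then show ?case
  proof cases
    case 1
    show ?thesis
    proof (cases "r = []")
      case False
      then have "foliage s2 \<le> r" using Br.IH(1)[OF std(1) 1(1)] Br.prems by simp
      then show ?thesis using le lex_prefix_le[of r "foliage t"] 1 by simp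
    qed (use 1 in simp)
  next
    case 2
    show ?thesis
    proof (cases "r = []")
      case False
      then show ?thesis using Br.prems 2 std lyndon_foliage[of t] unfolding lyndon_def by fastforce
    qed (use 2 in simp)
  qed
qed

text \<open>By \<open>std_min_suffix\<close> the right factor is the least proper suffix. That
  depends on the word alone, so the word determines where its tree splits.\<close>

lemma std_foliage_inj: "\<lbrakk>std s; std t; foliage s = foliage t\<rbrakk> \<Longrightarrow> s = t"
proof (induction s arbitrary: t)
  case (Leaf i)
  then show ?case by (cases t) (auto simp: Cons_eq_append_conv)
next
  case (Br s1 s2)
  then obtain t1 t2 where t: "t = Br t1 t2" by (cases t) (auto simp: append_eq_Cons_conv)
  have "foliage s2 \<le> foliage t2"
    using Br.prems t by (intro std_min_suffix[of s1 s2 "foliage t1"]) auto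
  moreover have "foliage t2 \<le> foliage s2"
    using Br.prems t by (intro std_min_suffix[of t1 t2 "foliage s1"]) auto
  ultimately have "foliage s2 = foliage t2" by simp
  moreover from this have "foliage s1 = foliage t1" using Br.prems t by simp
  ultimately show ?case using Br t by auto
qed

primrec bracket :: "nat \<Rightarrow> tree \<Rightarrow> word" where
  "bracket n (Leaf i) = gen i"
| "bracket n (Br s t) = comm (free_group n) (bracket n s) (bracket n t)"

abbreviation weight :: "tree \<Rightarrow> nat"
  where "weight t \<equiv> length (foliage t)"

lemma weight_ge_1: "weight t \<ge> 1"
  by (simp add: Suc_le_eq)

lemma bracket_lcs: "set (foliage t) \<subseteq> {1..n} \<Longrightarrow> bracket n t \<in> lcs (free_group n) (weight t)"
  by (induction t) (auto intro: F.comm_lcs)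

lemma bracket_closed: "set (foliage t) \<subseteq> {1..n} \<Longrightarrow> bracket n t \<in> carrier (free_group n)"
  using bracket_lcs F.lcs_in_carrier by blast

text \<open>Of the two products in the leading coefficient of a commutator, the one with
  \<open>s\<close> in front is controlled by induction on both factors, and the other vanishes at
  all words up to the foliage. This triangularity is what later separates the brackets.\<close>

lemma bracket_lead:
  "\<lbrakk>std t; set (foliage t) \<subseteq> {1..n}; length u = weight t; u \<le> foliage t\<rbrakk>
    \<Longrightarrow> coef (magnus (bracket n t)) u = (if u = foliage t then 1 else 0)"
proof (induction t arbitrary: u)
  case (Leaf i)
  then show ?case
    by (auto simp: gen_def letter_exp_def coef_one coef_var)
next
  case (Br s t)
  let ?i = "weight s" and ?j = "weight t"
  have std: "std s" "std t" "foliage s < foliage t" and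
    sub: "set (foliage s) \<subseteq> {1..n}" "set (foliage t) \<subseteq> {1..n}" and len: "length u = ?i + ?j"
    using Br.prems by auto
  have dim: "bracket n s \<in> dimension_subgroup n ?i" "bracket n t \<in> dimension_subgroup n ?j"
    using bracket_lcs lcs_subset_dimension sub by blast+
  have 1: "coef (magnus (bracket n s)) (take ?i u) * coef (magnus (bracket n t)) (drop ?i u)
      = (if u = foliage (Br s t) then 1 else 0)"
  proof -
    have "\<not> foliage s < take ?i u"
    proof
      assume "foliage s < take ?i u"
      then have "foliage s @ foliage t < take ?i u @ drop ?i u"
        using len by (intro lex_append_less) auto
      then show False using Br.prems by simp
    qed
    then have le: "take ?i u \<le> foliage s" by simp
    show ?thesis
    proof (cases "take ?i u = foliage s")
      case True
      have u: "u = foliage s @ drop ?i u" using True by (metis append_take_drop_id)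
      then have "\<not> foliage t < drop ?i u" using Br.prems(4) lex_append_mono[of "foliage s"]
        by (metis foliage.simps(2) leD)
      then have "coef (magnus (bracket n t)) (drop ?i u) = (if drop ?i u = foliage t then 1 else 0)"
        using std sub len by (intro Br.IH) auto
      moreover have "coef (magnus (bracket n s)) (take ?i u) = 1"
        using True std sub by (simp add: Br.IH)
      moreover have "u = foliage (Br s t) \<longleftrightarrow> drop ?i u = foliage t"
        using u by (metis append_same_eq foliage.simps(2) same_append_eq)
      ultimately show ?thesis by simp
    next
      case False
      then have "coef (magnus (bracket n s)) (take ?i u) = 0"
        using le std sub len Br.IH(1)[of "take ?i u"] by simp
      moreover have "u \<noteq> foliage (Br s t)" using False by auto
      ultimately show ?thesis by simp
    qed
  qed
  \<comment> \<open>The Lyndon property gives \<open>foliage s @ foliage t < foliage t\<close>, so a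
    word up to that foliage has a prefix strictly below \<open>foliage t\<close>, where the
    induction hypothesis gives 0.\<close>
  have 2: "coef (magnus (bracket n t)) (take ?j u) = 0"
  proof -
    have "foliage (Br s t) < foliage t"
      using std lyndon_append_less lyndon_foliage by simp
    then have "foliage (Br s t) @ [] < foliage t @ drop ?j u"
      by (intro lex_append_less) auto
    then have less: "u < foliage t @ drop ?j u" using Br.prems by simp
    have "take ?j u < foliage t"
    proof (rule ccontr)
      assume "\<not> take ?j u < foliage t"
      then consider "take ?j u = foliage t" | "foliage t < take ?j u" by fastforce
      then show False
      proof cases
        case 1
        then show False using less by (metis append_take_drop_id less_irrefl)
      next
        case 2
        then have "foliage t @ drop ?j u < take ?j u @ drop ?j u"
          using len by (intro lex_append_less) auto
        then show False using less by simp
      qed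
    qed
    then show ?thesis using std sub len Br.IH(2)[of "take ?j u"] by simp
  qed
  show ?case
    using coef_comm_lead[OF dim, of u] len weight_ge_1 1 2 by simp
qed

text \<open>For trees of weight \<open>k\<close>, the preimage in Gamma_k of the Z-span of their
  brackets in Gamma_k/Gamma_{k+1}. Such intermediate subgroups stand in for submodules of the graded
  Lie ring.\<close>

definition bspan :: "nat \<Rightarrow> nat \<Rightarrow> tree set \<Rightarrow> word set"
  where "bspan n k T = generate (free_group n) (lcs (free_group n) (Suc k) \<union> bracket n ` T)"

definition std_trees :: "nat \<Rightarrow> nat \<Rightarrow> tree set"
  where "std_trees n k = {t. std t \<and> weight t = k \<and> set (foliage t) \<subseteq> {1..n}}"

lemma finite_std_trees: "finite (std_trees n k)"
proof (rule inj_on_finite)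
  show "inj_on foliage (std_trees n k)"
    by (auto simp: inj_on_def std_trees_def intro: std_foliage_inj)
  show "foliage ` std_trees n k \<subseteq> {u. set u \<subseteq> {1..n} \<and> length u = k}"
    by (auto simp: std_trees_def)
qed (rule finite_lists_length_eq, simp)

lemma
  assumes "T \<subseteq> std_trees n k"
  shows bspan_gens_subset: "lcs (free_group n) (Suc k) \<union> bracket n ` T \<subseteq> lcs (free_group n) k"
    and bspan_subgroup: "subgroup (bspan n k T) (free_group n)"
    and bspan_lower: "lcs (free_group n) (Suc k) \<subseteq> bspan n k T"
    and bspan_bracket: "t \<in> T \<Longrightarrow> bracket n t \<in> bspan n k T"
    and bspan_upper: "bspan n k T \<subseteq> lcs (free_group n) k"
    and bspan_normal: "k \<ge> 1 \<Longrightarrow> bspan n k T \<lhd> free_group n"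
proof -
  show gens: "lcs (free_group n) (Suc k) \<union> bracket n ` T \<subseteq> lcs (free_group n) k"
    using assms F.lcs_Suc_subset[of n k] bracket_lcs by (auto simp: std_trees_def)
  show sg: "subgroup (bspan n k T) (free_group n)"
    unfolding bspan_def using gens F.lcs_carrier[of n k] by (intro F.generate_is_subgroup) blast
  show lo: "lcs (free_group n) (Suc k) \<subseteq> bspan n k T"
    by (auto simp: bspan_def intro: generate.incl)
  show "t \<in> T \<Longrightarrow> bracket n t \<in> bspan n k T"
    by (auto simp: bspan_def intro: generate.incl)
  show up: "bspan n k T \<subseteq> lcs (free_group n) k"
    unfolding bspan_def using gens by (rule F.generate_subgroup_incl[OF _ F.lcs_subgroup])
  show "k \<ge> 1 \<Longrightarrow> bspan n k T \<lhd> free_group n"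
    by (rule F.normal_between_lcs[OF sg lo up])
qed

text \<open>Linearity of the graded bracket in its first argument: the generators coming from
  Gamma_{k+1} contribute only to Gamma_{k+j+1}, so the brackets of the trees decide.\<close>

lemma comm_bspan:
  assumes "T \<subseteq> std_trees n k" "N \<lhd> free_group n" "b \<in> lcs (free_group n) j" "a \<in> bspan n k T"
    and "lcs (free_group n) (Suc (k + j)) \<subseteq> N"
    and "\<And>t. t \<in> T \<Longrightarrow> comm (free_group n) (bracket n t) b \<in> N"
  shows "comm (free_group n) a b \<in> N"
proof (rule F.comm_generate_mem[OF assms(2) _ _ assms(4)[unfolded bspan_def]])
  show "lcs (free_group n) (Suc k) \<union> bracket n ` T \<subseteq> carrier (free_group n)"
    using bspan_gens_subset[OF assms(1)] F.lcs_carrier by blast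
  fix s assume "s \<in> lcs (free_group n) (Suc k) \<union> bracket n ` T"
  then show "comm (free_group n) s b \<in> N"
    using assms F.comm_lcs[of s n "Suc k" b j] by auto
qed (use assms in auto)

definition std_below :: "nat \<Rightarrow> nat \<Rightarrow> nat list \<Rightarrow> tree set"
  where "std_below n k v = {t \<in> std_trees n k. foliage t < v}"

lemma std_below_subset: "std_below n k v \<subseteq> std_trees n k"
  by (auto simp: std_below_def)

lemma std_below_mono: "v \<le> v' \<Longrightarrow> std_below n k v \<subseteq> std_below n k v'"
  by (auto simp: std_below_def)

lemma bspan_mono: "T \<subseteq> T' \<Longrightarrow> bspan n k T \<subseteq> bspan n k T'"
  unfolding bspan_def by (rule F.mono_generate) auto

text \<open>
  If \<open>(s, t)\<close> is not already a standard pair then \<open>s = [s\<^sub>1, s\<^sub>2]\<close> with \<open>s\<^sub>2 < t\<close>, and the Jacobi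
  identity rewrites the bracket through pairs whose larger member is smaller than \<open>t\<close>. So the
  induction is on the total weight and, within it, on the larger member.
\<close>

lemma comm_brackets_bspan:
  "\<lbrakk>std s; std t; set (foliage s) \<subseteq> {1..n}; set (foliage t) \<subseteq> {1..n}; foliage s < foliage t\<rbrakk>
    \<Longrightarrow> comm (free_group n) (bracket n s) (bracket n t)
      \<in> bspan n (weight s + weight t) (std_below n (weight s + weight t) (foliage t))"
proof -
  \<comment> \<open>The lexicographic order on words is not well-founded, so the larger member is
    measured by the number of words of bounded length below it, over a finite alphabet.\<close>
  define below where "below k t = card {v. length v < k \<and> set v \<subseteq> {1..n} \<and> v < foliage t}" for k t
  show "\<lbrakk>std s; std t; set (foliage s) \<subseteq> {1..n}; set (foliage t) \<subseteq> {1..n}; foliage s < foliage t\<rbrakk>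
    \<Longrightarrow> comm (free_group n) (bracket n s) (bracket n t)
      \<in> bspan n (weight s + weight t) (std_below n (weight s + weight t) (foliage t))"
  proof (induction "(weight s + weight t, below (weight s + weight t) t)" arbitrary: s t
      rule: wf_induct_rule[OF wf_lex_prod[OF wf_less_than wf_less_than]])
    case (1 s t)
    let ?k = "weight s + weight t"
    let ?F = "free_group n"
    note std = "1.prems"(1,2) and sub = "1.prems"(3,4) and less = "1.prems"(5)
    have IH_weight: "comm ?F (bracket n s') (bracket n t') \<in> bspan n (weight s' + weight t') (std_below n (weight s' + weight t') (foliage t'))"
      if "weight s' + weight t' < ?k" "std s'" "std t'" "set (foliage s') \<subseteq> {1..n}" "set (foliage t') \<subseteq> {1..n}" "foliage s' < foliage t'" for s' t'
      using "1.hyps"[of s' t'] that by simp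
    have below_less: "below ?k t' < below ?k t"
      if "foliage t' < foliage t" "weight t' < ?k" "set (foliage t') \<subseteq> {1..n}" for t'
      unfolding below_def
    proof (rule psubset_card_mono)
      have "{v. length v < ?k \<and> set v \<subseteq> {1..n} \<and> v < foliage t} \<subseteq> {v. set v \<subseteq> {1..n} \<and> length v \<le> ?k}"
        by auto
      then show "finite {v. length v < ?k \<and> set v \<subseteq> {1..n} \<and> v < foliage t}"
        by (rule finite_subset) (rule finite_lists_length_le, simp)
      have "foliage t' \<in> {v. length v < ?k \<and> set v \<subseteq> {1..n} \<and> v < foliage t}"
        using that by simp
      moreover have "foliage t' \<notin> {v. length v < ?k \<and> set v \<subseteq> {1..n} \<and> v < foliage t'}" by simp
      moreover have "{v. length v < ?k \<and> set v \<subseteq> {1..n} \<and> v < foliage t'} \<subseteq> {v. length v < ?k \<and> set v \<subseteq> {1..n} \<and> v < foliage t}"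
        using that by auto
      ultimately show "{v. length v < ?k \<and> set v \<subseteq> {1..n} \<and> v < foliage t'} \<subset> {v. length v < ?k \<and> set v \<subseteq> {1..n} \<and> v < foliage t}"
        by blast
    qed
    define H where "H = bspan n ?k (std_below n ?k (foliage t))"
    have Hn: "H \<lhd> ?F" and Hlo: "lcs ?F (Suc ?k) \<subseteq> H" and Hsg: "subgroup H ?F"
      unfolding H_def using bspan_normal bspan_lower bspan_subgroup std_below_subset weight_ge_1[of s]
      by (auto simp: trans_le_add1)
    \<comment> \<open>Both members lie below \<open>t\<close>, so whichever is larger has a smaller
      measure than \<open>t\<close>. The reverse order costs an inverse, and equal words mean equal
      trees.\<close>
    have IH: "comm ?F (bracket n x) (bracket n y) \<in> H"
      if "std x" "std y" "set (foliage x) \<subseteq> {1..n}" "set (foliage y) \<subseteq> {1..n}"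
        "weight x + weight y = ?k" "foliage x < foliage t" "foliage y < foliage t" for x y
    proof -
      have smaller: "comm ?F (bracket n x) (bracket n y) \<in> H"
        if a: "std x" "std y" "set (foliage x) \<subseteq> {1..n}" "set (foliage y) \<subseteq> {1..n}"
          "weight x + weight y = ?k" "foliage y < foliage t" "foliage x < foliage y" for x y
      proof -
        have "weight y < ?k" using a(5) weight_ge_1[of x] by linarith
        then have "comm ?F (bracket n x) (bracket n y) \<in> bspan n (weight x + weight y) (std_below n (weight x + weight y) (foliage y))"
          using "1.hyps"[of x y] a below_less[of y] by simp
        moreover have "bspan n ?k (std_below n ?k (foliage y)) \<subseteq> H"
          unfolding H_def using a by (intro bspan_mono std_below_mono) auto
        ultimately show ?thesis using a(5) by auto
      qed
      have cl: "bracket n x \<in> carrier ?F" "bracket n y \<in> carrier ?F"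
        using that bracket_closed by auto
      consider "foliage x < foliage y" | "foliage y < foliage x" | "foliage x = foliage y" by fastforce
      then show ?thesis
      proof cases
        case 1 then show ?thesis using smaller that by blast
      next
        case 2
        then have "comm ?F (bracket n y) (bracket n x) \<in> H"
          using smaller[of y x] that by (simp add: add.commute)
        then show ?thesis using F.comm_swap_mem[OF Hsg] cl by blast
      next
        case 3
        then have "x = y" using that std_foliage_inj by blast
        then show ?thesis using cl subgroup.one_closed[OF Hsg] by (metis F.comm_self)
      qed
    qed
    have tl: "bracket n t \<in> lcs ?F (weight t)" using sub by (intro bracket_lcs)
    show ?case
    proof (cases "std (Br s t)")
      case True
      have "foliage (Br s t) < foliage t"
        using std less lyndon_append_less lyndon_foliage by simp
      then have "Br s t \<in> std_below n ?k (foliage t)"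
        using True sub by (simp add: std_below_def std_trees_def)
      then have "bracket n (Br s t) \<in> bspan n ?k (std_below n ?k (foliage t))"
        by (intro bspan_bracket std_below_subset)
      then show ?thesis by simp
    next
      case False
      then obtain s1 s2 where s: "s = Br s1 s2" and s2: "foliage s2 < foliage t"
        using std less by (cases s) auto
      have s12: "std s1" "std s2" "set (foliage s1) \<subseteq> {1..n}" "set (foliage s2) \<subseteq> {1..n}" "foliage s1 < foliage s2"
        using s std sub by auto
      have s1: "foliage s1 < foliage t" using s12 s2 by simp
      \<comment> \<open>One Jacobi term, stated for both orders of \<open>s1\<close> and
        \<open>s2\<close>. The bracket of \<open>x\<close> with \<open>t\<close> has smaller weight,
        so it is a combination of brackets below \<open>t\<close>; bracketing these with
        \<open>y\<close> gives pairs with both members below \<open>t\<close>. The inverse on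
        \<open>x\<close> is the form that \<open>comm_comm_mem\<close> consumes.\<close>
      have half: "comm ?F (comm ?F (inv\<^bsub>?F\<^esub> (bracket n x)) (bracket n t)) (bracket n y) \<in> H"
        "comm ?F (inv\<^bsub>?F\<^esub> (bracket n x)) (bracket n t) \<in> lcs ?F (weight x + weight t)"
        if xy: "std x" "std y" "set (foliage x) \<subseteq> {1..n}" "set (foliage y) \<subseteq> {1..n}"
          "weight x + weight y = weight s" "foliage x < foliage t" "foliage y < foliage t" for x y
      proof -
        let ?m = "weight x + weight t"
        let ?E = "bspan n ?m (std_below n ?m (foliage t))"
        have cl: "bracket n x \<in> carrier ?F" "bracket n t \<in> carrier ?F"
          using xy sub bracket_closed by auto
        have m: "?m < ?k" using xy(5) weight_ge_1[of y] by linarith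
        have "comm ?F (bracket n x) (bracket n t) \<in> ?E"
          using xy m std sub by (intro IH_weight)
        moreover have "?E \<lhd> ?F" using weight_ge_1[of x] by (intro bspan_normal std_below_subset) simp
        ultimately have e: "comm ?F (inv\<^bsub>?F\<^esub> (bracket n x)) (bracket n t) \<in> ?E"
          using subgroup.m_inv_closed[OF F.subgroup_centralizer_mod, of ?E n "bracket n t" "bracket n x"] cl by simp
        then show "comm ?F (inv\<^bsub>?F\<^esub> (bracket n x)) (bracket n t) \<in> lcs ?F (weight x + weight t)"
          using bspan_upper[OF std_below_subset] by blast
        have mk: "?m + weight y = ?k" using xy(5) by simp
        show "comm ?F (comm ?F (inv\<^bsub>?F\<^esub> (bracket n x)) (bracket n t)) (bracket n y) \<in> H"
        proof (rule comm_bspan[OF std_below_subset Hn bracket_lcs[OF xy(4)] e])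
          show "lcs ?F (Suc (?m + weight y)) \<subseteq> H" unfolding mk by (rule Hlo)
          fix z assume "z \<in> std_below n ?m (foliage t)"
          then show "comm ?F (bracket n z) (bracket n y) \<in> H"
            using xy mk by (intro IH) (auto simp: std_below_def std_trees_def)
        qed
      qed
      have ws: "weight s1 + weight s2 = weight s" by (simp add: s)
      have e: "comm ?F (inv\<^bsub>?F\<^esub> (bracket n s1)) (bracket n t) \<in> lcs ?F (weight s1 + weight t)"
        and eb: "comm ?F (comm ?F (inv\<^bsub>?F\<^esub> (bracket n s1)) (bracket n t)) (bracket n s2) \<in> H"
        using half[OF s12(1,2,3,4) ws s1 s2] by blast+
      have f: "comm ?F (inv\<^bsub>?F\<^esub> (bracket n s2)) (bracket n t) \<in> lcs ?F (weight s2 + weight t)"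
        and fa: "comm ?F (comm ?F (inv\<^bsub>?F\<^esub> (bracket n s2)) (bracket n t)) (bracket n s1) \<in> H"
        using half[OF s12(2,1,4,3) ws[unfolded add.commute[of "weight s1"]] s2 s1] by blast+
      \<comment> \<open>The quadratic term has total weight \<open>?k + weight t\<close>, so it
        vanishes modulo the next term and only the two Jacobi terms count.\<close>
      have "lcs ?F (weight s1 + weight t + (weight s2 + weight t)) \<subseteq> lcs ?F (Suc ?k)"
        using weight_ge_1[of t] ws by (intro F.lcs_antimono) linarith
      then have ef: "comm ?F (comm ?F (inv\<^bsub>?F\<^esub> (bracket n s1)) (bracket n t)) (comm ?F (inv\<^bsub>?F\<^esub> (bracket n s2)) (bracket n t)) \<in> H"
        using F.comm_lcs[OF e f] Hlo by blast
      have "comm ?F (comm ?F (bracket n s1) (bracket n s2)) (bracket n t) \<in> H"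
        by (rule F.comm_comm_mem[OF Hn _ _ _ eb fa ef]) (use s12 sub bracket_closed in auto)
      then show ?thesis unfolding H_def by (simp add: s)
    qed
  qed
qed

text \<open>Commutators with generators produce the next degree from the previous one, and a
  generator is itself a standard tree, so each step is a commutator of two standard brackets, which
  \<open>comm_brackets_bspan\<close> expands.\<close>

lemma lcs_subset_bspan: "lcs (free_group n) (Suc k) \<subseteq> bspan n (Suc k) (std_trees n (Suc k))"
proof (induction k)
  case 0
  have "generate (free_group n) (gen ` {1..n}) \<subseteq> bspan n 1 (std_trees n 1)"
  proof (rule F.generate_subgroup_incl)
    show "gen ` {1..n} \<subseteq> bspan n 1 (std_trees n 1)"
      using bspan_bracket[OF order_refl, of "Leaf _" n 1] by (auto simp: std_trees_def)
  qed (rule bspan_subgroup, simp)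
  then show ?case unfolding generate_gens by simp
next
  case (Suc k)
  let ?F = "free_group n"
  define H where "H = bspan n (Suc (Suc k)) (std_trees n (Suc (Suc k)))"
  have Hn: "H \<lhd> ?F" and Hlo: "lcs ?F (Suc (Suc (Suc k))) \<subseteq> H" and Hsg: "subgroup H ?F"
    unfolding H_def by (rule bspan_normal bspan_lower bspan_subgroup; simp)+
  have leaf: "comm ?F (gen i) (bracket n t) \<in> H" if i: "i \<in> {1..n}" and t: "t \<in> std_trees n (Suc k)" for i t
  proof -
    have t': "std t" "weight t = Suc k" "set (foliage t) \<subseteq> {1..n}" using t by (auto simp: std_trees_def)
    have cl: "bracket n t \<in> carrier ?F" "gen i \<in> carrier ?F" using t' i bracket_closed by auto
    have sub: "bspan n (Suc (Suc k)) (std_below n (Suc (Suc k)) v) \<subseteq> H" for v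
      unfolding H_def by (intro bspan_mono std_below_subset)
    consider "[i] < foliage t" | "foliage t < [i]" | "foliage t = [i]" by fastforce
    then show ?thesis
    proof cases
      case 1
      then show ?thesis using comm_brackets_bspan[of "Leaf i" t n] t' i sub by auto
    next
      case 2
      then have "comm ?F (bracket n t) (gen i) \<in> H"
        using comm_brackets_bspan[of t "Leaf i" n] t' i sub by auto
      then show ?thesis using F.comm_swap_mem[OF Hsg] cl by blast
    next
      case 3
      then have "t = Leaf i" using t' by (intro std_foliage_inj) auto
      then show ?thesis using cl subgroup.one_closed[OF Hsg] by (metis F.comm_self bracket.simps(1))
    qed
  qed
  have gen: "comm ?F (gen i) a \<in> H" if i: "i \<in> {1..n}" and a: "a \<in> lcs ?F (Suc k)" for i a
  proof -
    have "comm ?F a (gen i) \<in> H"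
    proof (rule comm_bspan[OF order_refl Hn])
      show "a \<in> bspan n (Suc k) (std_trees n (Suc k))" using a Suc by blast
      show "gen i \<in> lcs ?F 1" using i by simp
      show "lcs ?F (Suc (Suc k + 1)) \<subseteq> H" using Hlo by simp
      fix t assume t: "t \<in> std_trees n (Suc k)"
      have "bracket n t \<in> carrier ?F" using t by (intro bracket_closed) (simp add: std_trees_def)
      then show "comm ?F (bracket n t) (gen i) \<in> H"
        using F.comm_swap_mem[OF Hsg leaf[OF i t]] i by simp
    qed
    then show ?thesis using F.comm_swap_mem[OF Hsg _ F.lcs_in_carrier[OF a]] i by simp
  qed
  have "comm ?F g a \<in> H" if g: "g \<in> carrier ?F" and a: "a \<in> lcs ?F (Suc k)" for g a
  proof (rule F.comm_generate_mem[OF Hn])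
    show "g \<in> generate ?F (gen ` {1..n})" using g by (simp only: generate_gens)
  qed (use gen[OF _ a] a in auto)
  then have "{comm ?F g a | g a. g \<in> carrier ?F \<and> a \<in> lcs ?F (Suc k)} \<subseteq> H" by blast
  then show ?case
    using F.generate_subgroup_incl[OF _ Hsg] by (simp add: commutator_subgroup_comm H_def)
qed


section \<open>Independence of the standard brackets and the dimension subgroup theorem\<close>

lemma (in group) generate_insert_mod:
  assumes N: "N \<lhd> G" and b: "b \<in> carrier G" and g: "g \<in> generate G (insert b N)"
  shows "\<exists>e :: int. g \<otimes> b [^] e \<in> N"
proof -
  interpret N: normal N G by fact
  have mem: "g \<in> carrier G" if "g \<in> generate G (insert b N)" for g
    using generate_incl[of "insert b N"] b N.subset that by blast
  show ?thesis using g
  proof (induction rule: generate.induct)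
    case one
    then show ?case by (intro exI[of _ 0]) simp
  next
    case (incl h)
    show ?case
    proof (cases "h = b")
      case True
      then show ?thesis using b by (intro exI[of _ "-1"]) (simp add: int_pow_neg)
    next
      case False
      then show ?thesis using incl by (intro exI[of _ 0]) auto
    qed
  next
    case (inv h)
    show ?case
    proof (cases "h = b")
      case True
      then show ?thesis using b by (intro exI[of _ 1]) simp
    next
      case False
      then show ?thesis using inv by (intro exI[of _ 0]) auto
    qed
  next
    case (eng g h)
    then obtain d e :: int where de: "g \<otimes> b [^] d \<in> N" "h \<otimes> b [^] e \<in> N" by blast
    have gh: "g \<in> carrier G" "h \<in> carrier G" using eng mem by auto
    have "g \<otimes> h \<otimes> b [^] (e + d) = (g \<otimes> b [^] d) \<otimes> (inv (b [^] d) \<otimes> (h \<otimes> b [^] e) \<otimes> b [^] d)"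
      using gh b by (simp add: m_assoc int_pow_mult)
    also have "\<dots> \<in> N"
      by (rule N.m_closed[OF de(1) N.inv_op_closed1[OF _ de(2)]]) (simp add: b)
    finally show ?case by blast
  qed
qed

lemma coef_int_pow_lead:
  assumes x: "x \<in> dimension_subgroup n k" and u: "length u = k" "k \<ge> 1"
  shows "coef (magnus (x [^]\<^bsub>free_group n\<^esub> (e :: int))) u = e * coef (magnus x) u"
proof -
  have xc: "x \<in> carrier (free_group n)" using x by (simp add: dimension_subgroup_def)
  have ne: "u \<noteq> []" using u by auto
  have dim: "x [^]\<^bsub>free_group n\<^esub> m \<in> dimension_subgroup n k" for m :: int
    using F.subgroup_int_pow_closed[OF dimension_subgroup_is_subgroup x] .
  have nat: "coef (magnus (x [^]\<^bsub>free_group n\<^esub> (int m))) u = int m * coef (magnus x) u" for m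
  proof (induction m)
    case 0
    then show ?case using ne by (simp add: coef_one)
  next
    case (Suc m)
    have "x [^]\<^bsub>free_group n\<^esub> int (Suc m) = x [^]\<^bsub>free_group n\<^esub> int m \<star> x"
      using xc F.int_pow_mult[of x n "int m" 1] by (simp add: add.commute)
    then show ?case
      using Suc coef_mult_lead[OF dim[of "int m"] x u] by (simp add: algebra_simps)
  qed
  show ?thesis
  proof (cases "e \<ge> 0")
    case True
    then show ?thesis using nat[of "nat e"] by simp
  next
    case False
    define m where "m = nat (- e)"
    have e: "e = - int m" using False by (simp add: m_def)
    have "x [^]\<^bsub>free_group n\<^esub> e \<star> x [^]\<^bsub>free_group n\<^esub> int m = []"
      using xc F.int_pow_mult[of x n e "int m"] e by simp
    then have "coef (magnus (x [^]\<^bsub>free_group n\<^esub> e)) u + coef (magnus (x [^]\<^bsub>free_group n\<^esub> int m)) u = 0"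
      using coef_mult_lead[OF dim[of e] dim[of "int m"] u] ne by (simp add: coef_one)
    then show ?thesis using nat[of m] e by simp
  qed
qed

text \<open>The coefficient at \<open>u\<close> is additive on the dimension subgroup. It vanishes
  on the generators of the span, on brackets by triangularity and on the next term by
  degree.\<close>

lemma bspan_lead_zero:
  assumes T: "T \<subseteq> std_trees n k" and k: "k \<ge> 1" and u: "length u = k"
    and less: "\<And>t. t \<in> T \<Longrightarrow> u < foliage t" and g: "g \<in> bspan n k T"
  shows "coef (magnus g) u = 0"
proof -
  have ne: "u \<noteq> []" using u k by auto
  let ?Z = "{x \<in> dimension_subgroup n k. coef (magnus x) u = 0}"
  have sg: "subgroup ?Z (free_group n)"
  proof -
    interpret D: subgroup "dimension_subgroup n k" "free_group n"
      by (rule dimension_subgroup_is_subgroup)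
    show ?thesis
    proof
      show "?Z \<subseteq> carrier (free_group n)" using D.subset by blast
      show "\<one>\<^bsub>free_group n\<^esub> \<in> ?Z" using D.one_closed ne by (simp add: coef_one)
    next
      fix x y assume "x \<in> ?Z" "y \<in> ?Z"
      then have "x \<in> dimension_subgroup n k" "y \<in> dimension_subgroup n k"
        and "coef (magnus x) u = 0" "coef (magnus y) u = 0" by auto
      then show "x \<otimes>\<^bsub>free_group n\<^esub> y \<in> ?Z"
        using D.m_closed[of x y] coef_mult_lead[OF _ _ u k, of x n y] by simp
    next
      fix x assume x: "x \<in> ?Z"
      then have xc: "x \<in> carrier (free_group n)" using D.subset by blast
      have "coef (magnus (inv\<^bsub>free_group n\<^esub> x)) u = 0"
        using coef_int_pow_lead[of x n k u "-1"] x u k F.int_pow_neg[OF xc, of 1] xc by simp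
      then show "inv\<^bsub>free_group n\<^esub> x \<in> ?Z" using x D.m_inv_closed by simp
    qed
  qed
  have "lcs (free_group n) (Suc k) \<union> bracket n ` T \<subseteq> ?Z"
  proof
    fix x assume "x \<in> lcs (free_group n) (Suc k) \<union> bracket n ` T"
    then consider (1) "x \<in> lcs (free_group n) (Suc k)" | (2) t where "t \<in> T" "x = bracket n t"
      by blast
    then show "x \<in> ?Z"
    proof cases
      case 1
      then have "x \<in> dimension_subgroup n (Suc k)" "x \<in> dimension_subgroup n k"
        using lcs_subset_dimension F.lcs_Suc_subset by blast+
      then show ?thesis
        using u ne by (simp add: dimension_subgroup_def aug_def coef_one)
    next
      case 2
      then have t: "std t" "weight t = k" "set (foliage t) \<subseteq> {1..n}" using T by (auto simp: std_trees_def)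
      then have "x \<in> dimension_subgroup n k"
        using 2 bracket_lcs[of t n] lcs_subset_dimension by auto
      moreover have "coef (magnus x) u = 0"
        using bracket_lead[OF t(1,3), of u] t u less[OF 2(1)] 2 by auto
      ultimately show ?thesis by simp
    qed
  qed
  then have "bspan n k T \<subseteq> ?Z"
    unfolding bspan_def using F.generate_subgroup_incl[OF _ sg] by blast
  then show ?thesis using g by blast
qed

text \<open>Linear independence by leading words. The tree with the least foliage is split off as a
  power of its bracket; at that word no other bracket contributes and the series of \<open>g\<close>
  has coefficient 0, so the exponent is 0. Removing trees one at a time leaves Gamma_{k+1}.\<close>

lemma bspan_dimension:
  assumes "T \<subseteq> std_trees n k" "k \<ge> 1" "g \<in> bspan n k T" "g \<in> dimension_subgroup n (Suc k)"
  shows "g \<in> lcs (free_group n) (Suc k)"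
proof -
  have "finite T" using assms(1) finite_std_trees by (rule finite_subset)
  then show ?thesis using assms
  proof (induction T rule: finite_psubset_induct)
    case (psubset T)
    show ?case
    proof (cases "T = {}")
      case True
      then show ?thesis
        using psubset.prems F.generate_subgroup_incl[OF order_refl F.lcs_subgroup]
        by (auto simp: bspan_def)
    next
      case False
      define u where "u = Min (foliage ` T)"
      have "u \<in> foliage ` T" unfolding u_def using psubset.hyps False by (intro Min_in) auto
      then obtain t where t: "t \<in> T" "foliage t = u" by blast
      have min: "u \<le> foliage s" if "s \<in> T" for s
        unfolding u_def using psubset.hyps that by (intro Min_le) auto
      let ?T = "T - {t}" and ?b = "bracket n t"
      have T': "?T \<subseteq> std_trees n k" using psubset.prems by blast
      have tt: "std t" "weight t = k" "set (foliage t) \<subseteq> {1..n}"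
        using t psubset.prems by (auto simp: std_trees_def)
      have bc: "?b \<in> carrier (free_group n)" using tt by (intro bracket_closed)
      have bd: "?b \<in> dimension_subgroup n k"
        using bracket_lcs[of t n] tt lcs_subset_dimension by auto
      have gc: "g \<in> carrier (free_group n)" "g \<in> dimension_subgroup n k"
        using psubset.prems(4) aug_antimono[of k "Suc k"] by (auto simp: dimension_subgroup_def)
      have N: "bspan n k ?T \<lhd> free_group n" by (rule bspan_normal[OF T' psubset.prems(2)])
      have "lcs (free_group n) (Suc k) \<union> bracket n ` T \<subseteq> insert ?b (bspan n k ?T)"
        using bspan_lower[OF T'] bspan_bracket[OF T'] by auto
      then have "bspan n k T \<subseteq> generate (free_group n) (insert ?b (bspan n k ?T))"
        unfolding bspan_def[of n k T] by (rule F.mono_generate)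
      then obtain e :: int where e: "g \<star> ?b [^]\<^bsub>free_group n\<^esub> e \<in> bspan n k ?T"
        using F.generate_insert_mod[OF N bc, of g] psubset.prems(3) by auto
      have less: "u < foliage s" if "s \<in> ?T" for s
      proof -
        have "s \<noteq> t" "std s" using that psubset.prems by (auto simp: std_trees_def)
        then have "foliage s \<noteq> u" using std_foliage_inj tt t by blast
        then show ?thesis using min[of s] that by auto
      qed
      have u: "length u = k" using t tt by simp
      have "coef (magnus (g \<star> ?b [^]\<^bsub>free_group n\<^esub> e)) u = 0"
        by (rule bspan_lead_zero[OF T' psubset.prems(2) u less e])
      moreover have "?b [^]\<^bsub>free_group n\<^esub> e \<in> dimension_subgroup n k"
        by (rule F.subgroup_int_pow_closed[OF dimension_subgroup_is_subgroup bd])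
      ultimately have "coef (magnus g) u + e * coef (magnus ?b) u = 0"
        using coef_mult_lead[OF gc(2) _ u psubset.prems(2)] coef_int_pow_lead[OF bd u psubset.prems(2)]
        by simp
      moreover have "coef (magnus g) u = 0"
      proof -
        have "u \<noteq> []" using u psubset.prems(2) by auto
        then show ?thesis
          using psubset.prems(4) u by (auto simp: dimension_subgroup_def aug_def coef_one)
      qed
      moreover have "coef (magnus ?b) u = 1"
        using bracket_lead[OF tt(1,3), of u] t by simp
      ultimately have "e = 0" by simp
      then have "g \<in> bspan n k ?T" using e F.r_one[OF gc(1)] by simp
      then show ?thesis
        using t psubset.prems T' by (intro psubset.IH[of ?T]) auto
    qed
  qed
qed

text \<open>Spanning writes an element of Gamma_k through standard brackets; independence then
  forces it into Gamma_{k+1} as soon as its series starts in degree k + 1.\<close>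

theorem dimension_subgroup_eq_lcs: "dimension_subgroup n k = lcs (free_group n) k"
proof (induction k)
  case (Suc k)
  show ?case
  proof (cases "k = 0")
    case True
    then show ?thesis using magnus_aug_1 by (auto simp: dimension_subgroup_def)
  next
    case False
    have "g \<in> lcs (free_group n) (Suc k)" if g: "g \<in> dimension_subgroup n (Suc k)" for g
    proof -
      have "g \<in> dimension_subgroup n k"
        using g aug_antimono[of k "Suc k"] by (auto simp: dimension_subgroup_def)
      then have "g \<in> bspan n k (std_trees n k)"
        using Suc lcs_subset_bspan[of n "k - 1"] False by auto
      then show ?thesis using g False by (intro bspan_dimension[OF order_refl]) auto
    qed
    then show ?thesis using lcs_subset_dimension by blast
  qed
qed (simp add: dimension_subgroup_def)

section \<open>Exponent sums and the centralizer of a generator modulo Gamma_{j+1}\<close>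

definition expsum :: "nat \<Rightarrow> word \<Rightarrow> int"
  where "expsum m w = (\<Sum>a\<leftarrow>w. if fst a = m then (if snd a then 1 else - 1) else 0)"

lemma expsum_simps [simp]:
  "expsum m [] = 0"
  "expsum m (a # w) = (if fst a = m then (if snd a then 1 else - 1) else 0) + expsum m w"
  by (simp_all add: expsum_def)

lemma expsum_push: "expsum m (push a w) = expsum m [a] + expsum m w"
  by (cases w) (auto simp: inv_letter_def)

lemma expsum_mult: "expsum m (u \<star> v) = expsum m u + expsum m v"
  by (induction u) (auto simp: expsum_push)

lemma expsum_gen: "expsum m (gen i) = (if i = m then 1 else 0)"
  by (simp add: gen_def)

lemma expsum_inv:
  assumes "w \<in> carrier (free_group n)"
  shows "expsum m (inv\<^bsub>free_group n\<^esub> w) = - expsum m w"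
  using expsum_mult[of m w "inv\<^bsub>free_group n\<^esub> w"] F.r_inv[OF assms] by simp

lemma expsum_gen_pow:
  assumes "m \<in> {1..n}"
  shows "expsum m (gen m [^]\<^bsub>free_group n\<^esub> (e :: int)) = e"
proof -
  let ?F = "free_group n"
  have g: "gen m \<in> carrier ?F" using assms by simp
  have nat: "expsum m (gen m [^]\<^bsub>?F\<^esub> int p) = int p" for p
  proof (induction p)
    case (Suc p)
    then show ?case
      using F.int_pow_mult[OF g, of 1 "int p"] g by (simp add: expsum_mult expsum_gen)
  qed simp
  show ?thesis
  proof (cases "e \<ge> 0")
    case True
    then show ?thesis using nat[of "nat e"] by simp
  next
    case False
    then show ?thesis
      using nat[of "nat (- e)"] F.int_pow_neg[of "gen m" n "- e"] g expsum_inv[of "gen m [^]\<^bsub>?F\<^esub> (- e)" n m] by simp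
  qed
qed

text \<open>The binomial series (1 + X_m)^e for an integer exponent.\<close>

definition var_exp :: "nat \<Rightarrow> int \<Rightarrow> ncps"
  where "var_exp m e = (if e \<ge> 0 then (1 + var m) ^ nat e else geom m ^ nat (- e))"

lemma var_exp_up: "(1 + var m) * var_exp m e = var_exp m (e + 1)"
proof (cases "e \<ge> 0")
  case True
  then show ?thesis by (simp add: var_exp_def nat_add_distrib)
next
  case False
  define j where "j = nat (- e - 1)"
  have e: "e = - int j - 1" using False by (simp add: j_def)
  have "(1 + var m) * geom m ^ Suc j = geom m ^ j"
    using var_geom by (simp flip: mult.assoc)
  then show ?thesis unfolding e by (cases "j = 0") (auto simp: var_exp_def nat_add_distrib)
qed

lemma var_exp_down: "geom m * var_exp m e = var_exp m (e - 1)"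
  using var_exp_up[of m "e - 1"] geom_var[of m] by (metis diff_add_cancel mult.assoc mult_1)

text \<open>Setting every variable except X_m to 0 is multiplicative; here this is read on the
  coefficients of powers of X_m.\<close>

lemma conv_replicate_cong:
  "\<lbrakk>\<And>p. f (replicate p m) = f' (replicate p m); \<And>p. g (replicate p m) = g' (replicate p m)\<rbrakk>
    \<Longrightarrow> conv f g (replicate p m) = conv f' g' (replicate p m)"
proof (induction p arbitrary: f f')
  case 0
  show ?case using 0(1)[of 0] 0(2)[of 0] by simp
next
  case (Suc p)
  have "conv (\<lambda>v. f (m # v)) g (replicate p m) = conv (\<lambda>v. f' (m # v)) g' (replicate p m)"
    using Suc.prems(1)[of "Suc _"] Suc.prems(2) by (intro Suc.IH) auto
  then show ?case using Suc.prems(1)[of 0] Suc.prems(2)[of "Suc p"] by simp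
qed

text \<open>With the other variables set to 0 a word becomes 1 + X_m raised to its exponent
  sum.\<close>

lemma coef_magnus_replicate: "coef (magnus w) (replicate p m) = coef (var_exp m (expsum m w)) (replicate p m)"
proof (induction w arbitrary: p)
  case Nil
  then show ?case by (simp add: var_exp_def)
next
  case (Cons a w)
  define d :: int where "d = expsum m [a]"
  define l where "l = (if fst a = m then letter_exp a else 1)"
  have "coef (letter_exp a) (replicate q m) = coef l (replicate q m)" for q
    using in_set_replicate[of "fst a" q m] by (cases "replicate q m = [fst a]") (auto simp: l_def letter_exp_def coef_one coef_var coef_geom)
  then have "coef (magnus (a # w)) (replicate p m) = coef (l * var_exp m (expsum m w)) (replicate p m)"
    unfolding magnus_simps coef_mult by (rule conv_replicate_cong) (rule Cons.IH)
  also have "l * var_exp m (expsum m w) = var_exp m (expsum m (a # w))"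
    using var_exp_up[of m "expsum m w"] var_exp_down[of m "expsum m w"]
    by (auto simp: l_def letter_exp_def add.commute)
  finally show ?case .
qed

text \<open>
  A series commuting with \<open>X\<^sub>m\<close> up to degree \<open>j\<close> has only powers of \<open>X\<^sub>m\<close> in degree below \<open>j\<close>;
  their coefficients depend only on the exponent sum of \<open>x\<^sub>m\<close>.
\<close>

theorem centralizer_gen_mod_lcs:
  assumes w: "w \<in> carrier (free_group n)" and m: "m \<in> {1..n}"
    and c: "comm (free_group n) w (gen m) \<in> lcs (free_group n) (Suc j)"
  shows "\<exists>e :: int. w \<star> gen m [^]\<^bsub>free_group n\<^esub> e \<in> lcs (free_group n) j"
proof -
  let ?F = "free_group n"
  \<comment> \<open>The corrected element has exponent sum 0 in x_m, so its series has the same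
    coefficients as 1 at all powers of X_m.\<close>
  define e where "e = - expsum m w"
  define v where "v = w \<star> gen m [^]\<^bsub>?F\<^esub> e"
  have g: "gen m \<in> carrier ?F" using m by simp
  have ge: "gen m [^]\<^bsub>?F\<^esub> e \<in> carrier ?F" using g by simp
  have v: "v \<in> carrier ?F" unfolding v_def using F.m_closed[OF w ge] by simp
  have "gen m [^]\<^bsub>?F\<^esub> e \<otimes>\<^bsub>?F\<^esub> gen m = gen m \<otimes>\<^bsub>?F\<^esub> gen m [^]\<^bsub>?F\<^esub> e"
    using g F.int_pow_mult[of "gen m" n e 1] F.int_pow_mult[of "gen m" n 1 e] by (simp add: add.commute)
  then have "comm ?F v (gen m) = comm ?F w (gen m)"
    using F.comm_mult_commuting[OF w ge g] by (simp add: v_def)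
  then have "comm ?F v (gen m) \<in> dimension_subgroup n (Suc j)"
    using c dimension_subgroup_eq_lcs by auto
  then have "magnus (comm ?F v (gen m)) - 1 \<in> aug (Suc j)" by (simp add: dimension_subgroup_def)
  then have "(magnus (comm ?F v (gen m)) - 1) * (magnus (gen m) * magnus v) \<in> aug (Suc j)"
    by (rule aug_closed)
  also have "(magnus (comm ?F v (gen m)) - 1) * (magnus (gen m) * magnus v)
      = magnus (comm ?F v (gen m) \<otimes>\<^bsub>?F\<^esub> (gen m \<otimes>\<^bsub>?F\<^esub> v)) - magnus (gen m) * magnus v"
    by (simp add: magnus_mult algebra_simps)
  also have "comm ?F v (gen m) \<otimes>\<^bsub>?F\<^esub> (gen m \<otimes>\<^bsub>?F\<^esub> v) = v \<otimes>\<^bsub>?F\<^esub> gen m"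
    using v g by (simp add: comm_def F.word_simps del: mult_free_group one_free_group)
  also have "magnus (v \<otimes>\<^bsub>?F\<^esub> gen m) - magnus (gen m) * magnus v = magnus v * var m - var m * magnus v"
    by (simp add: magnus_mult gen_def letter_exp_def algebra_simps)
  finally have cm: "coef (magnus v * var m) u = coef (var m * magnus v) u" if "length u \<le> j" for u
    using that by (auto simp: aug_def)
  \<comment> \<open>Comparing coefficients at a word followed by m moves a leading m to the end.
    After \<open>p\<close> moves the word starts with \<open>a\<close>, which X_m times a series
    cannot produce. The extra letter m turns the bound \<open>\<le> j\<close> into
    \<open>< j\<close>.\<close>
  have rot: "coef (magnus v) (replicate p m @ a # s) = 0" if "a \<noteq> m" "p + length s + 1 < j" for p a s
    using that(2)
  proof (induction p arbitrary: s)
    case 0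
    then show ?case
      using cm[of "(a # s) @ [m]"] coef_mult_var(1)[of "magnus v" m "a # s" m]
        coef_var_mult(1)[of m "magnus v" a "s @ [m]"] that(1) by simp
  next
    case (Suc p)
    then show ?case
      using cm[of "(m # replicate p m @ a # s) @ [m]"] coef_mult_var(1)[of "magnus v" m "m # replicate p m @ a # s" m]
        coef_var_mult(1)[of m "magnus v" m "replicate p m @ a # s @ [m]"] Suc.IH[of "s @ [m]"] by simp
  qed
  have "expsum m (gen m [^]\<^bsub>?F\<^esub> e) = e" using m by (rule expsum_gen_pow)
  then have "expsum m v = 0" by (simp add: v_def expsum_mult e_def)
  then have pow: "coef (magnus v) (replicate p m) = coef 1 (replicate p m)" for p
    using coef_magnus_replicate[of v p m] by (simp add: var_exp_def)
  have "coef (magnus v) u = coef 1 u" if u: "length u < j" for u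
  proof (cases "\<exists>a \<in> set u. a \<noteq> m")
    case True
    then obtain p a s where "u = p @ a # s" "a \<noteq> m" "\<forall>b\<in>set p. \<not> b \<noteq> m"
      using split_list_first_prop[of u "\<lambda>a. a \<noteq> m"] by blast
    moreover from this have "p = replicate (length p) m"
      by (intro replicate_eqI) auto
    ultimately show ?thesis using rot[of a "length p" s] u by (simp add: coef_one)
  next
    case False
    then have "u = replicate (length u) m" by (intro replicate_eqI) auto
    then show ?thesis using pow[of "length u"] by simp
  qed
  then have "v \<in> dimension_subgroup n j"
    using v by (simp add: dimension_subgroup_def aug_def)
  then show ?thesis using dimension_subgroup_eq_lcs v_def by blast
qed


section \<open>Conjugates of generators\<close>

lemma reduced_append:
  "reduced (u @ v) \<longleftrightarrow> reduced u \<and> reduced v \<and> (u = [] \<or> v = [] \<or> hd v \<noteq> inv_letter (last u))"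
  by (auto simp: reduced_def successively_append_iff)

lemma wmult_append: "reduced (u @ v) \<Longrightarrow> u \<star> v = u @ v"
  by (induction u) (auto simp: reduced_Cons push_reduced)

lemma reduced_gen [simp]: "reduced (gen i)"
  by (simp add: gen_def reduced_Cons)

lemma reduced_winv [simp]: "reduced u \<Longrightarrow> reduced (winv u)"
  by (simp add: winv_def reduced_inverse)

lemma reduced_wmult [simp]: "reduced v \<Longrightarrow> reduced (u \<star> v)"
  by (rule reduced_foldr_push)

lemma free_group_reduced: "w \<in> carrier (free_group n) \<Longrightarrow> reduced w"
  by (simp add: mem_free_group)

lemma winv_winv [simp]: "winv (winv u) = u"
  by (simp add: winv_def rev_map comp_def)

lemma winv_Nil [simp]: "winv [] = []"
  by (simp add: winv_def)

lemma wmult_assoc [simp]: "\<lbrakk>reduced v; reduced w\<rbrakk> \<Longrightarrow> (u \<star> v) \<star> w = u \<star> v \<star> w"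
  by (rule foldr_push_assoc)

lemma wmult_Nil [simp]: "reduced u \<Longrightarrow> u \<star> [] = u"
  by (rule foldr_push_Nil)

lemma winv_wmult_self [simp]: "winv u \<star> u = []"
  by (simp add: winv_def foldr_push_inverse)

lemma wmult_winv_self [simp]: "u \<star> winv u = []"
  using winv_wmult_self[of "winv u"] by simp

lemma winv_cancel [simp]: "\<lbrakk>reduced u; reduced v\<rbrakk> \<Longrightarrow> winv u \<star> u \<star> v = v"
  using wmult_assoc[of u v "winv u"] by simp

lemma wmult_winv_cancel [simp]: "\<lbrakk>reduced u; reduced v\<rbrakk> \<Longrightarrow> u \<star> winv u \<star> v = v"
  using wmult_assoc[of "winv u" v u] by simp

lemma winv_unique: "\<lbrakk>reduced u; reduced v; u \<star> v = []\<rbrakk> \<Longrightarrow> v = winv u"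
  using winv_cancel[of u v] by simp

lemma winv_wmult [simp]:
  assumes "reduced u" "reduced v"
  shows "winv (u \<star> v) = winv v \<star> winv u"
  using assms by (intro winv_unique[symmetric]) auto

lemma length_push: "length (push a w) \<le> Suc (length w)"
  by (cases w) auto

lemma length_wmult: "length (u \<star> v) \<le> length u + length v"
proof (induction u)
  case (Cons a u)
  then show ?case using length_push[of a "u \<star> v"] by simp
qed simp

lemma length_winv [simp]: "length (winv u) = length u"
  by (simp add: winv_def)

lemma winv_append [simp]: "winv (u @ v) = winv v @ winv u"
  by (simp add: winv_def)

lemma winv_Cons [simp]: "winv (a # v) = winv v @ [inv_letter a]"
  by (simp add: winv_def)

lemma winv_eq_Nil [simp]: "winv u = [] \<longleftrightarrow> u = []"
  by (simp add: winv_def)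

lemma hd_winv: "u \<noteq> [] \<Longrightarrow> hd (winv u) = inv_letter (last u)"
  by (simp add: winv_def hd_rev last_map)

lemma last_winv: "u \<noteq> [] \<Longrightarrow> last (winv u) = inv_letter (hd u)"
  by (simp add: winv_def last_rev hd_map)

definition cj :: "word \<Rightarrow> word \<Rightarrow> word"
  where "cj w x = w \<star> x \<star> winv w"

lemma cj_Nil [simp]: "reduced x \<Longrightarrow> cj [] x = x"
  by (simp add: cj_def)

lemma reduced_cj [simp]: "reduced w \<Longrightarrow> reduced (cj w x)"
  by (simp add: cj_def)

lemma cj_cj [simp]: "\<lbrakk>reduced u; reduced v; reduced x\<rbrakk> \<Longrightarrow> cj u (cj v x) = cj (u \<star> v) x"
  by (simp add: cj_def)

lemma cj_wmult: "\<lbrakk>reduced w; reduced x; reduced y\<rbrakk> \<Longrightarrow> cj w (x \<star> y) = cj w x \<star> cj w y"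
  by (simp add: cj_def)

lemma cj_winv: "\<lbrakk>reduced w; reduced x\<rbrakk> \<Longrightarrow> cj w (winv x) = winv (cj w x)"
  by (simp add: cj_def)

lemma cj_Nil_right [simp]: "reduced w \<Longrightarrow> cj w [] = []"
  by (simp add: cj_def)

lemma cj_closed:
  "\<lbrakk>w \<in> carrier (free_group n); x \<in> carrier (free_group n)\<rbrakk> \<Longrightarrow> cj w x \<in> carrier (free_group n)"
  using F.m_closed[of x n "winv w"] F.m_closed[of w n "x \<star> winv w"] winv_closed[of w n]
  by (simp add: cj_def)

text \<open>Normal form of a conjugator of x_k: nothing cancels in
  \<open>w @ (k, True) # winv w\<close>, so the central letter is visible and the length of the
  conjugate is 2 |w| + 1.\<close>

definition normalised :: "word \<Rightarrow> nat \<Rightarrow> bool"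
  where "normalised w k \<longleftrightarrow> reduced w \<and> (w = [] \<or> fst (last w) \<noteq> k)"

lemma normalised_exists:
  "reduced w \<Longrightarrow> \<exists>v e b. w = v @ replicate e (k, b) \<and> normalised v k"
proof (induction w rule: rev_induct)
  case Nil
  show ?case by (intro exI[of _ "[]"] exI[of _ 0]) (simp add: normalised_def)
next
  case (snoc a w)
  show ?case
  proof (cases "fst a = k")
    case False
    then show ?thesis
      using snoc.prems by (intro exI[of _ "w @ [a]"] exI[of _ 0]) (simp add: normalised_def)
  next
    case True
    have "reduced w" using snoc.prems by (simp add: reduced_append)
    then obtain v e b where v: "w = v @ replicate e (k, b)" "normalised v k"
      using snoc.IH by blast
    have "w @ [a] = v @ replicate (Suc e) (k, snd a)"
    proof (cases e)
      case 0 then show ?thesis using v True by (simp add: prod_eq_iff)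
    next
      case (Suc e')
      then have "last w = (k, b)" "w \<noteq> []" using v by auto
      then have "a \<noteq> inv_letter (k, b)" using snoc.prems by (auto simp: reduced_append)
      then have "a = (k, b)" using True by (auto simp: inv_letter_def prod_eq_iff)
      then show ?thesis using v by (simp add: replicate_append_same)
    qed
    then show ?thesis using v(2) by blast
  qed
qed

lemma cj_append_power:
  assumes "reduced (v @ replicate e (k, b))"
  shows "cj (v @ replicate e (k, b)) (gen k) = cj v (gen k)"
  using assms
proof (induction e)
  case (Suc e)
  let ?w = "v @ replicate e (k, b)"
  have eq: "v @ replicate (Suc e) (k, b) = ?w @ [(k, b)]" by (simp add: replicate_append_same)
  have w: "reduced ?w" using Suc.prems reduced_append[of ?w "[(k, b)]"] unfolding eq by blast
  have "?w @ [(k, b)] = ?w \<star> [(k, b)]"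
    using Suc.prems unfolding eq by (rule wmult_append[symmetric])
  moreover have "cj [(k, b)] (gen k) = gen k"
    by (cases b) (auto simp: cj_def gen_def inv_letter_def)
  ultimately have "cj (?w @ [(k, b)]) (gen k) = cj ?w (gen k)"
    using w cj_cj[of ?w "[(k, b)]" "gen k"] by (simp add: reduced_Cons)
  then show ?case using Suc.IH[OF w] unfolding eq by simp
qed simp

lemma cj_gen_normalised: "normalised v k \<Longrightarrow> cj v (gen k) = v @ (k, True) # winv v"
proof -
  assume v: "normalised v k"
  have "reduced (gen k @ winv v)"
    using v by (auto simp: reduced_append gen_def reduced_Cons normalised_def hd_winv inv_letter_def)
  then have 1: "gen k \<star> winv v = (k, True) # winv v" by (simp add: gen_def push_reduced)
  have "reduced (v @ (k, True) # winv v)"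
    using v \<open>reduced (gen k @ winv v)\<close> by (auto simp: reduced_append gen_def normalised_def inv_letter_def)
  then show ?thesis unfolding cj_def 1 by (rule wmult_append)
qed

lemma obtain_normalised:
  assumes "w \<in> carrier (free_group n)"
  obtains v where "normalised v k" "v \<in> carrier (free_group n)" "cj w (gen k) = cj v (gen k)"
proof -
  have r: "reduced w" using assms by (rule free_group_reduced)
  then obtain v e b where v: "w = v @ replicate e (k, b)" "normalised v k"
    using normalised_exists[OF r, of k] by blast
  have "v \<in> carrier (free_group n)"
    using assms v by (auto simp: mem_free_group reduced_append)
  then show ?thesis using that[of v] v cj_append_power[of v e k b] r by simp
qed

lemma length_cj_gen:
  assumes "reduced w" shows "length (cj w (gen k)) \<le> 2 * length w + 1"
  using length_wmult[of w "gen k \<star> winv w"] length_wmult[of "gen k" "winv w"]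
  by (simp add: cj_def gen_def)

text \<open>Stripping a final power of x_k leaves a normalised conjugator \<open>v\<close> of x_k to
  itself, and 2 |v| + 1 = 1 makes it empty.\<close>

lemma centralizer_gen:
  assumes w: "reduced w" and c: "cj w (gen k) = gen k"
  shows "\<exists>e b. w = replicate e (k, b)"
proof -
  obtain v e b where v: "w = v @ replicate e (k, b)" "normalised v k"
    using normalised_exists[OF w, of k] by blast
  have "cj v (gen k) = gen k" using v c cj_append_power[of v e k b] w by simp
  then have "length (v @ (k, True) # winv v) = 1"
    using cj_gen_normalised[OF v(2)] by (metis gen_def length_Cons list.size(3) One_nat_def)
  then show ?thesis using v by auto
qed


section \<open>Artin's reduction\<close>

primrec conj_prod :: "(word \<times> nat) list \<Rightarrow> word" where
  "conj_prod [] = []"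
| "conj_prod (p # ps) = cj (fst p) (gen (snd p)) \<star> conj_prod ps"

text \<open>
  In the product of two neighbouring conjugates neither central letter is absorbed by the other
  factor; if one is, a Hurwitz move shortens the tuple.
\<close>

definition unabsorbed :: "word \<times> nat \<Rightarrow> word \<times> nat \<Rightarrow> bool"
  where "unabsorbed p q \<longleftrightarrow>
    (\<nexists>t. fst q = fst p @ (snd p, False) # t) \<and> (\<nexists>t. fst p = fst q @ (snd q, True) # t)"

lemma reduced_conj_prod: "(\<And>p. p \<in> set ps \<Longrightarrow> reduced (fst p)) \<Longrightarrow> reduced (conj_prod ps)"
  by (induction ps) auto

text \<open>Induction from the right. The first conjugator is kept apart because it may still cancel
  against a factor to its left, whereas the central letters are protected and survive. They account
  for the length bound, and equality leaves no room for conjugators.\<close>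

lemma unabsorbed_conj_prod:
  assumes "ps \<noteq> []" "\<forall>p\<in>set ps. normalised (fst p) (snd p)" "successively unabsorbed ps"
  shows "\<exists>R. reduced ((snd (hd ps), True) # R) \<and> conj_prod ps = fst (hd ps) \<star> ((snd (hd ps), True) # R)
    \<and> Suc (length R) \<ge> length ps
    \<and> (Suc (length R) = length ps \<longrightarrow> (\<forall>p\<in>set ps. fst p = []) \<and> (snd (hd ps), True) # R = map (\<lambda>p. (snd p, True)) ps)"
  using assms
proof (induction ps)
  case (Cons p ps)
  obtain w k where p: "p = (w, k)" by fastforce
  have nw: "normalised w k" using Cons.prems p by simp
  then have w: "reduced w" by (simp add: normalised_def)
  have red_p: "reduced (conj_prod ps)"
    using Cons.prems by (intro reduced_conj_prod) (auto simp: normalised_def)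
  have prod: "conj_prod (p # ps) = w \<star> gen k \<star> winv w \<star> conj_prod ps"
    using w red_p by (simp add: p cj_def)
  show ?case
  proof (cases ps)
    case Nil
    have r: "reduced (gen k @ winv w)"
      using nw by (auto simp: reduced_append gen_def reduced_Cons normalised_def hd_winv inv_letter_def)
    then have "gen k \<star> winv w = (k, True) # winv w" by (simp add: gen_def push_reduced)
    then show ?thesis
      using Nil p prod r w by (intro exI[of _ "winv w"]) (auto simp: gen_def)
  next
    case (Cons q qs)
    obtain w' k' where q: "q = (w', k')" by fastforce
    have ab: "unabsorbed (w, k) (w', k')" and "successively unabsorbed ps"
      using Cons.prems(3) Cons p q by auto
    then obtain R where R: "reduced ((k', True) # R)" "conj_prod ps = w' \<star> ((k', True) # R)"
      "Suc (length R) \<ge> length ps"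
      "Suc (length R) = length ps \<Longrightarrow> (\<forall>p\<in>set ps. fst p = []) \<and> (k', True) # R = map (\<lambda>p. (snd p, True)) ps"
      using Cons.IH Cons.prems Cons q by auto
    have nw': "normalised w' k'" using Cons.prems Cons q by simp
    then have w': "reduced w'" by (simp add: normalised_def)
    \<comment> \<open>All cancellation between the neighbouring conjugators is their common prefix,
      so the junction \<open>winv s @ s'\<close> is already reduced.\<close>
    obtain c s s' where s: "w = c @ s" "w' = c @ s'" "s = [] \<or> s' = [] \<or> hd s \<noteq> hd s'"
      using longest_common_prefix[of w w'] by blast
    define t where "t = winv s @ s'"
    have red: "reduced c" "reduced s" "reduced s'" using w w' s by (auto simp: reduced_append)
    have "reduced t"
      using red s(3) by (auto simp: t_def reduced_append last_winv)
    have "winv w \<star> w' = (winv s \<star> winv c) \<star> (c \<star> s')"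
      using wmult_append[of c s] wmult_append[of c s'] w w' s red by simp
    also have "\<dots> = winv s \<star> s'" using red by simp
    also have "\<dots> = t" using \<open>reduced t\<close> by (simp add: t_def wmult_append)
    finally have t: "winv w \<star> w' = t" .
    \<comment> \<open>If \<open>s'\<close> is empty, the junction ends in the inverse of the first
      letter of \<open>s\<close>. It could cancel x_{k'} only if \<open>w\<close> continued
      \<open>w'\<close> by that letter, which is the absorption excluded by hypothesis; otherwise
      \<open>w'\<close> being normalised suffices.\<close>
    have t_R: "reduced (t @ (k', True) # R)"
    proof -
      have "last t \<noteq> inv_letter (k', True)" if "t \<noteq> []"
      proof (cases "s' = []")
        case True
        then have "s \<noteq> []" "w = w' @ s" using that s by (auto simp: t_def)
        then have "hd s \<noteq> (k', True)"
          using ab unfolding unabsorbed_def by (metis fst_conv snd_conv list.collapse)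
        then show ?thesis using True \<open>s \<noteq> []\<close> by (auto simp: t_def last_winv)
             (metis inv_letter_inv_letter)
      next
        case False
        then have "last t = last w'" "w' \<noteq> []" using s by (auto simp: t_def)
        then show ?thesis using nw' by (auto simp: normalised_def inv_letter_def)
      qed
      then show ?thesis using \<open>reduced t\<close> R(1) inv_letter_inv_letter
        by (auto simp: reduced_append)
    qed
    have k_t_R: "reduced ((k, True) # t @ (k', True) # R)"
    proof -
      have "hd (t @ (k', True) # R) \<noteq> inv_letter (k, True)"
      proof (cases "t = []")
        case True then show ?thesis by (simp add: inv_letter_def)
      next
        case False
        have "hd t \<noteq> (k, False)"
        proof (cases "s = []")
          case True
          then have "s' \<noteq> []" "w' = w @ s'" using False s by (auto simp: t_def)
          then have "hd s' \<noteq> (k, False)"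
            using ab unfolding unabsorbed_def by (metis fst_conv snd_conv list.collapse)
          then show ?thesis using True by (simp add: t_def)
        next
          case False
          then have "hd t = inv_letter (last w)" "w \<noteq> []" using s by (auto simp: t_def hd_winv)
          then show ?thesis using nw by (auto simp: normalised_def inv_letter_def)
        qed
        then show ?thesis using False by (simp add: inv_letter_def)
      qed
      then show ?thesis using t_R by (simp add: reduced_Cons)
    qed
    have "winv w \<star> conj_prod ps = t \<star> ((k', True) # R)"
      using R(1,2) w w' t wmult_assoc[of w' "(k', True) # R" "winv w"] by simp
    also have "\<dots> = t @ (k', True) # R" using t_R by (rule wmult_append)
    finally have "conj_prod (p # ps) = w \<star> gen k \<star> (t @ (k', True) # R)"
      using prod by simp
    also have "gen k \<star> (t @ (k', True) # R) = (k, True) # t @ (k', True) # R"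
      using wmult_append[of "gen k"] k_t_R by (simp add: gen_def push_reduced)
    finally have eq: "conj_prod (p # ps) = w \<star> ((k, True) # t @ (k', True) # R)" .
    have len: "length (p # ps) \<le> Suc (length (t @ (k', True) # R))" using R(3) by simp
    \<comment> \<open>There is no letter to spare: the junction is empty, so the two conjugators
      agree, and the second is empty by induction.\<close>
    have tight: "(\<forall>p\<in>set (p # ps). fst p = []) \<and> (k, True) # t @ (k', True) # R = map (\<lambda>p. (snd p, True)) (p # ps)"
      if "Suc (length (t @ (k', True) # R)) = length (p # ps)"
    proof -
      have "Suc (length t + length R) = length ps" using that by simp
      then have "length t = 0" and len_R: "Suc (length R) = length ps" using R(3) by linarith+
      then have "t = []" by simp
      then have "(\<forall>p\<in>set ps. fst p = []) \<and> (k', True) # R = map (\<lambda>p. (snd p, True)) ps"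
        using R(4) len_R by blast
      moreover from this have "w' = []" using Cons q by simp
      ultimately show ?thesis using \<open>t = []\<close> s p by (auto simp: t_def)
    qed
    show ?thesis
      using k_t_R eq len tight by (intro exI[of _ "t @ (k', True) # R"]) (auto simp: p)
  qed
qed simp

lemma boundary_eq: "boundary n = map (\<lambda>i. (i, True)) [1..<Suc n]"
proof -
  have "foldr (\<lambda>i w. gen i \<star> w) xs [] = map (\<lambda>i. (i, True)) xs" for xs
  proof (induction xs)
    case (Cons a xs)
    then show ?case by (cases xs) (auto simp: gen_def inv_letter_def)
  qed simp
  then show ?thesis by (simp add: boundary_def)
qed

text \<open>The word \<partial>_n has exactly as many letters as there are factors, so the length
  bound is attained and every conjugator is empty.\<close>

lemma conj_prod_boundary:
  assumes norm: "\<forall>p\<in>set ps. normalised (fst p) (snd p)" and ab: "successively unabsorbed ps"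
    and len: "length ps = n" and prod: "conj_prod ps = boundary n"
  shows "ps = map (\<lambda>i. ([], i)) [1..<Suc n]"
proof (cases "ps = []")
  case False
  obtain w k where hd: "hd ps = (w, k)" by fastforce
  have nw: "normalised w k" using norm False hd by (metis fst_conv list.set_sel(1) snd_conv)
  obtain R where R: "reduced ((k, True) # R)" "conj_prod ps = w \<star> ((k, True) # R)" "Suc (length R) \<ge> length ps"
    "Suc (length R) = length ps \<Longrightarrow> (\<forall>p\<in>set ps. fst p = []) \<and> (k, True) # R = map (\<lambda>p. (snd p, True)) ps"
    using unabsorbed_conj_prod[OF False norm ab] hd by auto
  have "reduced (w @ (k, True) # R)"
    using nw R(1) by (auto simp: reduced_append normalised_def inv_letter_def)
  then have eq: "w @ (k, True) # R = map (\<lambda>i. (i, True)) [1..<Suc n]"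
    using R(2) prod by (simp add: wmult_append boundary_eq)
  from arg_cong[OF eq, of length] have "length w + Suc (length R) = n" by simp
  then have "w = []" "Suc (length R) = length ps" using R(3) len by auto
  then have *: "\<forall>p\<in>set ps. fst p = []" "map (\<lambda>p. (snd p, True)) ps = map (\<lambda>i. (i, True)) [1..<Suc n]"
    using R(4) eq by auto
  from arg_cong[OF *(2), of "map fst"] have "map snd ps = [1..<Suc n]" by (simp add: comp_def)
  moreover have "map (\<lambda>p. ([], snd p)) ps = ps"
    using *(1) by (intro map_idI) (auto simp: prod_eq_iff)
  ultimately have "map (Pair []) [1..<Suc n] = ps"
    by (metis (no_types, lifting) comp_apply list.map_comp map_eq_conv)
  then show ?thesis by simp
qed (use len in simp)


section \<open>Automorphisms of free groups\<close>

lemma wmult_closed [simp]: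
  "\<lbrakk>u \<in> carrier (free_group n); v \<in> carrier (free_group n)\<rbrakk> \<Longrightarrow> u \<star> v \<in> carrier (free_group n)"
  using F.m_closed[of u n v] by simp

lemma Nil_closed [simp]: "[] \<in> carrier (free_group n)"
  by (simp add: mem_free_group)

declare winv_closed [simp] cj_closed [simp]

lemma inv_free_group_cj: "\<lbrakk>w \<in> carrier (free_group n); x \<in> carrier (free_group n)\<rbrakk>
    \<Longrightarrow> w \<otimes>\<^bsub>free_group n\<^esub> x \<otimes>\<^bsub>free_group n\<^esub> inv\<^bsub>free_group n\<^esub> w = cj w x"
  by (simp add: cj_def inv_free_group free_group_reduced)

abbreviation whom :: "nat \<Rightarrow> nat \<Rightarrow> (word \<Rightarrow> word) set"
  where "whom m n \<equiv> hom (free_group m) (free_group n)"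

lemma
  assumes f: "f \<in> whom m n"
  shows whom_closed: "u \<in> carrier (free_group m) \<Longrightarrow> f u \<in> carrier (free_group n)"
    and whom_wmult: "\<lbrakk>u \<in> carrier (free_group m); v \<in> carrier (free_group m)\<rbrakk> \<Longrightarrow> f (u \<star> v) = f u \<star> f v"
    and whom_Nil: "f [] = []"
    and whom_winv: "u \<in> carrier (free_group m) \<Longrightarrow> f (winv u) = winv (f u)"
    and whom_cj: "\<lbrakk>u \<in> carrier (free_group m); v \<in> carrier (free_group m)\<rbrakk> \<Longrightarrow> f (cj u v) = cj (f u) (f v)"
proof -
  interpret f: group_hom "free_group m" "free_group n" f
    using f by (simp add: group_hom_def group_hom_axioms_def group_free_group)
  show cl: "u \<in> carrier (free_group m) \<Longrightarrow> f u \<in> carrier (free_group n)" for u by simp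
  show mult: "\<lbrakk>u \<in> carrier (free_group m); v \<in> carrier (free_group m)\<rbrakk> \<Longrightarrow> f (u \<star> v) = f u \<star> f v" for u v
    using f.hom_mult[of u v] by simp
  show "f [] = []" using f.hom_one by simp
  show inv: "u \<in> carrier (free_group m) \<Longrightarrow> f (winv u) = winv (f u)" for u
    using f.hom_inv[of u] cl[of u] by (simp add: inv_free_group)
  show "\<lbrakk>u \<in> carrier (free_group m); v \<in> carrier (free_group m)\<rbrakk> \<Longrightarrow> f (cj u v) = cj (f u) (f v)"
    by (simp add: cj_def mult inv)
qed

lemma whom_compose: "\<lbrakk>f \<in> whom l m; g \<in> whom m n\<rbrakk> \<Longrightarrow> (\<lambda>w. g (f w)) \<in> whom l n"
  by (auto simp: hom_def Pi_iff)

lemma whom_id: "m \<le> n \<Longrightarrow> (\<lambda>w. w) \<in> whom m n"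
  using free_group_mono[of m n] by (auto simp: hom_def)

lemma whom_restrict: "f \<in> whom m n \<Longrightarrow> restrict f (carrier (free_group m)) \<in> whom m n"
  by (auto simp: hom_def Pi_iff)

lemma whom_eqI:
  "\<lbrakk>f \<in> whom m n; g \<in> whom m n; \<And>i. i \<in> {1..m} \<Longrightarrow> f (gen i) = g (gen i); w \<in> carrier (free_group m)\<rbrakk>
    \<Longrightarrow> f w = g w"
  by (rule free_group_hom_eq[OF group_free_group])

definition lift :: "nat \<Rightarrow> nat \<Rightarrow> (nat \<Rightarrow> word) \<Rightarrow> word \<Rightarrow> word"
  where "lift m n t = (THE h. h \<in> whom m n \<inter> extensional (carrier (free_group m)) \<and> (\<forall>i\<in>{1..m}. h (gen i) = t i))"

lemma
  assumes "\<And>i. i \<in> {1..m} \<Longrightarrow> t i \<in> carrier (free_group n)"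
  shows lift_whom: "lift m n t \<in> whom m n"
    and lift_ext: "lift m n t \<in> extensional (carrier (free_group m))"
    and lift_gen: "i \<in> {1..m} \<Longrightarrow> lift m n t (gen i) = t i"
proof -
  have "t \<in> {1..m} \<rightarrow> carrier (free_group n)" using assms by blast
  from theI'[OF free_group_universal[OF group_free_group this]]
  show "lift m n t \<in> whom m n" "lift m n t \<in> extensional (carrier (free_group m))"
    "i \<in> {1..m} \<Longrightarrow> lift m n t (gen i) = t i"
    unfolding lift_def by auto
qed

global_interpretation Aut: group "Aut_free n" for n
  by (rule F.AutoGroup)

lemma aut_iff: "\<phi> \<in> carrier (Aut_free n) \<longleftrightarrow>
    \<phi> \<in> whom n n \<and> bij_betw \<phi> (carrier (free_group n)) (carrier (free_group n)) \<and> \<phi> \<in> extensional (carrier (free_group n))"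
  by (auto simp: AutoGroup_def auto_def Bij_def)

lemma aut_whom: "\<phi> \<in> carrier (Aut_free n) \<Longrightarrow> \<phi> \<in> whom n n"
  by (simp add: aut_iff)

lemma aut_mult:
  "\<lbrakk>\<phi> \<in> carrier (Aut_free n); \<psi> \<in> carrier (Aut_free n)\<rbrakk>
    \<Longrightarrow> \<phi> \<otimes>\<^bsub>Aut_free n\<^esub> \<psi> = compose (carrier (free_group n)) \<phi> \<psi>"
  by (simp add: AutoGroup_def BijGroup_def auto_def)

lemma aut_mult_apply:
  "\<lbrakk>\<phi> \<in> carrier (Aut_free n); \<psi> \<in> carrier (Aut_free n); w \<in> carrier (free_group n)\<rbrakk>
    \<Longrightarrow> (\<phi> \<otimes>\<^bsub>Aut_free n\<^esub> \<psi>) w = \<phi> (\<psi> w)"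
  by (simp add: aut_mult compose_eq)

lemma aut_one_apply: "w \<in> carrier (free_group n) \<Longrightarrow> \<one>\<^bsub>Aut_free n\<^esub> w = w"
  by (simp add: AutoGroup_def BijGroup_def)

lemma aut_eqI:
  assumes "\<phi> \<in> carrier (Aut_free n)" "\<psi> \<in> carrier (Aut_free n)"
    and "\<And>i. i \<in> {1..n} \<Longrightarrow> \<phi> (gen i) = \<psi> (gen i)"
  shows "\<phi> = \<psi>"
proof (rule extensionalityI)
  show "\<phi> \<in> extensional (carrier (free_group n))" "\<psi> \<in> extensional (carrier (free_group n))"
    using assms by (simp_all add: aut_iff)
qed (use assms whom_eqI aut_whom in blast)

lemma aut_inv_apply:
  assumes "\<phi> \<in> carrier (Aut_free n)" "w \<in> carrier (free_group n)"
  shows "(inv\<^bsub>Aut_free n\<^esub> \<phi>) (\<phi> w) = w" "\<phi> ((inv\<^bsub>Aut_free n\<^esub> \<phi>) w) = w"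
proof -
  have i: "inv\<^bsub>Aut_free n\<^esub> \<phi> \<in> carrier (Aut_free n)" using assms by simp
  show "(inv\<^bsub>Aut_free n\<^esub> \<phi>) (\<phi> w) = w"
    using aut_mult_apply[OF i assms] Aut.l_inv[OF assms(1)] aut_one_apply[OF assms(2)] by simp
  show "\<phi> ((inv\<^bsub>Aut_free n\<^esub> \<phi>) w) = w"
    using aut_mult_apply[OF assms(1) i assms(2)] Aut.r_inv[OF assms(1)] aut_one_apply[OF assms(2)] by simp
qed

lemma aut_inv_eqI:
  assumes "\<phi> \<in> carrier (Aut_free n)" "\<phi> v = w" "v \<in> carrier (free_group n)"
  shows "(inv\<^bsub>Aut_free n\<^esub> \<phi>) w = v"
  using aut_inv_apply(1)[OF assms(1,3)] assms(2) by simp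

lemma lift_aut:
  assumes t: "\<And>i. i \<in> {1..n} \<Longrightarrow> t i \<in> carrier (free_group n)"
    and t': "\<And>i. i \<in> {1..n} \<Longrightarrow> t' i \<in> carrier (free_group n)"
    and tt': "\<And>i. i \<in> {1..n} \<Longrightarrow> lift n n t (t' i) = gen i"
    and t't: "\<And>i. i \<in> {1..n} \<Longrightarrow> lift n n t' (t i) = gen i"
  shows "lift n n t \<in> carrier (Aut_free n)"
proof -
  let ?f = "lift n n t" and ?g = "lift n n t'"
  have f: "?f \<in> whom n n" using t by (rule lift_whom)
  have g: "?g \<in> whom n n" using t' by (rule lift_whom)
  have fg: "?f (?g w) = w" if "w \<in> carrier (free_group n)" for w
    by (rule whom_eqI[OF whom_compose[OF g f] whom_id[OF order_refl] _ that])
      (use lift_gen[OF t'] tt' in simp)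
  have gf: "?g (?f w) = w" if "w \<in> carrier (free_group n)" for w
    by (rule whom_eqI[OF whom_compose[OF f g] whom_id[OF order_refl] _ that])
      (use lift_gen[OF t] t't in simp)
  have "bij_betw ?f (carrier (free_group n)) (carrier (free_group n))"
    using fg gf whom_closed[OF f] whom_closed[OF g] by (intro bij_betw_byWitness[of _ ?g]) auto
  then show ?thesis using f lift_ext[of n t n] t by (simp add: aut_iff)
qed


section \<open>Braid automorphisms\<close>

text \<open>Artin's half twist; the product of the two changed entries is still
  \<open>gen i \<star> gen (Suc i)\<close>.\<close>

definition braid_tuple :: "nat \<Rightarrow> nat \<Rightarrow> word"
  where "braid_tuple i j = (if j = i then cj (gen i) (gen (Suc i)) else if j = Suc i then gen i else gen j)"

definition braid_tuple_inv :: "nat \<Rightarrow> nat \<Rightarrow> word"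
  where "braid_tuple_inv i j =
    (if j = i then gen (Suc i) else if j = Suc i then cj (winv (gen (Suc i))) (gen i) else gen j)"

definition sig :: "nat \<Rightarrow> nat \<Rightarrow> word \<Rightarrow> word"
  where "sig n i = lift n n (braid_tuple i)"

lemma braid_tuple_closed:
  assumes "i \<in> {1..<n}" "j \<in> {1..n}"
  shows "braid_tuple i j \<in> carrier (free_group n)" "braid_tuple_inv i j \<in> carrier (free_group n)"
  using assms by (auto simp: braid_tuple_def braid_tuple_inv_def)

lemma sig_gen: "\<lbrakk>i \<in> {1..<n}; j \<in> {1..n}\<rbrakk> \<Longrightarrow> sig n i (gen j) = braid_tuple i j"
  unfolding sig_def by (rule lift_gen) (auto simp: braid_tuple_closed)

lemma sig_aut: "i \<in> {1..<n} \<Longrightarrow> sig n i \<in> carrier (Aut_free n)"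
proof -
  assume i: "i \<in> {1..<n}"
  let ?g = "lift n n (braid_tuple_inv i)"
  have f: "sig n i \<in> whom n n" unfolding sig_def using i by (intro lift_whom braid_tuple_closed)
  have g: "?g \<in> whom n n" using i by (intro lift_whom braid_tuple_closed)
  have gg: "?g (gen j) = braid_tuple_inv i j" if "j \<in> {1..n}" for j
    using i that by (intro lift_gen braid_tuple_closed)
  have x: "gen i \<in> carrier (free_group n)" "gen (Suc i) \<in> carrier (free_group n)" using i by auto
  show ?thesis
    unfolding sig_def
  proof (rule lift_aut[of n "braid_tuple i" "braid_tuple_inv i"])
    fix j assume j: "j \<in> {1..n}"
    have "sig n i (cj (winv (gen (Suc i))) (gen i)) = gen (Suc i)"
      using whom_cj[OF f winv_closed[OF x(2)] x(1)] whom_winv[OF f x(2)] i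
      by (simp add: sig_gen braid_tuple_def)
    then show "lift n n (braid_tuple i) (braid_tuple_inv i j) = gen j"
      using i j sig_gen[OF i] by (auto simp: sig_def[symmetric] braid_tuple_inv_def braid_tuple_def)
    have "?g (cj (gen i) (gen (Suc i))) = gen i"
      using whom_cj[OF g x] i by (simp add: gg braid_tuple_inv_def)
    then show "?g (braid_tuple i j) = gen j"
      using i j gg by (auto simp: braid_tuple_inv_def braid_tuple_def)
  qed (use i braid_tuple_closed in auto)
qed

lemma boundary_closed: "boundary n \<in> carrier (free_group n)"
proof -
  have "reduced (map (\<lambda>i. (i, True)) xs)" for xs
    by (induction xs) (auto simp: reduced_Cons hd_map inv_letter_def)
  then show ?thesis by (auto simp: boundary_eq mem_free_group simp del: upt_Suc)
qed

lemma boundary_Suc: "boundary (Suc n) = boundary n \<star> gen (Suc n)"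
proof -
  have "boundary (Suc n) = boundary n @ gen (Suc n)" by (simp add: boundary_eq gen_def)
  moreover from this have "reduced (boundary n @ gen (Suc n))"
    using boundary_closed[of "Suc n"] by (simp add: free_group_reduced)
  ultimately show ?thesis by (simp add: wmult_append)
qed

text \<open>Artin's description of the full braid group. Hurwitz moves permute the strands, so the
  reduction cannot stay inside the pure braids.\<close>

definition braids :: "nat \<Rightarrow> (word \<Rightarrow> word) set"
  where "braids n = {\<phi> \<in> carrier (Aut_free n).
    (\<forall>i\<in>{1..n}. \<exists>k\<in>{1..n}. \<exists>w\<in>carrier (free_group n). \<phi> (gen i) = cj w (gen k)) \<and>
    \<phi> (boundary n) = boundary n}"

lemma braids_aut: "\<phi> \<in> braids n \<Longrightarrow> \<phi> \<in> carrier (Aut_free n)"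
  by (simp add: braids_def)

lemma braids_mult:
  assumes "\<phi> \<in> braids n" "\<psi> \<in> braids n"
  shows "\<phi> \<otimes>\<^bsub>Aut_free n\<^esub> \<psi> \<in> braids n"
proof -
  have aut: "\<phi> \<in> carrier (Aut_free n)" "\<psi> \<in> carrier (Aut_free n)" using assms by (auto simp: braids_def)
  have "\<exists>k\<in>{1..n}. \<exists>w\<in>carrier (free_group n). (\<phi> \<otimes>\<^bsub>Aut_free n\<^esub> \<psi>) (gen i) = cj w (gen k)"
    if i: "i \<in> {1..n}" for i
  proof -
    obtain k w where k: "k \<in> {1..n}" and w: "w \<in> carrier (free_group n)" "\<psi> (gen i) = cj w (gen k)"
      using assms(2) i unfolding braids_def by blast
    obtain l v where l: "l \<in> {1..n}" and v: "v \<in> carrier (free_group n)" "\<phi> (gen k) = cj v (gen l)"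
      using assms(1) k unfolding braids_def by blast
    have cl: "\<phi> w \<in> carrier (free_group n)" by (rule whom_closed[OF aut_whom[OF aut(1)] w(1)])
    have "(\<phi> \<otimes>\<^bsub>Aut_free n\<^esub> \<psi>) (gen i) = cj (\<phi> w) (cj v (gen l))"
      using aut i k w v whom_cj[OF aut_whom[OF aut(1)] w(1), of "gen k"] by (simp add: aut_mult_apply)
    also have "\<dots> = cj (\<phi> w \<star> v) (gen l)"
      using cl v l by (simp add: free_group_reduced)
    finally show ?thesis using l cl v by (intro bexI[of _ l] bexI[of _ "\<phi> w \<star> v"]) auto
  qed
  then show ?thesis
    using assms aut boundary_closed by (simp add: braids_def aut_mult_apply)
qed

lemma whom_boundary_fix:
  assumes f: "f \<in> whom n n" and "k \<le> l" "l \<le> n" "f (boundary k) = boundary k"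
    and "\<And>j. \<lbrakk>k < j; j \<le> l\<rbrakk> \<Longrightarrow> f (gen j) = gen j"
  shows "f (boundary l) = boundary l"
  using assms(2-)
proof (induction l rule: dec_induct)
  case (step l)
  have "boundary l \<in> carrier (free_group n)"
    using step boundary_closed[of l] free_group_mono[of l n] by auto
  then show ?case
    using step whom_wmult[OF f, of "boundary l" "gen (Suc l)"] by (simp add: boundary_Suc)
qed

lemma boundary_0 [simp]: "boundary 0 = []"
  by (simp add: boundary_eq)

lemma sig_boundary:
  assumes i: "i \<in> {1..<n}"
  shows "sig n i (boundary n) = boundary n"
proof -
  have f: "sig n i \<in> whom n n" using sig_aut[OF i] by (rule aut_whom)
  obtain k where k: "i = Suc k" using i by (cases i) auto
  have cl: "boundary k \<in> carrier (free_group n)"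
    using i k boundary_closed[of k] free_group_mono[of k n] by auto
  have 1: "sig n i (boundary k) = boundary k"
    by (rule whom_boundary_fix[OF f, of 0]) (use i k sig_gen[OF i] whom_Nil[OF f] in \<open>auto simp: braid_tuple_def\<close>)
  have "sig n i (boundary (Suc i)) = boundary (Suc i)"
    using i k cl 1 whom_wmult[OF f] sig_gen[OF i]
    by (simp add: boundary_Suc free_group_reduced braid_tuple_def cj_def)
  then show ?thesis
    by (rule whom_boundary_fix[OF f, of "Suc i", rotated 2]) (use i sig_gen[OF i] in \<open>auto simp: braid_tuple_def\<close>)
qed

lemma sig_braids:
  assumes i: "i \<in> {1..<n}"
  shows "sig n i \<in> braids n"
proof -
  have "\<exists>k\<in>{1..n}. \<exists>w\<in>carrier (free_group n). sig n i (gen j) = cj w (gen k)" if j: "j \<in> {1..n}" for j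
  proof -
    consider "j = i" | "j = Suc i" | "j \<noteq> i" "j \<noteq> Suc i" by blast
    then show ?thesis
    proof cases
      case 1
      then show ?thesis using i j sig_gen[OF i j]
        by (intro bexI[of _ "Suc i"] bexI[of _ "gen i"]) (auto simp: braid_tuple_def)
    next
      case 2
      then show ?thesis using i j sig_gen[OF i j]
        by (intro bexI[of _ i] bexI[of _ "[]"]) (auto simp: braid_tuple_def)
    next
      case 3
      then show ?thesis using i j sig_gen[OF i j]
        by (intro bexI[of _ j] bexI[of _ "[]"]) (auto simp: braid_tuple_def)
    qed
  qed
  then show ?thesis using sig_aut[OF i] sig_boundary[OF i] by (simp add: braids_def)
qed

lemma sig_inv_gen:
  assumes i: "i \<in> {1..<n}" and j: "j \<in> {1..n}"
  shows "(inv\<^bsub>Aut_free n\<^esub> (sig n i)) (gen j) = braid_tuple_inv i j"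
proof -
  have f: "sig n i \<in> whom n n" using sig_aut[OF i] by (rule aut_whom)
  have x: "gen i \<in> carrier (free_group n)" "gen (Suc i) \<in> carrier (free_group n)" using i by auto
  have "sig n i (cj (winv (gen (Suc i))) (gen i)) = gen (Suc i)"
    using whom_cj[OF f winv_closed[OF x(2)] x(1)] whom_winv[OF f x(2)] i
    by (simp add: sig_gen braid_tuple_def)
  then have "sig n i (braid_tuple_inv i j) = gen j"
    using i j sig_gen[OF i] by (auto simp: braid_tuple_inv_def braid_tuple_def)
  then show ?thesis
    by (rule aut_inv_eqI[OF sig_aut[OF i]]) (use i j braid_tuple_closed in blast)
qed

lemma sig_inv_braids:
  assumes i: "i \<in> {1..<n}"
  shows "inv\<^bsub>Aut_free n\<^esub> (sig n i) \<in> braids n"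
proof -
  have "\<exists>k\<in>{1..n}. \<exists>w\<in>carrier (free_group n). (inv\<^bsub>Aut_free n\<^esub> (sig n i)) (gen j) = cj w (gen k)" if j: "j \<in> {1..n}" for j
  proof -
    consider "j = i" | "j = Suc i" | "j \<noteq> i" "j \<noteq> Suc i" by blast
    then show ?thesis
    proof cases
      case 1
      then show ?thesis using i j sig_inv_gen[OF i j]
        by (intro bexI[of _ "Suc i"] bexI[of _ "[]"]) (auto simp: braid_tuple_inv_def)
    next
      case 2
      then show ?thesis using i j sig_inv_gen[OF i j]
        by (intro bexI[of _ i] bexI[of _ "winv (gen (Suc i))"]) (auto simp: braid_tuple_inv_def)
    next
      case 3
      then show ?thesis using i j sig_inv_gen[OF i j]
        by (intro bexI[of _ j] bexI[of _ "[]"]) (auto simp: braid_tuple_inv_def)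
    qed
  qed
  then show ?thesis
    using sig_aut[OF i] aut_inv_eqI[OF sig_aut[OF i] sig_boundary[OF i] boundary_closed]
    by (simp add: braids_def)
qed

lemma conj_prod_snoc:
  "\<lbrakk>\<And>p. p \<in> set ps \<Longrightarrow> reduced (fst p); reduced (fst q)\<rbrakk>
    \<Longrightarrow> conj_prod (ps @ [q]) = conj_prod ps \<star> cj (fst q) (gen (snd q))"
  by (induction ps) (auto simp: reduced_conj_prod)

lemma whom_boundary:
  assumes f: "f \<in> whom n m" and "k \<le> n"
    and w: "\<And>i. i \<in> {1..n} \<Longrightarrow> reduced (fst (p i)) \<and> f (gen i) = cj (fst (p i)) (gen (snd (p i)))"
  shows "f (boundary k) = conj_prod (map p [1..<Suc k])"
  using assms(2)
proof (induction k)
  case 0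
  then show ?case using whom_Nil[OF f] by simp
next
  case (Suc k)
  have "boundary k \<in> carrier (free_group n)"
    using Suc.prems boundary_closed[of k] free_group_mono[of k n] by auto
  then have "f (boundary (Suc k)) = conj_prod (map p [1..<Suc k]) \<star> cj (fst (p (Suc k))) (gen (snd (p (Suc k))))"
    using Suc whom_wmult[OF f, of "boundary k" "gen (Suc k)"] w[of "Suc k"] by (simp add: boundary_Suc)
  moreover have "conj_prod (map p [1..<Suc k] @ [p (Suc k)])
      = conj_prod (map p [1..<Suc k]) \<star> cj (fst (p (Suc k))) (gen (snd (p (Suc k))))"
    using w Suc.prems by (intro conj_prod_snoc) auto
  ultimately show ?case by simp
qed

definition braid_length :: "nat \<Rightarrow> (word \<Rightarrow> word) \<Rightarrow> nat"
  where "braid_length n \<phi> = (\<Sum>i\<in>{1..n}. length (\<phi> (gen i)))"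

lemma braid_length_less:
  assumes i: "i \<in> {1..<n}"
    and "\<And>j. \<lbrakk>j \<in> {1..n}; j \<noteq> i; j \<noteq> Suc i\<rbrakk> \<Longrightarrow> \<psi> (gen j) = \<phi> (gen j)"
    and "length (\<psi> (gen i)) + length (\<psi> (gen (Suc i))) < length (\<phi> (gen i)) + length (\<phi> (gen (Suc i)))"
  shows "braid_length n \<psi> < braid_length n \<phi>"
proof -
  have split: "braid_length n \<theta> = length (\<theta> (gen i)) + length (\<theta> (gen (Suc i)))
      + (\<Sum>j\<in>{1..n} - {i, Suc i}. length (\<theta> (gen j)))" for \<theta> :: "word \<Rightarrow> word"
    unfolding braid_length_def using i sum.subset_diff[of "{i, Suc i}" "{1..n}" "\<lambda>j. length (\<theta> (gen j))"] by auto
  have "(\<Sum>j\<in>{1..n} - {i, Suc i}. length (\<psi> (gen j))) = (\<Sum>j\<in>{1..n} - {i, Suc i}. length (\<phi> (gen j)))"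
    using assms(2) by (intro sum.cong) auto
  then show ?thesis using assms(3) split[of \<psi>] split[of \<phi>] by linarith
qed

text \<open>Precomposing with a half twist or its inverse performs a Hurwitz move on the tuple of
  images. The total length drops as long as some neighbours absorb a letter; an unabsorbed tuple
  with product \<partial>_n is the standard one.\<close>

theorem braids_generated: "\<phi> \<in> braids n \<Longrightarrow> \<phi> \<in> generate (Aut_free n) (sig n ` {1..<n})"
proof (induction "braid_length n \<phi>" arbitrary: \<phi> rule: less_induct)
  case less
  let ?A = "Aut_free n"
  have \<phi>: "\<phi> \<in> carrier ?A" using less.prems by (rule braids_aut)
  have f: "\<phi> \<in> whom n n" using \<phi> by (rule aut_whom)
  have "\<exists>p. i \<in> {1..n} \<longrightarrow> normalised (fst p) (snd p) \<and> fst p \<in> carrier (free_group n) \<and> snd p \<in> {1..n} \<and> \<phi> (gen i) = cj (fst p) (gen (snd p))" for i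
  proof (cases "i \<in> {1..n}")
    case True
    then obtain k w where k: "k \<in> {1..n}" "w \<in> carrier (free_group n)" "\<phi> (gen i) = cj w (gen k)"
      using less.prems unfolding braids_def by blast
    obtain v where "normalised v k" "v \<in> carrier (free_group n)" "cj w (gen k) = cj v (gen k)"
      using k(2) by (rule obtain_normalised)
    then show ?thesis using k by (intro exI[of _ "(v, k)"]) simp
  qed auto
  then obtain p where p: "\<And>i. i \<in> {1..n} \<Longrightarrow> normalised (fst (p i)) (snd (p i)) \<and> fst (p i) \<in> carrier (free_group n) \<and> snd (p i) \<in> {1..n} \<and> \<phi> (gen i) = cj (fst (p i)) (gen (snd (p i)))"
    by metis
  have prod: "conj_prod (map p [1..<Suc n]) = boundary n"
    using whom_boundary[OF f order_refl, of p] p less.prems by (auto simp: braids_def normalised_def)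
  have len: "length (\<phi> (gen i)) = 2 * length (fst (p i)) + 1" if "i \<in> {1..n}" for i
    using p[OF that] cj_gen_normalised[of "fst (p i)" "snd (p i)"] by simp
  show ?case
  proof (cases "successively unabsorbed (map p [1..<Suc n])")
    case True
    have "\<forall>q\<in>set (map p [1..<Suc n]). normalised (fst q) (snd q)"
    proof
      fix q assume "q \<in> set (map p [1..<Suc n])"
      then have "q \<in> p ` {1..n}" by (simp only: set_map set_upt atLeastLessThanSuc_atLeastAtMost)
      then obtain i where i: "i \<in> {1..n}" "q = p i" by (rule imageE)
      then show "normalised (fst q) (snd q)" using p[OF i(1)] by blast
    qed
    then have eq: "map p [1..<Suc n] = map (\<lambda>i. ([], i)) [1..<Suc n]"
      by (rule conj_prod_boundary[OF _ True _ prod]) simp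
    have pi: "p i = ([], i)" if "i \<in> {1..n}" for i
      using eq that unfolding map_eq_conv set_upt atLeastLessThanSuc_atLeastAtMost by blast
    have "\<phi> = \<one>\<^bsub>?A\<^esub>"
    proof (rule aut_eqI[OF \<phi> Aut.one_closed])
      fix i assume i: "i \<in> {1..n}"
      then show "\<phi> (gen i) = \<one>\<^bsub>?A\<^esub> (gen i)"
        using p[OF i] pi[OF i] aut_one_apply[of "gen i" n] by simp
    qed
    then show ?thesis by (simp add: generate.one)
  next
    case False
    then obtain j where j: "Suc j < n" "\<not> unabsorbed (p (Suc j)) (p (Suc (Suc j)))"
      unfolding successively_conv_nth by (auto simp del: upt_Suc)
    define i where "i = Suc j"
    have i: "i \<in> {1..<n}" "\<not> unabsorbed (p i) (p (Suc i))" using j by (auto simp: i_def)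
    have ii: "i \<in> {1..n}" "Suc i \<in> {1..n}" using i by auto
    obtain w k where wk: "p i = (w, k)" by fastforce
    obtain w' k' where wk': "p (Suc i) = (w', k')" by fastforce
    have pw: "normalised w k" "w \<in> carrier (free_group n)" "k \<in> {1..n}" "\<phi> (gen i) = cj w (gen k)"
      and pw': "normalised w' k'" "w' \<in> carrier (free_group n)" "k' \<in> {1..n}" "\<phi> (gen (Suc i)) = cj w' (gen k')"
      using p[OF ii(1)] p[OF ii(2)] wk wk' by auto
    have r: "reduced w" "reduced w'" using pw pw' by (auto simp: normalised_def)
    have x: "gen i \<in> carrier (free_group n)" "gen (Suc i) \<in> carrier (free_group n)" using i by auto
    have s: "sig n i \<in> carrier ?A" using i by (intro sig_aut)
    have sg: "sig n i \<in> generate ?A (sig n ` {1..<n})" using i by (intro generate.incl) auto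
    have incl: "sig n ` {1..<n} \<subseteq> carrier ?A" using sig_aut by auto
    consider t where "w' = w @ (k, False) # t" | t where "w = w' @ (k', True) # t"
      using i(2) wk wk' by (auto simp: unabsorbed_def)
    then show ?thesis
    proof cases
      case (1 t)
      have t: "reduced t" and kt: "reduced ((k, False) # t)" using r(2) 1 by (auto simp: reduced_append reduced_Cons)
      \<comment> \<open>Conjugating the second entry by the first cancels the letter x_k^-1, so
        after the move its conjugator is \<open>w \<star> t\<close>, shorter than
        \<open>w'\<close>.\<close>
      have w': "w' = w \<star> winv (gen k) \<star> t"
        using wmult_append[of w "(k, False) # t"] push_reduced[OF kt] r(2) 1 by (simp add: winv_gen)
      let ?\<psi> = "\<phi> \<otimes>\<^bsub>?A\<^esub> sig n i"
      have \<psi>: "?\<psi> (gen j) = \<phi> (braid_tuple i j)" if "j \<in> {1..n}" for j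
        using aut_mult_apply[OF \<phi> s, of "gen j"] sig_gen[OF i(1) that] that by simp
      have "?\<psi> (gen i) = cj (cj w (gen k)) (cj w' (gen k'))"
        using \<psi>[OF ii(1)] whom_cj[OF f x] pw pw' by (simp add: braid_tuple_def)
      also have "\<dots> = cj (w \<star> t) (gen k')"
        using r t by (simp add: w' cj_def)
      finally have "length (?\<psi> (gen i)) \<le> 2 * length (w \<star> t) + 1"
        using r t length_cj_gen by simp
      then have "length (?\<psi> (gen i)) < length (\<phi> (gen (Suc i)))"
        using len[OF ii(2)] wk' 1 length_wmult[of w t] by simp
      moreover have "?\<psi> (gen (Suc i)) = \<phi> (gen i)" using \<psi>[OF ii(2)] by (simp add: braid_tuple_def)
      ultimately have "braid_length n ?\<psi> < braid_length n \<phi>"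
        using \<psi> by (intro braid_length_less[OF i(1)]) (auto simp: braid_tuple_def)
      moreover have "?\<psi> \<in> braids n" using less.prems sig_braids[OF i(1)] by (rule braids_mult)
      ultimately have "?\<psi> \<in> generate ?A (sig n ` {1..<n})" by (rule less.hyps)
      then have "?\<psi> \<otimes>\<^bsub>?A\<^esub> inv\<^bsub>?A\<^esub> (sig n i) \<in> generate ?A (sig n ` {1..<n})"
        by (rule generate.eng[OF _ Aut.generate_m_inv_closed[OF incl sg]])
      then show ?thesis using \<phi> s by (simp add: Aut.m_assoc)
    next
      case (2 t)
      have t: "reduced t" and kt: "reduced ((k', True) # t)" using r(1) 2 by (auto simp: reduced_append reduced_Cons)
      \<comment> \<open>The mirror case: the inverse twist conjugates the first entry by the inverse
        of the second and removes the letter x_{k'} from \<open>w\<close>.\<close>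
      have w: "w = w' \<star> gen k' \<star> t"
        using wmult_append[of w' "(k', True) # t"] push_reduced[OF kt] r(1) 2 by (simp add: gen_def)
      let ?\<psi> = "\<phi> \<otimes>\<^bsub>?A\<^esub> inv\<^bsub>?A\<^esub> (sig n i)"
      have \<psi>: "?\<psi> (gen j) = \<phi> (braid_tuple_inv i j)" if "j \<in> {1..n}" for j
        using aut_mult_apply[OF \<phi> Aut.inv_closed[OF s], of "gen j"] sig_inv_gen[OF i(1) that] that by simp
      have "?\<psi> (gen (Suc i)) = cj (winv (cj w' (gen k'))) (cj w (gen k))"
        using \<psi>[OF ii(2)] whom_cj[OF f winv_closed[OF x(2)] x(1)] whom_winv[OF f x(2)] pw pw'
        by (simp add: braid_tuple_inv_def)
      also have "\<dots> = cj (w' \<star> t) (gen k)"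
        using r t by (simp add: w cj_def)
      finally have "length (?\<psi> (gen (Suc i))) \<le> 2 * length (w' \<star> t) + 1"
        using r t length_cj_gen by simp
      then have "length (?\<psi> (gen (Suc i))) < length (\<phi> (gen i))"
        using len[OF ii(1)] wk 2 length_wmult[of w' t] by simp
      moreover have "?\<psi> (gen i) = \<phi> (gen (Suc i))" using \<psi>[OF ii(1)] by (simp add: braid_tuple_inv_def)
      ultimately have "braid_length n ?\<psi> < braid_length n \<phi>"
        using \<psi> by (intro braid_length_less[OF i(1)]) (auto simp: braid_tuple_inv_def)
      moreover have "?\<psi> \<in> braids n" using less.prems sig_inv_braids[OF i(1)] by (rule braids_mult)
      ultimately have "?\<psi> \<in> generate ?A (sig n ` {1..<n})" by (rule less.hyps)
      then have "?\<psi> \<otimes>\<^bsub>?A\<^esub> sig n i \<in> generate ?A (sig n ` {1..<n})"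
        using sg by (rule generate.eng)
      then show ?thesis using \<phi> s by (simp add: Aut.m_assoc)
    qed
  qed
qed


section \<open>Combing\<close>

context group
begin

lemma commute_inv_left:
  assumes "x \<in> carrier G" "y \<in> carrier G" "x \<otimes> y = y \<otimes> x"
  shows "inv x \<otimes> y = y \<otimes> inv x"
proof -
  have "inv x \<otimes> y = inv x \<otimes> (y \<otimes> x) \<otimes> inv x" using assms(1,2) by (simp add: m_assoc)
  also have "\<dots> = y \<otimes> inv x" using assms(1,2) by (simp add: assms(3)[symmetric] m_assoc)
  finally show ?thesis .
qed

lemma commute_mult_left:
  assumes "x \<in> carrier G" "y \<in> carrier G" "z \<in> carrier G" "x \<otimes> z = z \<otimes> x" "y \<otimes> z = z \<otimes> y"
  shows "x \<otimes> y \<otimes> z = z \<otimes> (x \<otimes> y)"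
  using assms by (metis m_assoc)

end

text \<open>
  Elements satisfying the braid relations on \<open>n + 1\<close> strands. The elements \<open>pull k\<close> are coset
  representatives for the stabiliser of the last strand, and the \<open>pushes k\<close> carry the last strand
  around the \<open>k\<close>-th one.
\<close>

locale braid_relations = group G for G (structure) +
  fixes s :: "nat \<Rightarrow> 'a" and n :: nat
  assumes s_closed: "i \<in> {1..n} \<Longrightarrow> s i \<in> carrier G"
    and far: "\<lbrakk>i \<in> {1..n}; j \<in> {1..n}; Suc i < j\<rbrakk> \<Longrightarrow> s i \<otimes> s j = s j \<otimes> s i"
    and braid: "\<lbrakk>i \<in> {1..n}; Suc i \<in> {1..n}\<rbrakk> \<Longrightarrow> s i \<otimes> s (Suc i) \<otimes> s i = s (Suc i) \<otimes> s i \<otimes> s (Suc i)"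
begin

text \<open>\<open>pull k\<close> is s_n^-1 ... s_k^-1, the empty product for \<open>Suc n\<close>.
  The auxiliary function counts factors because the product is built from the top index
  down.\<close>

primrec pull_aux :: "nat \<Rightarrow> 'a" where
  "pull_aux 0 = \<one>"
| "pull_aux (Suc m) = pull_aux m \<otimes> inv (s (n - m))"

definition pull :: "nat \<Rightarrow> 'a"
  where "pull k = pull_aux (Suc n - k)"

lemma pull_last [simp]: "pull (Suc n) = \<one>"
  by (simp add: pull_def)

lemma pull_step: "k \<in> {1..n} \<Longrightarrow> pull k = pull (Suc k) \<otimes> inv (s k)"
  by (simp add: pull_def Suc_diff_le)

lemma pull_closed: "k \<in> {1..Suc n} \<Longrightarrow> pull k \<in> carrier G"
proof (cases "k = Suc n")
  case False
  assume "k \<in> {1..Suc n}"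
  then have "k \<le> Suc n" "1 \<le> k" by auto
  then show ?thesis
    by (induction k rule: inc_induct) (auto simp: pull_step s_closed)
qed simp

lemma pull_commute_low:
  assumes "1 \<le> i" "Suc i < k" "k \<le> Suc n"
  shows "pull k \<otimes> s i = s i \<otimes> pull k"
  using assms(3,2)
proof (induction k rule: inc_induct)
  case base
  then show ?case using assms s_closed[of i] by simp
next
  case (step k)
  have k: "k \<in> {1..n}" "Suc k \<in> {1..Suc n}" and i: "i \<in> {1..n}" using step assms by auto
  have "inv (s k) \<otimes> s i = s i \<otimes> inv (s k)"
    using far[OF i k(1)] step s_closed[OF k(1)] s_closed[OF i] by (intro commute_inv_left) auto
  then show ?case
    unfolding pull_step[OF k(1)] using step pull_closed[OF k(2)] s_closed[OF k(1)] s_closed[OF i]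
    by (intro commute_mult_left) auto
qed

lemma braid_inv:
  assumes "i \<in> {1..n}" "Suc i \<in> {1..n}"
  shows "inv (s (Suc i)) \<otimes> inv (s i) \<otimes> s (Suc i) = s i \<otimes> inv (s (Suc i)) \<otimes> inv (s i)"
proof -
  note c = s_closed[OF assms(1)] s_closed[OF assms(2)]
  have "inv (s (Suc i)) \<otimes> inv (s i) \<otimes> s (Suc i)
      = inv (s (Suc i)) \<otimes> inv (s i) \<otimes> (s (Suc i) \<otimes> s i \<otimes> s (Suc i)) \<otimes> inv (s (Suc i)) \<otimes> inv (s i)"
    using c by (simp add: m_assoc)
  also have "\<dots> = s i \<otimes> inv (s (Suc i)) \<otimes> inv (s i)"
    using c unfolding braid[OF assms, symmetric] by (simp add: m_assoc)
  finally show ?thesis .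
qed

text \<open>At k = i - 1 this is the braid relation in the form \<open>braid_inv\<close>; each
  further factor s_k^-1 commutes with s_i.\<close>

lemma pull_commute_high:
  assumes "i \<in> {1..n}" "k < i" "1 \<le> k"
  shows "pull k \<otimes> s i = s (i - 1) \<otimes> pull k"
proof -
  have "k \<le> i - 1" "i - 1 \<ge> 1" using assms by auto
  then show ?thesis using assms(3)
  proof (induction k rule: inc_induct)
    case base
    define j where "j = i - 1"
    have i: "i = Suc j" and j: "j \<in> {1..n}" "Suc j \<in> {1..n}" "Suc (Suc j) \<in> {1..Suc n}"
      using base assms by (auto simp: j_def)
    note c = s_closed[OF j(1)] s_closed[OF j(2)] pull_closed[OF j(3)]
    have "pull j \<otimes> s (Suc j) = pull (Suc (Suc j)) \<otimes> (inv (s (Suc j)) \<otimes> inv (s j) \<otimes> s (Suc j))"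
      using c by (simp add: pull_step[OF j(1)] pull_step[OF j(2)] m_assoc)
    also have "\<dots> = pull (Suc (Suc j)) \<otimes> s j \<otimes> inv (s (Suc j)) \<otimes> inv (s j)"
      unfolding braid_inv[OF j(1,2)] using c by (simp add: m_assoc)
    also have "\<dots> = s j \<otimes> pull j"
      using c pull_commute_low[of j "Suc (Suc j)"] j
      by (simp add: pull_step[OF j(1)] pull_step[OF j(2)] m_assoc)
    finally show ?case by (simp add: j_def[symmetric] i)
  next
    case (step k)
    have k: "k \<in> {1..n}" "Suc k \<in> {1..Suc n}" "i - 1 \<in> {1..n}" using step assms by auto
    note c = s_closed[OF k(1)] s_closed[OF assms(1)] s_closed[OF k(3)] pull_closed[OF k(2)]
    have "s k \<otimes> s i = s i \<otimes> s k" using step k assms by (intro far) auto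
    then have "inv (s k) \<otimes> s i = s i \<otimes> inv (s k)" using c by (intro commute_inv_left) auto
    then have "pull k \<otimes> s i = pull (Suc k) \<otimes> s i \<otimes> inv (s k)"
      using c by (simp add: pull_step[OF k(1)] m_assoc)
    also have "\<dots> = s (i - 1) \<otimes> pull k"
      using step c by (simp add: pull_step[OF k(1)] m_assoc)
    finally show ?case .
  qed
qed

definition pushes :: "nat \<Rightarrow> 'a"
  where "pushes k = pull (Suc k) \<otimes> s k \<otimes> s k \<otimes> inv (pull (Suc k))"

lemma pushes_closed: "k \<in> {1..n} \<Longrightarrow> pushes k \<in> carrier G"
  using pull_closed[of "Suc k"] s_closed[of k] by (simp add: pushes_def)

lemma pull_Suc_s: "k \<in> {1..n} \<Longrightarrow> pull (Suc k) \<otimes> s k = pushes k \<otimes> pull k"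
  using pull_closed[of "Suc k"] s_closed[of k] by (simp add: pushes_def pull_step m_assoc)

lemma pull_s: "k \<in> {1..n} \<Longrightarrow> pull k \<otimes> s k = pull (Suc k)"
  using pull_closed[of "Suc k"] s_closed[of k] by (simp add: pull_step m_assoc)

lemma pull_s_inv: "k \<in> {1..n} \<Longrightarrow> pull k \<otimes> inv (s k) = inv (pushes k) \<otimes> pull (Suc k)"
  using pull_closed[of "Suc k"] s_closed[of k] by (simp add: pushes_def pull_step m_assoc inv_mult_group)

lemma s_pushes_far:
  assumes i: "i \<in> {1..n}" "i < n" and k: "k \<in> {1..n}" "k \<noteq> i" "k \<noteq> Suc i"
  shows "s i \<otimes> pushes k = pushes k \<otimes> s i"
proof -
  have k': "Suc k \<in> {1..Suc n}" using k by auto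
  note c = s_closed[OF i(1)] s_closed[OF k(1)] pull_closed[OF k']
  consider "k < i" | "Suc i < k" using k by linarith
  then show ?thesis
  proof cases
    case 1
    have i': "Suc i \<in> {1..n}" using i by auto
    note c' = s_closed[OF i']
    have p: "pull (Suc k) \<otimes> s (Suc i) = s i \<otimes> pull (Suc k)"
      using pull_commute_high[OF i', of "Suc k"] 1 by simp
    have "inv (pull (Suc k)) \<otimes> (pull (Suc k) \<otimes> s (Suc i)) \<otimes> inv (pull (Suc k))
        = inv (pull (Suc k)) \<otimes> (s i \<otimes> pull (Suc k)) \<otimes> inv (pull (Suc k))"
      by (simp add: p)
    then have p': "s (Suc i) \<otimes> inv (pull (Suc k)) = inv (pull (Suc k)) \<otimes> s i"
      using c c' by (simp add: m_assoc)
    have f: "s k \<otimes> s (Suc i) = s (Suc i) \<otimes> s k" using far[OF k(1) i'] 1 by simp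
    have "s i \<otimes> pushes k = s i \<otimes> pull (Suc k) \<otimes> s k \<otimes> s k \<otimes> inv (pull (Suc k))"
      using c by (simp add: pushes_def m_assoc)
    also have "\<dots> = pull (Suc k) \<otimes> (s (Suc i) \<otimes> s k) \<otimes> s k \<otimes> inv (pull (Suc k))"
      using c c' by (simp add: p[symmetric] m_assoc)
    also have "\<dots> = pull (Suc k) \<otimes> s k \<otimes> (s (Suc i) \<otimes> s k) \<otimes> inv (pull (Suc k))"
      using c c' by (simp add: f[symmetric] m_assoc)
    also have "\<dots> = pull (Suc k) \<otimes> s k \<otimes> s k \<otimes> (s (Suc i) \<otimes> inv (pull (Suc k)))"
      using c c' by (simp add: f[symmetric] m_assoc)
    also have "\<dots> = pushes k \<otimes> s i"
      using c c' by (simp add: p' pushes_def m_assoc)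
    finally show ?thesis .
  next
    case 2
    have p: "pull (Suc k) \<otimes> s i = s i \<otimes> pull (Suc k)"
      using pull_commute_low[of i "Suc k"] i k 2 by simp
    have f: "s k \<otimes> s i = s i \<otimes> s k" using far[OF i(1) k(1) 2] by simp
    have "pushes k \<otimes> s i = s i \<otimes> pushes k"
      unfolding pushes_def using c p f by (intro commute_mult_left commute_inv_left) auto
    then show ?thesis by simp
  qed
qed

text \<open>These are the two push generators that s_i does not commute with. The relations yield
  the conjugates by s_i and its inverse as words in the push generators, which is why
  \<open>low_group\<close> normalises \<open>push_group\<close>.\<close>

lemma
  assumes i: "i \<in> {1..n}" "i < n"
  shows s_pushes_Suc: "s i \<otimes> pushes (Suc i) = pushes i \<otimes> s i"
    and s_pushes: "pushes i \<otimes> s i \<otimes> pushes i = pushes (Suc i) \<otimes> pushes i \<otimes> s i"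
proof -
  define a b p where "a = s i" and "b = s (Suc i)" and "p = pull (Suc (Suc i))"
  have i': "Suc i \<in> {1..n}" "Suc (Suc i) \<in> {1..Suc n}" using i by auto
  have c: "a \<in> carrier G" "b \<in> carrier G" "p \<in> carrier G"
    unfolding a_def b_def p_def using s_closed[OF i(1)] s_closed[OF i'(1)] pull_closed[OF i'(2)] by auto
  have aba: "a \<otimes> b \<otimes> a = b \<otimes> a \<otimes> b" unfolding a_def b_def by (rule braid[OF i(1) i'(1)])
  have aba': "a \<otimes> (b \<otimes> (a \<otimes> x)) = b \<otimes> (a \<otimes> (b \<otimes> x))" if "x \<in> carrier G" for x
    using arg_cong[OF aba, of "\<lambda>y. y \<otimes> x"] c that by (simp add: m_assoc)
  have pa: "p \<otimes> a = a \<otimes> p" unfolding p_def a_def using pull_commute_low[of i "Suc (Suc i)"] i by simp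
  have p'a: "inv p \<otimes> a = a \<otimes> inv p" using pa c by (intro commute_inv_left) auto
  have p'a': "inv p \<otimes> inv a = inv a \<otimes> inv p"
    using p'a c commute_inv_left[of a "inv p"] by simp
  have A': "pushes (Suc i) = p \<otimes> (b \<otimes> b) \<otimes> inv p"
    using c by (simp add: pushes_def a_def b_def p_def m_assoc)
  \<comment> \<open>Two applications of the braid relation. It exhibits \<open>pushes i\<close> as
    the conjugate of \<open>b \<otimes> b\<close> by \<open>p \<otimes> a\<close>; since
    \<open>p\<close> commutes with \<open>a\<close>, this is the conjugate of
    \<open>pushes (Suc i)\<close> by \<open>a\<close>.\<close>
  have key: "b \<otimes> (a \<otimes> (b \<otimes> b)) = a \<otimes> (a \<otimes> (b \<otimes> a))"
    using aba'[of b] aba'[of \<one>] c by (simp add: aba' m_assoc)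
  have "pushes i = p \<otimes> (inv b \<otimes> (a \<otimes> (a \<otimes> (b \<otimes> a)))) \<otimes> inv a \<otimes> inv p"
    using c pull_step[OF i'(1)] by (simp add: pushes_def a_def[symmetric] b_def[symmetric] p_def[symmetric] m_assoc inv_mult_group)
  then have A: "pushes i = p \<otimes> (a \<otimes> (b \<otimes> b) \<otimes> inv a) \<otimes> inv p"
    unfolding key[symmetric] using c by (simp add: m_assoc)
  show "s i \<otimes> pushes (Suc i) = pushes i \<otimes> s i"
  proof -
    have "pushes i \<otimes> a = p \<otimes> (a \<otimes> (b \<otimes> b) \<otimes> inv a) \<otimes> (inv p \<otimes> a)" unfolding A using c by (simp add: m_assoc)
    also have "\<dots> = p \<otimes> a \<otimes> (b \<otimes> b) \<otimes> inv p" unfolding p'a using c by (simp add: m_assoc)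
    also have "\<dots> = a \<otimes> pushes (Suc i)" unfolding pa A' using c by (simp add: m_assoc)
    finally show ?thesis by (simp add: a_def)
  qed
  \<comment> \<open>Geometrically, a strand encircling two others does not notice their exchange:
    \<open>b\<close> commutes with a b b a.\<close>
  have comm: "b \<otimes> (a \<otimes> (b \<otimes> (b \<otimes> a))) = a \<otimes> (b \<otimes> (b \<otimes> (a \<otimes> b)))"
  proof -
    have "b \<otimes> (a \<otimes> (b \<otimes> (b \<otimes> a))) = a \<otimes> (b \<otimes> (a \<otimes> (b \<otimes> a)))"
      using c by (simp add: aba')
    also have "b \<otimes> (a \<otimes> (b \<otimes> a)) = b \<otimes> (b \<otimes> (a \<otimes> b))"
      using aba c by (simp add: m_assoc)
    finally show ?thesis .
  qed
  have comm': "b \<otimes> (a \<otimes> (b \<otimes> (b \<otimes> (a \<otimes> x)))) = a \<otimes> (b \<otimes> (b \<otimes> (a \<otimes> (b \<otimes> x))))" if "x \<in> carrier G" for x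
    using arg_cong[OF comm, of "\<lambda>y. y \<otimes> x"] c that by (simp add: m_assoc)
  show "pushes i \<otimes> s i \<otimes> pushes i = pushes (Suc i) \<otimes> pushes i \<otimes> s i"
  proof -
    have "pushes i \<otimes> a \<otimes> pushes i = p \<otimes> (a \<otimes> (b \<otimes> b) \<otimes> inv a) \<otimes> (inv p \<otimes> a) \<otimes> p \<otimes> (a \<otimes> (b \<otimes> b) \<otimes> inv a) \<otimes> inv p"
      unfolding A using c by (simp add: m_assoc)
    also have "\<dots> = p \<otimes> (a \<otimes> (b \<otimes> (b \<otimes> (a \<otimes> (b \<otimes> b))))) \<otimes> (inv a \<otimes> inv p)"
      unfolding p'a using c by (simp add: m_assoc)
    also have "a \<otimes> (b \<otimes> (b \<otimes> (a \<otimes> (b \<otimes> b)))) = b \<otimes> (b \<otimes> (a \<otimes> (b \<otimes> (b \<otimes> a))))"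
      using c comm'[of b] comm'[of \<one>] comm by simp
    also have "p \<otimes> (b \<otimes> (b \<otimes> (a \<otimes> (b \<otimes> (b \<otimes> a))))) \<otimes> (inv a \<otimes> inv p)
        = p \<otimes> (b \<otimes> (b \<otimes> (a \<otimes> (b \<otimes> b)))) \<otimes> inv p"
      using c by (simp add: m_assoc)
    also have "\<dots> = pushes (Suc i) \<otimes> (pushes i \<otimes> a)"
    proof -
      have "pushes i \<otimes> a = p \<otimes> (a \<otimes> (b \<otimes> b) \<otimes> inv a) \<otimes> (inv p \<otimes> a)" unfolding A using c by (simp add: m_assoc)
      then show ?thesis unfolding A' p'a using c by (simp add: m_assoc)
    qed
    finally show ?thesis
      using c pushes_closed[OF i(1)] pushes_closed[OF i'(1)] by (simp add: a_def m_assoc)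
  qed
qed

section \<open>Normality of the push subgroup and combed forms\<close>

definition push_group :: "'a set"
  where "push_group = generate G (pushes ` {1..n})"

definition low_group :: "'a set"
  where "low_group = generate G (s ` {1..<n})"

lemma push_subgroup: "subgroup push_group G"
  unfolding push_group_def using pushes_closed by (intro generate_is_subgroup) auto

lemma low_subgroup: "subgroup low_group G"
  unfolding low_group_def using s_closed by (intro generate_is_subgroup) auto

lemma pushes_mem: "k \<in> {1..n} \<Longrightarrow> pushes k \<in> push_group"
  unfolding push_group_def by (rule generate.incl) auto

lemma conj_push_group:
  assumes g: "g \<in> carrier G" and "\<And>k. k \<in> {1..n} \<Longrightarrow> g \<otimes> pushes k \<otimes> inv g \<in> push_group"
    and u: "u \<in> push_group"
  shows "g \<otimes> u \<otimes> inv g \<in> push_group"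
proof -
  interpret c: group_hom G G "\<lambda>y. g \<otimes> y \<otimes> inv g"
    using g by unfold_locales (auto simp: hom_def word_simps)
  have "(\<lambda>y. g \<otimes> y \<otimes> inv g) ` push_group = generate G ((\<lambda>y. g \<otimes> y \<otimes> inv g) ` pushes ` {1..n})"
    unfolding push_group_def using pushes_closed by (intro c.generate_img[symmetric]) auto
  also have "\<dots> \<subseteq> push_group"
    using assms(2) by (intro generate_subgroup_incl push_subgroup) auto
  finally show ?thesis using u by blast
qed

lemma s_conj_push_group:
  assumes i: "i \<in> {1..<n}" and u: "u \<in> push_group"
  shows "s i \<otimes> u \<otimes> inv (s i) \<in> push_group" "inv (s i) \<otimes> u \<otimes> inv (inv (s i)) \<in> push_group"
proof -
  interpret U: subgroup push_group G by (rule push_subgroup)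
  have i': "i \<in> {1..n}" "i < n" "Suc i \<in> {1..n}" using i by auto
  note c = s_closed[OF i'(1)] pushes_closed[OF i'(1)] pushes_closed[OF i'(3)]
  note m = pushes_mem[OF i'(1)] pushes_mem[OF i'(3)]
  have 1: "s i \<otimes> pushes (Suc i) \<otimes> inv (s i) = pushes i"
    using s_pushes_Suc[OF i'(1,2)] c by (simp add: m_assoc)
  then have 2: "inv (s i) \<otimes> pushes i \<otimes> s i = pushes (Suc i)"
    using c by (simp add: m_assoc flip: 1)
  have 3: "s i \<otimes> pushes i \<otimes> inv (s i) = inv (pushes i) \<otimes> pushes (Suc i) \<otimes> pushes i"
  proof -
    have "s i \<otimes> pushes i \<otimes> inv (s i) = inv (pushes i) \<otimes> (pushes i \<otimes> s i \<otimes> pushes i) \<otimes> inv (s i)"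
      using c by (simp add: m_assoc)
    then show ?thesis unfolding s_pushes[OF i'(1,2)] using c by (simp add: m_assoc)
  qed
  have 4: "inv (s i) \<otimes> pushes (Suc i) \<otimes> s i = pushes (Suc i) \<otimes> pushes i \<otimes> inv (pushes (Suc i))"
  proof -
    have "pushes (Suc i) = pushes i \<otimes> (s i \<otimes> pushes i \<otimes> inv (s i)) \<otimes> inv (pushes i)"
      unfolding 3 using c by (simp add: m_assoc)
    then have "inv (s i) \<otimes> pushes (Suc i) \<otimes> s i
        = (inv (s i) \<otimes> pushes i \<otimes> s i) \<otimes> pushes i \<otimes> inv (inv (s i) \<otimes> pushes i \<otimes> s i)"
      using c by (simp add: m_assoc inv_mult_group)
    then show ?thesis unfolding 2 .
  qed
  have far': "s i \<otimes> pushes k \<otimes> inv (s i) = pushes k" "inv (s i) \<otimes> pushes k \<otimes> s i = pushes k"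
    if "k \<in> {1..n}" "k \<noteq> i" "k \<noteq> Suc i" for k
    using s_pushes_far[OF i'(1,2) that] commute_inv_left[of "s i" "pushes k"] c pushes_closed[OF that(1)]
    by (simp_all add: m_assoc)
  show "s i \<otimes> u \<otimes> inv (s i) \<in> push_group"
  proof (rule conj_push_group[OF c(1) _ u])
    fix k assume k: "k \<in> {1..n}"
    show "s i \<otimes> pushes k \<otimes> inv (s i) \<in> push_group"
      by (cases "k = i"; cases "k = Suc i") (use 1 3 m far'[OF k] pushes_mem[OF k] in auto)
  qed
  show "inv (s i) \<otimes> u \<otimes> inv (inv (s i)) \<in> push_group"
  proof (rule conj_push_group[OF inv_closed[OF c(1)] _ u])
    fix k assume k: "k \<in> {1..n}"
    show "inv (s i) \<otimes> pushes k \<otimes> inv (inv (s i)) \<in> push_group"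
      unfolding inv_inv[OF c(1)]
      by (cases "k = i"; cases "k = Suc i") (use 2 4 m far'[OF k] pushes_mem[OF k] in auto)
  qed
qed

lemma low_conj_push_group:
  assumes "b \<in> low_group" "u \<in> push_group"
  shows "b \<otimes> u \<otimes> inv b \<in> push_group"
  using assms unfolding low_group_def
proof (induction b arbitrary: u rule: generate.induct)
  case one
  then show ?case using subgroup.mem_carrier[OF push_subgroup] by simp
next
  case (incl h)
  then show ?case using s_conj_push_group(1) by blast
next
  case (inv h)
  then show ?case using s_conj_push_group(2) by blast
next
  case (eng g h)
  have "g \<in> carrier G" "h \<in> carrier G"
    using eng subgroup.mem_carrier[OF low_subgroup] by (auto simp: low_group_def)
  moreover have "u \<in> carrier G" using eng subgroup.mem_carrier[OF push_subgroup] by auto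
  ultimately have "g \<otimes> h \<otimes> u \<otimes> inv (g \<otimes> h) = g \<otimes> (h \<otimes> u \<otimes> inv h) \<otimes> inv g"
    by (simp add: m_assoc inv_mult_group)
  then show ?case using eng by simp
qed

text \<open>A candidate for the whole group: push part, braid on the lower strands, coset
  representative. It contains the identity, so closure under right multiplication by the generators
  and their inverses shows that it contains all they generate.\<close>

definition combed :: "'a set"
  where "combed = {u \<otimes> b \<otimes> pull k | u b k. u \<in> push_group \<and> b \<in> low_group \<and> k \<in> {1..Suc n}}"

lemma combedI: "\<lbrakk>u \<in> push_group; b \<in> low_group; k \<in> {1..Suc n}\<rbrakk> \<Longrightarrow> u \<otimes> b \<otimes> pull k \<in> combed"
  by (auto simp: combed_def)

text \<open>Unless \<open>i\<close> is \<open>k\<close> or \<open>k - 1\<close>, the generator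
  passes through \<open>pull k\<close> and joins the lower braid, with its index lowered if it
  exceeds \<open>k\<close>. In the two adjacent cases the coset representative changes, at the cost
  of at most a \<open>pushes i\<close> or its inverse, which moves left past the lower braid by
  normality.\<close>

lemma combed_step:
  assumes "t \<in> combed" "i \<in> {1..n}" "g = s i \<or> g = inv (s i)"
  shows "t \<otimes> g \<in> combed"
proof -
  interpret U: subgroup push_group G by (rule push_subgroup)
  interpret B: subgroup low_group G by (rule low_subgroup)
  obtain u b k where t: "t = u \<otimes> b \<otimes> pull k" and u: "u \<in> push_group" and b: "b \<in> low_group" and k: "k \<in> {1..Suc n}"
    using assms(1) by (auto simp: combed_def)
  note c = U.mem_carrier[OF u] B.mem_carrier[OF b] pull_closed[OF k] s_closed[OF assms(2)]
  have gc: "g \<in> carrier G" using assms(3) c by auto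
  have by_low: "t \<otimes> g \<in> combed" if "pull k \<otimes> g = h \<otimes> pull k" "h \<in> low_group" for h
  proof -
    have "t \<otimes> g = u \<otimes> b \<otimes> (pull k \<otimes> g)" using t c gc by (simp add: m_assoc)
    also have "\<dots> = u \<otimes> (b \<otimes> h) \<otimes> pull k" unfolding that(1) using c B.mem_carrier[OF that(2)] by (simp add: m_assoc)
    finally show ?thesis using u b that(2) k by (simp add: combedI)
  qed
  have by_push: "t \<otimes> g \<in> combed" if "pull k \<otimes> g = a \<otimes> pull l" "a \<in> push_group" "l \<in> {1..Suc n}" for a l
  proof -
    note ca = U.mem_carrier[OF that(2)] pull_closed[OF that(3)]
    have "t \<otimes> g = u \<otimes> b \<otimes> (pull k \<otimes> g)" using t c gc by (simp add: m_assoc)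
    also have "\<dots> = (u \<otimes> (b \<otimes> a \<otimes> inv b)) \<otimes> b \<otimes> pull l" unfolding that(1) using c ca by (simp add: m_assoc)
    finally show ?thesis using u b low_conj_push_group[OF b that(2)] that(3) by (simp add: combedI)
  qed
  have low: "s j \<in> low_group" if "j \<in> {1..<n}" for j
    unfolding low_group_def using that by (intro generate.incl) auto
  have inv_rel: "x \<otimes> inv y = inv z \<otimes> x" if "x \<otimes> y = z \<otimes> x" "x \<in> carrier G" "y \<in> carrier G" "z \<in> carrier G" for x y z
  proof -
    have "inv z \<otimes> (z \<otimes> x) \<otimes> inv y = inv z \<otimes> (x \<otimes> y) \<otimes> inv y" by (simp add: that(1))
    then show ?thesis using that(2-4) by (simp add: m_assoc)
  qed
  consider "Suc i < k" | "k = Suc i" | "k = i" | "k < i" by linarith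
  then show ?thesis
  proof cases
    case 1
    have rel: "pull k \<otimes> s i = s i \<otimes> pull k" using pull_commute_low[of i k] 1 assms(2) k by simp
    have "s i \<in> low_group" using 1 k assms(2) by (intro low) auto
    then show ?thesis
      using assms(3) by_low[of "s i"] by_low[of "inv (s i)"] rel inv_rel[OF rel] c by auto
  next
    case 2
    show ?thesis
      using assms(2,3) 2 k c by_push[of "pushes i" i] by_push[of "\<one>" i] pull_Suc_s[OF assms(2)] pull_step[OF assms(2)]
        pushes_mem[OF assms(2)] by auto
  next
    case 3
    show ?thesis
      using assms(2,3) 3 c by_push[of "\<one>" "Suc i"] by_push[of "inv (pushes i)" "Suc i"] pull_s[OF assms(2)] pull_s_inv[OF assms(2)]
        pushes_mem[OF assms(2)] pull_closed[of "Suc i"] by auto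
  next
    case 4
    have rel: "pull k \<otimes> s i = s (i - 1) \<otimes> pull k" using pull_commute_high[OF assms(2) 4] k by simp
    have l: "s (i - 1) \<in> low_group" using 4 k assms(2) by (intro low) auto
    then show ?thesis
      using assms(3) by_low[of "s (i - 1)"] by_low[of "inv (s (i - 1))"] rel inv_rel[OF rel] c B.mem_carrier[OF l] by auto
  qed
qed

theorem generate_subset_combed: "generate G (s ` {1..n}) \<subseteq> combed"
proof
  have step: "t \<otimes> g \<in> combed" if "g \<in> generate G (s ` {1..n})" "t \<in> combed" for g t
    using that
  proof (induction g arbitrary: t rule: generate.induct)
    case one
    have "t \<in> carrier G"
      using one pull_closed subgroup.mem_carrier[OF push_subgroup] subgroup.mem_carrier[OF low_subgroup]
      by (auto simp: combed_def)
    then show ?case using one by simp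
  next
    case (incl h) then show ?case using combed_step by blast
  next
    case (inv h) then show ?case using combed_step by blast
  next
    case (eng g h)
    have gen: "generate G (s ` {1..n}) \<subseteq> carrier G" using s_closed by (intro generate_incl) auto
    have "t \<in> carrier G"
      using eng pull_closed subgroup.mem_carrier[OF push_subgroup] subgroup.mem_carrier[OF low_subgroup]
      by (auto simp: combed_def)
    moreover have "g \<in> carrier G" "h \<in> carrier G" using eng(1,2) gen by blast+
    ultimately have "t \<otimes> (g \<otimes> h) = t \<otimes> g \<otimes> h" by (simp add: m_assoc)
    then show ?case using eng by simp
  qed
  fix g assume g: "g \<in> generate G (s ` {1..n})"
  have "\<one> \<otimes> \<one> \<otimes> pull (Suc n) \<in> combed"
    using subgroup.one_closed[OF push_subgroup] subgroup.one_closed[OF low_subgroup] by (intro combedI) auto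
  then have "\<one> \<otimes> g \<in> combed" using step[OF g] by simp
  moreover have "s ` {1..n} \<subseteq> carrier G" using s_closed by auto
  then have "g \<in> carrier G" using g generate_incl by blast
  ultimately show "g \<in> combed" by simp
qed

end


section \<open>Structure of pure braid groups\<close>

lemma pure_braids_iff:
  "\<beta> \<in> pure_braids n \<longleftrightarrow> \<beta> \<in> carrier (Aut_free n) \<and>
    (\<forall>i\<in>{1..n}. \<exists>w\<in>carrier (free_group n). \<beta> (gen i) = cj w (gen i)) \<and> \<beta> (boundary n) = boundary n"
  by (simp add: pure_braids_def inv_free_group_cj del: mult_free_group)

lemma pure_braidsE:
  assumes "\<beta> \<in> pure_braids n" "i \<in> {1..n}"
  obtains w where "w \<in> carrier (free_group n)" "\<beta> (gen i) = cj w (gen i)"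
  using assms unfolding pure_braids_iff by blast

text \<open>The basis-conjugating automorphisms. P_n and Inn(F_n)P_n are cut out of this group by
  fixing \<partial>_n exactly or up to conjugacy.\<close>

definition conj_auts :: "nat \<Rightarrow> (word \<Rightarrow> word) set"
  where "conj_auts n = {\<phi> \<in> carrier (Aut_free n).
    \<forall>i\<in>{1..n}. \<exists>w\<in>carrier (free_group n). \<phi> (gen i) = cj w (gen i)}"

lemma conj_class_subgroup:
  assumes g: "v \<in> carrier (free_group n)"
  shows "subgroup {\<phi> \<in> carrier (Aut_free n). \<exists>w\<in>carrier (free_group n). \<phi> v = cj w v} (Aut_free n)"
    (is "subgroup ?S _")
proof
  have "\<one>\<^bsub>Aut_free n\<^esub> v = cj [] v" using aut_one_apply[OF g] g by (simp add: free_group_reduced)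
  then show "\<one>\<^bsub>Aut_free n\<^esub> \<in> ?S" using Nil_closed[of n] by blast
next
  fix \<phi> \<psi> assume in_S: "\<phi> \<in> ?S" "\<psi> \<in> ?S"
  then have aut: "\<phi> \<in> carrier (Aut_free n)" "\<psi> \<in> carrier (Aut_free n)" by auto
  obtain w where w: "w \<in> carrier (free_group n)" "\<psi> v = cj w v" using in_S(2) by blast
  obtain u where u: "u \<in> carrier (free_group n)" "\<phi> v = cj u v" using in_S(1) by blast
  have \<phi>w: "\<phi> w \<in> carrier (free_group n)" using whom_closed[OF aut_whom[OF aut(1)] w(1)] .
  have "(\<phi> \<otimes>\<^bsub>Aut_free n\<^esub> \<psi>) v = cj (\<phi> w \<star> u) v"
    using aut_mult_apply[OF aut g] whom_cj[OF aut_whom[OF aut(1)] w(1) g] w u \<phi>w g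
    by (simp add: free_group_reduced)
  moreover have "\<phi> w \<star> u \<in> carrier (free_group n)" using \<phi>w u by simp
  ultimately show "\<phi> \<otimes>\<^bsub>Aut_free n\<^esub> \<psi> \<in> ?S" using Aut.m_closed[OF aut] by blast
next
  fix \<phi> assume \<phi>: "\<phi> \<in> ?S"
  then have aut: "\<phi> \<in> carrier (Aut_free n)" by auto
  let ?i = "inv\<^bsub>Aut_free n\<^esub> \<phi>"
  have iaut: "?i \<in> carrier (Aut_free n)" using aut by simp
  note iw = aut_whom[OF iaut]
  obtain w where w: "w \<in> carrier (free_group n)" "\<phi> v = cj w v" using \<phi> by blast
  have c: "?i w \<in> carrier (free_group n)" "?i v \<in> carrier (free_group n)"
    using whom_closed[OF iw] w g by auto
  have "v = ?i (cj w v)" using aut_inv_apply(1)[OF aut g] w by simp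
  also have "\<dots> = cj (?i w) (?i v)" using whom_cj[OF iw w(1) g] .
  finally have "cj (winv (?i w)) v = cj (winv (?i w)) (cj (?i w) (?i v))" by simp
  then have "?i v = cj (winv (?i w)) v" using c by (simp add: free_group_reduced)
  moreover have "winv (?i w) \<in> carrier (free_group n)" using c by simp
  ultimately show "?i \<in> ?S" using iaut by blast
qed auto

lemma conj_auts_subgroup: "subgroup (conj_auts n) (Aut_free n)"
proof -
  let ?S = "\<lambda>i. {\<phi> \<in> carrier (Aut_free n). \<exists>w\<in>carrier (free_group n). \<phi> (gen i) = cj w (gen i)}"
  have "conj_auts n = \<Inter> (insert (carrier (Aut_free n)) (?S ` {1..n}))"
    by (auto simp: conj_auts_def)
  also have "subgroup \<dots> (Aut_free n)"
    by (rule Aut.subgroups_Inter) (use conj_class_subgroup Aut.subgroup_self in auto)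
  finally show ?thesis .
qed

lemma fix_subgroup:
  assumes "v \<in> carrier (free_group n)"
  shows "subgroup {\<phi> \<in> carrier (Aut_free n). \<phi> v = v} (Aut_free n)"
proof
  fix \<phi> assume "\<phi> \<in> {\<phi> \<in> carrier (Aut_free n). \<phi> v = v}"
  then show "inv\<^bsub>Aut_free n\<^esub> \<phi> \<in> {\<phi> \<in> carrier (Aut_free n). \<phi> v = v}"
    using aut_inv_eqI[of \<phi> n v v] assms by auto
qed (use assms in \<open>auto simp: aut_mult_apply aut_one_apply\<close>)

lemma pure_braids_eq_Int: "pure_braids n = conj_auts n \<inter> {\<phi> \<in> carrier (Aut_free n). \<phi> (boundary n) = boundary n}"
  by (auto simp: pure_braids_iff conj_auts_def)

lemma pure_braids_subgroup: "subgroup (pure_braids n) (Aut_free n)"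
  unfolding pure_braids_eq_Int
  by (rule Aut.subgroups_Inter_pair[OF conj_auts_subgroup fix_subgroup[OF boundary_closed]])

lemma pure_braids_aut: "\<beta> \<in> pure_braids n \<Longrightarrow> \<beta> \<in> carrier (Aut_free n)"
  by (simp add: pure_braids_iff)

lemma braid_relations_sig: "braid_relations (Aut_free (Suc n)) (sig (Suc n)) n"
proof -
  let ?A = "Aut_free (Suc n)" and ?s = "sig (Suc n)"
  have s: "?s i \<in> carrier ?A" if "i \<in> {1..n}" for i using that by (intro sig_aut) auto
  have st: "?s i (braid_tuple j k) = (if k = j then cj (braid_tuple i j) (braid_tuple i (Suc j))
      else if k = Suc j then braid_tuple i j else braid_tuple i k)"
    if "i \<in> {1..n}" "j \<in> {1..n}" "k \<in> {1..Suc n}" for i j k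
    using whom_cj[OF aut_whom[OF s[OF that(1)]], of "gen j" "gen (Suc j)"] sig_gen[of i "Suc n"] that
    by (auto simp: braid_tuple_def[of j])
  have app: "(\<phi> \<otimes>\<^bsub>?A\<^esub> ?s i) (gen k) = \<phi> (braid_tuple i k)"
    if "\<phi> \<in> carrier ?A" "i \<in> {1..n}" "k \<in> {1..Suc n}" for \<phi> i k
    using aut_mult_apply[OF that(1) s[OF that(2)], of "gen k"] sig_gen[of i "Suc n" k] that by auto
  have tc: "braid_tuple j k \<in> carrier (free_group (Suc n))" if "j \<in> {1..n}" "k \<in> {1..Suc n}" for j k
    using that by (intro braid_tuple_closed) auto
  show ?thesis
  proof (intro braid_relations.intro braid_relations_axioms.intro Aut.is_group s)
    fix i j assume ij: "i \<in> {1..n}" "j \<in> {1..n}" "Suc i < j"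
    show "?s i \<otimes>\<^bsub>?A\<^esub> ?s j = ?s j \<otimes>\<^bsub>?A\<^esub> ?s i"
    proof (rule aut_eqI)
      fix k assume "k \<in> {1..Suc n}"
      then show "(?s i \<otimes>\<^bsub>?A\<^esub> ?s j) (gen k) = (?s j \<otimes>\<^bsub>?A\<^esub> ?s i) (gen k)"
        using ij s app st by (simp add: braid_tuple_def)
    qed (use ij s in auto)
  next
    fix i assume i: "i \<in> {1..n}" "Suc i \<in> {1..n}"
    show "?s i \<otimes>\<^bsub>?A\<^esub> ?s (Suc i) \<otimes>\<^bsub>?A\<^esub> ?s i = ?s (Suc i) \<otimes>\<^bsub>?A\<^esub> ?s i \<otimes>\<^bsub>?A\<^esub> ?s (Suc i)"
    proof (rule aut_eqI)
      fix k assume k: "k \<in> {1..Suc n}"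
      have x: "gen i \<in> carrier (free_group (Suc n))" "gen (Suc i) \<in> carrier (free_group (Suc n))"
        "gen (Suc (Suc i)) \<in> carrier (free_group (Suc n))" using i by auto
      note cjx = whom_cj[OF aut_whom[OF s[OF i(1)]] x(1)] whom_cj[OF aut_whom[OF s[OF i(2)]] x(1)]
      have app2: "(?s a \<otimes>\<^bsub>?A\<^esub> ?s b \<otimes>\<^bsub>?A\<^esub> ?s c) (gen k) = ?s a (?s b (braid_tuple c k))"
        if "a \<in> {1..n}" "b \<in> {1..n}" "c \<in> {1..n}" for a b c
        using app[of "?s a \<otimes>\<^bsub>?A\<^esub> ?s b" c k] aut_mult_apply[OF s[OF that(1)] s[OF that(2)] tc[OF that(3) k]] that k s by simp
      have gens: "?s a (gen b) = braid_tuple a b" if "a \<in> {1..n}" "b \<in> {1..Suc n}" for a b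
        using that by (intro sig_gen) auto
      show "(?s i \<otimes>\<^bsub>?A\<^esub> ?s (Suc i) \<otimes>\<^bsub>?A\<^esub> ?s i) (gen k) = (?s (Suc i) \<otimes>\<^bsub>?A\<^esub> ?s i \<otimes>\<^bsub>?A\<^esub> ?s (Suc i)) (gen k)"
        unfolding app2[OF i(1) i(2) i(1)] app2[OF i(2) i(1) i(2)] st[OF i(1,2) k] st[OF i(2,1) k]
        using i k x gens cjx[of "gen (Suc i)"] cjx[of "gen (Suc (Suc i))"] cjx[of "cj (gen (Suc i)) (gen (Suc (Suc i)))"]
          whom_cj[OF aut_whom[OF s[OF i(1)]] x(2,3)] whom_cj[OF aut_whom[OF s[OF i(2)]] x(2,3)]
        by (auto simp: braid_tuple_def cj_def)
    qed (use i s in auto)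
  qed
qed

section \<open>Adding and forgetting the last strand\<close>

definition ext :: "nat \<Rightarrow> (word \<Rightarrow> word) \<Rightarrow> word \<Rightarrow> word"
  where "ext n \<phi> = lift (Suc n) (Suc n) (\<lambda>i. if i = Suc n then gen (Suc n) else \<phi> (gen i))"

text \<open>Forgetting the last strand, on fundamental groups: the last puncture is filled in. The
  inclusion of F_n is a section of it, by \<open>kill_low\<close>.\<close>

definition kill :: "nat \<Rightarrow> word \<Rightarrow> word"
  where "kill n = lift (Suc n) n (\<lambda>i. if i = Suc n then [] else gen i)"

lemma free_group_Suc: "w \<in> carrier (free_group n) \<Longrightarrow> w \<in> carrier (free_group (Suc n))"
  using free_group_mono[of n "Suc n"] by auto

lemma kill_whom: "kill n \<in> whom (Suc n) n"
  unfolding kill_def by (rule lift_whom) auto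

lemma kill_gen: "i \<in> {1..Suc n} \<Longrightarrow> kill n (gen i) = (if i = Suc n then [] else gen i)"
  unfolding kill_def by (rule lift_gen) auto

lemma kill_low: "w \<in> carrier (free_group n) \<Longrightarrow> kill n w = w"
  by (rule whom_eqI[OF whom_compose[OF whom_id kill_whom] whom_id]) (auto simp: kill_gen)

lemma
  assumes \<phi>: "\<phi> \<in> carrier (Aut_free n)"
  shows ext_whom: "ext n \<phi> \<in> whom (Suc n) (Suc n)"
    and ext_low: "w \<in> carrier (free_group n) \<Longrightarrow> ext n \<phi> w = \<phi> w"
    and ext_last: "ext n \<phi> (gen (Suc n)) = gen (Suc n)"
    and ext_gen: "i \<in> {1..n} \<Longrightarrow> ext n \<phi> (gen i) = \<phi> (gen i)"
proof -
  have t: "(if i = Suc n then gen (Suc n) else \<phi> (gen i)) \<in> carrier (free_group (Suc n))" if "i \<in> {1..Suc n}" for i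
    using that whom_closed[OF aut_whom[OF \<phi>], of "gen i"] by (auto intro: free_group_Suc)
  show e: "ext n \<phi> \<in> whom (Suc n) (Suc n)" unfolding ext_def using t by (rule lift_whom)
  have g: "ext n \<phi> (gen i) = (if i = Suc n then gen (Suc n) else \<phi> (gen i))" if "i \<in> {1..Suc n}" for i
    unfolding ext_def using t that by (rule lift_gen)
  show "ext n \<phi> (gen (Suc n)) = gen (Suc n)" "i \<in> {1..n} \<Longrightarrow> ext n \<phi> (gen i) = \<phi> (gen i)"
    using g by auto
  show "w \<in> carrier (free_group n) \<Longrightarrow> ext n \<phi> w = \<phi> w"
    by (rule whom_eqI[OF whom_compose[OF whom_id e] whom_compose[OF aut_whom[OF \<phi>] whom_id]]) (auto simp: g)
qed

lemma ext_aut: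
  assumes \<phi>: "\<phi> \<in> carrier (Aut_free n)"
  shows "ext n \<phi> \<in> carrier (Aut_free (Suc n))"
proof -
  let ?i = "inv\<^bsub>Aut_free n\<^esub> \<phi>"
  have i: "?i \<in> carrier (Aut_free n)" using \<phi> by simp
  have cl: "\<theta> (gen j) \<in> carrier (free_group n)" if "\<theta> \<in> carrier (Aut_free n)" "j \<in> {1..Suc n}" "j \<noteq> Suc n" for \<theta> j
    using that whom_closed[OF aut_whom[OF that(1)], of "gen j"] by auto
  show ?thesis
    unfolding ext_def
  proof (rule lift_aut[of _ _ "\<lambda>i. if i = Suc n then gen (Suc n) else ?i (gen i)"])
    fix j assume j: "j \<in> {1..Suc n}"
    show "(if j = Suc n then gen (Suc n) else \<phi> (gen j)) \<in> carrier (free_group (Suc n))"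
      "(if j = Suc n then gen (Suc n) else ?i (gen j)) \<in> carrier (free_group (Suc n))"
      using j cl[OF \<phi> j] cl[OF i j] by (auto intro: free_group_Suc)
    show "lift (Suc n) (Suc n) (\<lambda>i. if i = Suc n then gen (Suc n) else \<phi> (gen i)) (if j = Suc n then gen (Suc n) else ?i (gen j)) = gen j"
      using j ext_last[OF \<phi>] ext_low[OF \<phi> cl[OF i j]] aut_inv_apply(2)[OF \<phi>, of "gen j"] by (auto simp: ext_def)
    show "lift (Suc n) (Suc n) (\<lambda>i. if i = Suc n then gen (Suc n) else ?i (gen i)) (if j = Suc n then gen (Suc n) else \<phi> (gen j)) = gen j"
      using j ext_last[OF i] ext_low[OF i cl[OF \<phi> j]] aut_inv_apply(1)[OF \<phi>, of "gen j"] by (auto simp: ext_def)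
  qed
qed

lemma ext_hom: "ext n \<in> hom (Aut_free n) (Aut_free (Suc n))"
proof (rule homI)
  fix \<phi> \<psi> assume aut: "\<phi> \<in> carrier (Aut_free n)" "\<psi> \<in> carrier (Aut_free n)"
  show "ext n (\<phi> \<otimes>\<^bsub>Aut_free n\<^esub> \<psi>) = ext n \<phi> \<otimes>\<^bsub>Aut_free (Suc n)\<^esub> ext n \<psi>"
  proof (rule aut_eqI)
    fix i assume i: "i \<in> {1..Suc n}"
    then have g: "gen i \<in> carrier (free_group (Suc n))" by simp
    note m = aut_mult_apply[OF ext_aut[OF aut(1)] ext_aut[OF aut(2)] g]
    show "ext n (\<phi> \<otimes>\<^bsub>Aut_free n\<^esub> \<psi>) (gen i) = (ext n \<phi> \<otimes>\<^bsub>Aut_free (Suc n)\<^esub> ext n \<psi>) (gen i)"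
    proof (cases "i = Suc n")
      case True
      then show ?thesis using m aut ext_last[OF Aut.m_closed[OF aut]] ext_last by simp
    next
      case False
      then have i': "i \<in> {1..n}" using i by auto
      then have "\<psi> (gen i) \<in> carrier (free_group n)" using whom_closed[OF aut_whom[OF aut(2)], of "gen i"] by simp
      then show ?thesis
        using m aut i' ext_gen[OF Aut.m_closed[OF aut] i'] ext_gen[OF aut(2) i'] ext_low[OF aut(1)]
          aut_mult_apply[OF aut, of "gen i"] by simp
    qed
  qed (use aut ext_aut Aut.m_closed in auto)
qed (rule ext_aut)

lemma ext_pure:
  assumes "\<beta> \<in> pure_braids n"
  shows "ext n \<beta> \<in> pure_braids (Suc n)"
proof -
  have aut: "\<beta> \<in> carrier (Aut_free n)" using assms by (rule pure_braids_aut)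
  have "\<exists>w\<in>carrier (free_group (Suc n)). ext n \<beta> (gen i) = cj w (gen i)" if i: "i \<in> {1..Suc n}" for i
  proof (cases "i = Suc n")
    case True
    then show ?thesis using ext_last[OF aut] by (intro bexI[of _ "[]"]) auto
  next
    case False
    then have i': "i \<in> {1..n}" using i by auto
    obtain w where "w \<in> carrier (free_group n)" "\<beta> (gen i) = cj w (gen i)" using assms i' by (rule pure_braidsE)
    then show ?thesis using ext_gen[OF aut i'] free_group_Suc by auto
  qed
  moreover have "ext n \<beta> (boundary (Suc n)) = boundary (Suc n)"
    using whom_wmult[OF ext_whom[OF aut] free_group_Suc[OF boundary_closed], of "gen (Suc n)"]
      ext_low[OF aut boundary_closed] ext_last[OF aut] assms
    by (simp add: boundary_Suc pure_braids_iff)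
  ultimately show ?thesis using ext_aut[OF aut] by (simp add: pure_braids_iff)
qed

lemma ext_sig: "i \<in> {1..<n} \<Longrightarrow> ext n (sig n i) = sig (Suc n) i"
proof (rule aut_eqI)
  assume i: "i \<in> {1..<n}"
  have i': "i \<in> {1..<Suc n}" using i by auto
  show "ext n (sig n i) \<in> carrier (Aut_free (Suc n))" "sig (Suc n) i \<in> carrier (Aut_free (Suc n))"
    using ext_aut[OF sig_aut[OF i]] sig_aut[OF i'] by auto
  fix j assume j: "j \<in> {1..Suc n}"
  show "ext n (sig n i) (gen j) = sig (Suc n) i (gen j)"
  proof (cases "j = Suc n")
    case True
    then show ?thesis using ext_last[OF sig_aut[OF i]] sig_gen[OF i' j] i by (simp add: braid_tuple_def)
  next
    case False
    then have "j \<in> {1..n}" using j by auto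
    then show ?thesis using ext_gen[OF sig_aut[OF i]] sig_gen[OF i] sig_gen[OF i' j] by simp
  qed
qed

text \<open>
  \<open>u\<close> acts trivially once \<open>x\<^sub>n\<^sub>+\<^sub>1\<close> is killed, and drags the last strand along the loop \<open>w\<close>; the
  inverse makes \<open>w \<mapsto> u\<close> multiplicative.
\<close>

definition pushes_along :: "nat \<Rightarrow> word \<Rightarrow> (word \<Rightarrow> word) \<Rightarrow> bool"
  where "pushes_along n w u \<longleftrightarrow> u \<in> pure_braids (Suc n) \<and>
    (\<forall>v\<in>carrier (free_group (Suc n)). kill n (u v) = kill n v) \<and>
    (\<exists>w'\<in>carrier (free_group (Suc n)). u (gen (Suc n)) = cj w' (gen (Suc n)) \<and> kill n w' = winv w)"

lemma pushes_along_one: "pushes_along n [] \<one>\<^bsub>Aut_free (Suc n)\<^esub>"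
  using subgroup.one_closed[OF pure_braids_subgroup[of "Suc n"]] aut_one_apply[of _ "Suc n"] whom_Nil[OF kill_whom]
  by (auto simp: pushes_along_def intro!: bexI[of _ "[]"])

lemma pushes_along_mult:
  assumes "pushes_along n w u" "pushes_along n w' u'" "w \<in> carrier (free_group n)" "w' \<in> carrier (free_group n)"
  shows "pushes_along n (w \<star> w') (u \<otimes>\<^bsub>Aut_free (Suc n)\<^esub> u')"
proof -
  let ?C = "carrier (free_group (Suc n))"
  obtain v where v: "v \<in> ?C" "u (gen (Suc n)) = cj v (gen (Suc n))" "kill n v = winv w"
    using assms(1) by (auto simp: pushes_along_def)
  obtain v' where v': "v' \<in> ?C" "u' (gen (Suc n)) = cj v' (gen (Suc n))" "kill n v' = winv w'"
    using assms(2) by (auto simp: pushes_along_def)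
  have p: "u \<in> pure_braids (Suc n)" "u' \<in> pure_braids (Suc n)" and
    k: "\<And>x. x \<in> ?C \<Longrightarrow> kill n (u x) = kill n x" "\<And>x. x \<in> ?C \<Longrightarrow> kill n (u' x) = kill n x"
    using assms by (auto simp: pushes_along_def)
  note aut = pure_braids_aut[OF p(1)] pure_braids_aut[OF p(2)]
  have g: "gen (Suc n) \<in> ?C" by simp
  have uv': "u v' \<in> ?C" using whom_closed[OF aut_whom[OF aut(1)] v'(1)] .
  have "(u \<otimes>\<^bsub>Aut_free (Suc n)\<^esub> u') (gen (Suc n)) = cj (u v' \<star> v) (gen (Suc n))"
    using aut_mult_apply[OF aut g] v v' whom_cj[OF aut_whom[OF aut(1)] v'(1) g] uv' by (simp add: free_group_reduced)
  moreover have "kill n (u v' \<star> v) = winv (w \<star> w')"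
    using whom_wmult[OF kill_whom uv' v(1)] k(1)[OF v'(1)] v v' assms(3,4) by (simp add: free_group_reduced)
  moreover have "u v' \<star> v \<in> ?C" using uv' v by simp
  moreover have "kill n ((u \<otimes>\<^bsub>Aut_free (Suc n)\<^esub> u') x) = kill n x" if "x \<in> ?C" for x
    using aut_mult_apply[OF aut that] k(1)[OF whom_closed[OF aut_whom[OF aut(2)] that]] k(2)[OF that] by simp
  ultimately show ?thesis
    using subgroup.m_closed[OF pure_braids_subgroup p] unfolding pushes_along_def by blast
qed

lemma pushes_along_inv:
  assumes "pushes_along n w u" "w \<in> carrier (free_group n)"
  shows "pushes_along n (winv w) (inv\<^bsub>Aut_free (Suc n)\<^esub> u)"
proof -
  let ?C = "carrier (free_group (Suc n))" and ?i = "inv\<^bsub>Aut_free (Suc n)\<^esub> u"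
  obtain v where v: "v \<in> ?C" "u (gen (Suc n)) = cj v (gen (Suc n))" "kill n v = winv w"
    using assms(1) by (auto simp: pushes_along_def)
  have p: "u \<in> pure_braids (Suc n)" and
    k: "\<And>x. x \<in> ?C \<Longrightarrow> kill n (u x) = kill n x"
    using assms by (auto simp: pushes_along_def)
  note aut = pure_braids_aut[OF p]
  have iaut: "?i \<in> carrier (Aut_free (Suc n))" using aut by simp
  note iw = aut_whom[OF iaut]
  have g: "gen (Suc n) \<in> ?C" by simp
  have c: "?i v \<in> ?C" "?i (gen (Suc n)) \<in> ?C" using whom_closed[OF iw] v g by auto
  have ik: "kill n (?i x) = kill n x" if "x \<in> ?C" for x
    using k[OF whom_closed[OF iw that]] aut_inv_apply(2)[OF aut that] by simp
  have "gen (Suc n) = ?i (cj v (gen (Suc n)))" using aut_inv_apply(1)[OF aut g] v by simp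
  also have "\<dots> = cj (?i v) (?i (gen (Suc n)))" using whom_cj[OF iw v(1) g] .
  finally have "cj (winv (?i v)) (gen (Suc n)) = cj (winv (?i v)) (cj (?i v) (?i (gen (Suc n))))" by simp
  then have "?i (gen (Suc n)) = cj (winv (?i v)) (gen (Suc n))" using c by (simp add: free_group_reduced)
  moreover have "kill n (winv (?i v)) = winv (winv w)"
    using whom_winv[OF kill_whom c(1)] ik[OF v(1)] v by simp
  moreover have "winv (?i v) \<in> ?C" using c by simp
  ultimately show ?thesis
    using subgroup.m_inv_closed[OF pure_braids_subgroup p] ik unfolding pushes_along_def by blast
qed


global_interpretation BR: braid_relations "Aut_free (Suc n)" "sig (Suc n)" n for n
  by (rule braid_relations_sig)

lemma pull_gen:
  assumes "1 \<le> k" "k \<le> Suc n"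
  shows "j \<in> {1..Suc n} \<Longrightarrow> BR.pull n k (gen j) =
    (if j < k then gen j else if j = k then gen (Suc n) else cj (winv (gen (Suc n))) (gen (j - 1)))"
  using assms(2,1)
proof (induction k arbitrary: j rule: inc_induct)
  case base
  then show ?case using aut_one_apply[of "gen j" "Suc n"] by auto
next
  case (step k)
  have k: "k \<in> {1..n}" "k \<in> {1..<Suc n}" using step by auto
  let ?p = "BR.pull n (Suc k)" and ?i = "inv\<^bsub>Aut_free (Suc n)\<^esub> (sig (Suc n) k)"
  have aut: "?p \<in> carrier (Aut_free (Suc n))" "?i \<in> carrier (Aut_free (Suc n))"
    using BR.pull_closed[of "Suc k" n] sig_aut[OF k(2)] step by auto
  have g: "gen j \<in> carrier (free_group (Suc n))" using step by simp
  have x: "gen k \<in> carrier (free_group (Suc n))" "gen (Suc k) \<in> carrier (free_group (Suc n))" using k by auto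
  have "BR.pull n k (gen j) = ?p (braid_tuple_inv k j)"
    unfolding BR.pull_step[OF k(1)] aut_mult_apply[OF aut g] sig_inv_gen[OF k(2) step.prems(1)] ..
  moreover have "?p (cj (winv (gen (Suc k))) (gen k)) = cj (winv (?p (gen (Suc k)))) (?p (gen k))"
    using whom_cj[OF aut_whom[OF aut(1)] winv_closed[OF x(2)] x(1)] whom_winv[OF aut_whom[OF aut(1)] x(2)] by simp
  ultimately show ?case
    using step.IH[of k] step.IH[of "Suc k"] step.IH[of j] step.prems step.hyps
    by (auto simp: braid_tuple_inv_def)
qed

lemma pull_boundary:
  assumes "1 \<le> k" "k \<le> Suc n"
  shows "BR.pull n k (boundary (Suc n)) = boundary (Suc n)"
  using assms(2,1)
proof (induction k rule: inc_induct)
  case base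
  then show ?case using aut_one_apply[OF boundary_closed] by simp
next
  case (step k)
  have k: "k \<in> {1..n}" "k \<in> {1..<Suc n}" using step by auto
  let ?p = "BR.pull n (Suc k)" and ?i = "inv\<^bsub>Aut_free (Suc n)\<^esub> (sig (Suc n) k)"
  have aut: "?p \<in> carrier (Aut_free (Suc n))" "?i \<in> carrier (Aut_free (Suc n))"
    using BR.pull_closed[of "Suc k" n] sig_aut[OF k(2)] step by auto
  have "?i (boundary (Suc n)) = boundary (Suc n)"
    using sig_inv_braids[OF k(2)] by (simp add: braids_def)
  then show ?case
    using step unfolding BR.pull_step[OF k(1)] aut_mult_apply[OF aut boundary_closed] by simp
qed

text \<open>\<open>pushes k\<close> conjugates x_{n+1} by x_k, and the conjugator records the
  inverse of the loop, hence the loop x_k^-1. The rest is transported through \<open>pull\<close>,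
  which turns the two strands of the double twist into x_k and x_{n+1}.\<close>

lemma pushes_along_pushes:
  assumes k: "k \<in> {1..n}"
  shows "pushes_along n (winv (gen k)) (BR.pushes n k)"
proof -
  let ?A = "Aut_free (Suc n)" and ?C = "carrier (free_group (Suc n))"
  define p where "p = BR.pull n (Suc k)"
  define s where "s = sig (Suc n) k"
  define a where "a = BR.pushes n k"
  have k': "k \<in> {1..<Suc n}" using k by auto
  have aut: "p \<in> carrier ?A" "s \<in> carrier ?A" "a \<in> carrier ?A"
    unfolding p_def s_def a_def using BR.pull_closed[of "Suc k" n] sig_aut[OF k'] BR.pushes_closed[OF k] k by auto
  note pw = aut_whom[OF aut(1)] and sw = aut_whom[OF aut(2)] and aw = aut_whom[OF aut(3)]
  have x: "gen k \<in> ?C" "gen (Suc k) \<in> ?C" "gen (Suc n) \<in> ?C" using k by auto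
  \<comment> \<open>The defining conjugate is used as a p = p s s, so that the inverse of
    \<open>p\<close> need not be evaluated on generators.\<close>
  have ap: "a (p v) = p (s (s v))" if v: "v \<in> ?C" for v
  proof -
    have "a \<otimes>\<^bsub>?A\<^esub> p = p \<otimes>\<^bsub>?A\<^esub> (s \<otimes>\<^bsub>?A\<^esub> s)"
      using aut by (simp add: a_def BR.pushes_def p_def[symmetric] s_def[symmetric] Aut.m_assoc)
    then show ?thesis
      using aut_mult_apply[OF aut(3,1) v] aut_mult_apply[OF aut(1) Aut.m_closed[OF aut(2,2)] v]
        aut_mult_apply[OF aut(2,2) v] by simp
  qed
  have pg: "p (gen j) = (if j \<le> k then gen j else if j = Suc k then gen (Suc n) else cj (winv (gen (Suc n))) (gen (j - 1)))"
    if "j \<in> {1..Suc n}" for j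
    using pull_gen[of "Suc k" n j] that k by (auto simp: p_def)
  have sg: "s (gen j) = braid_tuple k j" if "j \<in> {1..Suc n}" for j
    unfolding s_def using k' that by (rule sig_gen)
  have ss: "s (s (gen k)) = cj (cj (gen k) (gen (Suc k))) (gen k)" "s (s (gen (Suc k))) = cj (gen k) (gen (Suc k))"
    "\<And>j. \<lbrakk>j \<in> {1..Suc n}; j \<noteq> k; j \<noteq> Suc k\<rbrakk> \<Longrightarrow> s (s (gen j)) = gen j"
    using sg[of k] sg[of "Suc k"] sg whom_cj[OF sw x(1,2)] k by (auto simp: braid_tuple_def)
  have last: "a (gen (Suc n)) = cj (gen k) (gen (Suc n))"
    using ap[OF x(2)] ss(2) pg[of "Suc k"] pg[of k] whom_cj[OF pw x(1,2)] k by simp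
  have kp: "kill n (p v) \<in> carrier (free_group n)" if "v \<in> ?C" for v
    by (rule whom_closed[OF kill_whom whom_closed[OF pw that]])
  have kgen: "kill n (p (gen k)) = gen k" "kill n (p (gen (Suc k))) = []"
    using pg[of k] pg[of "Suc k"] kill_gen[of k n] kill_gen[of "Suc n" n] k by auto
  \<comment> \<open>The double twist changes x_k and x_{k+1} only by conjugators in these two
    generators. After \<open>p\<close> and killing, x_{k+1} becomes trivial and the conjugators
    become powers of x_k.\<close>
  have kill_ss: "kill n (p (s (s v))) = kill n (p v)" if "v \<in> ?C" for v
  proof (rule whom_eqI[OF whom_compose[OF sw whom_compose[OF sw whom_compose[OF pw kill_whom]]] whom_compose[OF pw kill_whom] _ that])
    note kpw = whom_compose[OF pw kill_whom[of n]]
    fix j assume j: "j \<in> {1..Suc n}"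
    consider "j = k" | "j = Suc k" | "j \<noteq> k" "j \<noteq> Suc k" by blast
    then show "kill n (p (s (s (gen j)))) = kill n (p (gen j))"
    proof cases
      case 1
      then show ?thesis
        using ss(1) whom_cj[OF kpw cj_closed[OF x(1,2)] x(1)] whom_cj[OF kpw x(1,2)] kgen by simp
    next
      case 2
      then show ?thesis using ss(2) whom_cj[OF kpw x(1,2)] kgen by simp
    qed (use ss(3) j in simp)
  qed
  have killa: "kill n (a v) = kill n v" if v: "v \<in> ?C" for v
  proof -
    have "inv\<^bsub>?A\<^esub> p \<in> carrier ?A" using aut by simp
    from whom_closed[OF aut_whom[OF this] v] have c: "(inv\<^bsub>?A\<^esub> p) v \<in> ?C" .
    have "p ((inv\<^bsub>?A\<^esub> p) v) = v" using aut_inv_apply(2)[OF aut(1) v] .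
    then show ?thesis using ap[OF c] kill_ss[OF c] by simp
  qed
  have sconj: "\<exists>y\<in>?C. s (s (gen j)) = cj y (gen j)" if "j \<in> {1..Suc n}" for j
  proof -
    consider "j = k" | "j = Suc k" | "j \<noteq> k" "j \<noteq> Suc k" by blast
    then show ?thesis
    proof cases
      case 1 then show ?thesis using ss(1) x by (intro bexI[of _ "cj (gen k) (gen (Suc k))"]) auto
    next
      case 2 then show ?thesis using ss(2) x by (intro bexI[of _ "gen k"]) auto
    next
      case 3 then show ?thesis using ss(3) that by (intro bexI[of _ "[]"]) auto
    qed
  qed
  have "\<exists>w\<in>?C. a (gen j) = cj w (gen j)" if j: "j \<in> {1..Suc n}" for j
  proof -
    \<comment> \<open>Up to conjugation \<open>p\<close> permutes the generators, so each x_j is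
      reached from some x_{j'}, where the effect of the double twist is known.\<close>
    have "\<exists>j'\<in>{1..Suc n}. \<exists>w\<in>?C. p (gen j') = cj w (gen j)"
    proof -
      consider "j \<le> k" | "j = Suc n" | "k < j" "j \<noteq> Suc n" by linarith
      then show ?thesis
      proof cases
        case 1 then show ?thesis using pg[OF j] j by (intro bexI[of _ j] bexI[of _ "[]"]) auto
      next
        case 2 then show ?thesis using pg[of "Suc k"] k by (intro bexI[of _ "Suc k"] bexI[of _ "[]"]) auto
      next
        case 3 then show ?thesis using pg[of "Suc j"] j
          by (intro bexI[of _ "Suc j"] bexI[of _ "winv (gen (Suc n))"]) auto
      qed
    qed
    then obtain j' w where j': "j' \<in> {1..Suc n}" and w: "w \<in> ?C" "p (gen j') = cj w (gen j)" by blast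
    obtain y where y: "y \<in> ?C" "s (s (gen j')) = cj y (gen j')" using sconj[OF j'] by blast
    have g: "gen j \<in> ?C" "gen j' \<in> ?C" using j j' by auto
    have c: "a w \<in> ?C" "p y \<in> ?C" "a (gen j) \<in> ?C"
      using whom_closed[OF aw w(1)] whom_closed[OF pw y(1)] whom_closed[OF aw g(1)] by auto
    have "cj (a w) (a (gen j)) = a (p (gen j'))" using whom_cj[OF aw w(1) g(1)] w by simp
    also have "\<dots> = cj (p y) (cj w (gen j))" using ap[OF g(2)] whom_cj[OF pw y(1) g(2)] y w by simp
    finally have "cj (winv (a w)) (cj (a w) (a (gen j))) = cj (winv (a w)) (cj (p y) (cj w (gen j)))" by simp
    then have "a (gen j) = cj (winv (a w) \<star> p y \<star> w) (gen j)"
      using c w by (simp add: free_group_reduced)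
    then show ?thesis using c w by (intro bexI[of _ "winv (a w) \<star> p y \<star> w"]) auto
  qed
  moreover have "a (boundary (Suc n)) = boundary (Suc n)"
    using ap[OF boundary_closed] pull_boundary[of "Suc k" n] sig_boundary[OF k'] k by (simp add: p_def s_def)
  ultimately have "a \<in> pure_braids (Suc n)" using aut(3) by (simp add: pure_braids_iff)
  then show ?thesis
    using killa last x kill_gen[of k n] k unfolding pushes_along_def a_def[symmetric]
    by (auto intro!: bexI[of _ "gen k"])
qed

text \<open>The inverse is taken because \<open>pushes i\<close> drags the last strand along x_i^-1;
  with it a word \<open>w\<close> goes to a push along \<open>w\<close> itself.\<close>

definition push_hom :: "nat \<Rightarrow> word \<Rightarrow> word \<Rightarrow> word"
  where "push_hom n = (THE h. h \<in> hom (free_group n) (Aut_free (Suc n)) \<inter> extensional (carrier (free_group n)) \<and>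
    (\<forall>i\<in>{1..n}. h (gen i) = inv\<^bsub>Aut_free (Suc n)\<^esub> (BR.pushes n i)))"

lemma push_hom: "push_hom n \<in> hom (free_group n) (Aut_free (Suc n))"
  and push_hom_gen: "i \<in> {1..n} \<Longrightarrow> push_hom n (gen i) = inv\<^bsub>Aut_free (Suc n)\<^esub> (BR.pushes n i)"
proof -
  have "(\<lambda>i. inv\<^bsub>Aut_free (Suc n)\<^esub> (BR.pushes n i)) \<in> {1..n} \<rightarrow> carrier (Aut_free (Suc n))"
    using BR.pushes_closed[of _ n] by auto
  from theI'[OF free_group_universal[OF Aut.is_group this]]
  show "push_hom n \<in> hom (free_group n) (Aut_free (Suc n))"
    "i \<in> {1..n} \<Longrightarrow> push_hom n (gen i) = inv\<^bsub>Aut_free (Suc n)\<^esub> (BR.pushes n i)"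
    unfolding push_hom_def by auto
qed

lemma group_hom_push: "group_hom (free_group n) (Aut_free (Suc n)) (push_hom n)"
  using push_hom by (simp add: group_hom_def group_hom_axioms_def group_free_group Aut.is_group)

lemma pushes_along_push: "w \<in> carrier (free_group n) \<Longrightarrow> pushes_along n w (push_hom n w)"
proof (induction w rule: free_group_induct)
  case one
  then show ?case using group_hom.hom_one[OF group_hom_push] pushes_along_one by simp
next
  case (gen i)
  then have "pushes_along n (winv (winv (gen i))) (inv\<^bsub>Aut_free (Suc n)\<^esub> (BR.pushes n i))"
    by (intro pushes_along_inv pushes_along_pushes) auto
  then show ?case using push_hom_gen[OF gen] by simp
next
  case (inv x)
  then show ?case
    using group_hom.hom_inv[OF group_hom_push] pushes_along_inv by (simp add: inv_free_group)
next
  case (mult x y)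
  then show ?case
    using group_hom.hom_mult[OF group_hom_push mult(1,2)] pushes_along_mult by simp
qed

lemma push_group_image: "BR.push_group n = push_hom n ` carrier (free_group n)"
proof -
  interpret h: group_hom "free_group n" "Aut_free (Suc n)" "push_hom n" by (rule group_hom_push)
  let ?A = "Aut_free (Suc n)"
  have img: "push_hom n ` carrier (free_group n) = generate ?A (push_hom n ` gen ` {1..n})"
    unfolding generate_gens[symmetric] by (rule h.generate_img[symmetric]) auto
  have sub: "push_hom n ` gen ` {1..n} \<subseteq> carrier ?A" using h.hom_closed by auto
  have "BR.pushes n ` {1..n} \<subseteq> generate ?A (push_hom n ` gen ` {1..n})"
  proof
    fix u assume "u \<in> BR.pushes n ` {1..n}"
    then obtain i where i: "i \<in> {1..n}" "u = BR.pushes n i" by blast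
    then have "u = inv\<^bsub>?A\<^esub> (push_hom n (gen i))"
      using push_hom_gen[OF i(1)] BR.pushes_closed[OF i(1)] by simp
    then show "u \<in> generate ?A (push_hom n ` gen ` {1..n})"
      using i(1) by (auto intro: generate.inv)
  qed
  then have "BR.push_group n \<subseteq> generate ?A (push_hom n ` gen ` {1..n})"
    unfolding BR.push_group_def by (rule Aut.generate_subgroup_incl[OF _ Aut.generate_is_subgroup[OF sub]])
  moreover have "push_hom n ` gen ` {1..n} \<subseteq> BR.push_group n"
  proof
    fix u assume "u \<in> push_hom n ` gen ` {1..n}"
    then obtain i where i: "i \<in> {1..n}" "u = push_hom n (gen i)" by blast
    then show "u \<in> BR.push_group n"
      using subgroup.m_inv_closed[OF BR.push_subgroup BR.pushes_mem[OF i(1)]] push_hom_gen[OF i(1)] by simp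
  qed
  then have "generate ?A (push_hom n ` gen ` {1..n}) \<subseteq> BR.push_group n"
    by (rule Aut.generate_subgroup_incl[OF _ BR.push_subgroup])
  ultimately show ?thesis unfolding img by (rule subset_antisym)
qed

lemma braids_subgroup_generate: "generate (Aut_free n) (sig n ` {1..<n}) \<subseteq> {\<phi> \<in> carrier (Aut_free n). \<phi> (boundary n) = boundary n}"
  using sig_aut sig_boundary by (intro Aut.generate_subgroup_incl fix_subgroup boundary_closed) auto

lemma low_group_image: "BR.low_group n \<subseteq> ext n ` {\<phi> \<in> carrier (Aut_free n). \<phi> (boundary n) = boundary n}"
proof -
  interpret e: group_hom "Aut_free n" "Aut_free (Suc n)" "ext n"
    using ext_hom by (simp add: group_hom_def group_hom_axioms_def Aut.is_group)
  have "ext n ` sig n ` {1..<n} = sig (Suc n) ` {1..<n}"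
    unfolding image_image using ext_sig[of _ n] by (rule image_cong[OF refl])
  then have "BR.low_group n = generate (Aut_free (Suc n)) (ext n ` sig n ` {1..<n})"
    unfolding BR.low_group_def by (simp only:)
  also have "\<dots> = ext n ` generate (Aut_free n) (sig n ` {1..<n})"
    using sig_aut by (intro e.generate_img) auto
  finally show ?thesis using braids_subgroup_generate by blast
qed

lemma expsum_cj:
  assumes "reduced w" "reduced x"
  shows "expsum m (cj w x) = expsum m x"
proof -
  have "expsum m w + expsum m (winv w) = 0"
    using expsum_mult[of m w "winv w"] by simp
  then show ?thesis by (simp add: cj_def expsum_mult)
qed

text \<open>Artin's theorem puts \<beta> into the group generated by the half twists, whose elements
  have a combed form, and purity eliminates the coset representative.\<close>

theorem pure_braids_decompose:
  assumes \<beta>: "\<beta> \<in> pure_braids (Suc n)"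
  obtains w b where "w \<in> carrier (free_group n)" "b \<in> pure_braids n"
    "\<beta> = push_hom n w \<otimes>\<^bsub>Aut_free (Suc n)\<^esub> ext n b"
proof -
  let ?A = "Aut_free (Suc n)" and ?C = "carrier (free_group (Suc n))"
  have "\<beta> \<in> braids (Suc n)"
    using \<beta> unfolding pure_braids_iff braids_def by blast
  then have "\<beta> \<in> generate ?A (sig (Suc n) ` {1..n})"
    using braids_generated[of \<beta> "Suc n"] by (simp only: atLeastLessThanSuc_atLeastAtMost)
  then have "\<beta> \<in> BR.combed n" using BR.generate_subset_combed by blast
  then obtain u b k where dec: "\<beta> = u \<otimes>\<^bsub>?A\<^esub> b \<otimes>\<^bsub>?A\<^esub> BR.pull n k" "u \<in> BR.push_group n" "b \<in> BR.low_group n" and k: "k \<in> {1..Suc n}"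
    by (auto simp: BR.combed_def)
  obtain w where w: "w \<in> carrier (free_group n)" "u = push_hom n w" using dec(2) push_group_image by blast
  obtain b' where b': "b' \<in> carrier (Aut_free n)" "b' (boundary n) = boundary n" "b = ext n b'"
    using dec(3) low_group_image by blast
  have along: "pushes_along n w u" using pushes_along_push w by simp
  then have up: "u \<in> pure_braids (Suc n)" and uk: "\<And>v. v \<in> ?C \<Longrightarrow> kill n (u v) = kill n v"
    by (auto simp: pushes_along_def)
  obtain w' where w': "w' \<in> ?C" "u (gen (Suc n)) = cj w' (gen (Suc n))"
    using along by (auto simp: pushes_along_def)
  have aut: "u \<in> carrier ?A" "b \<in> carrier ?A" "BR.pull n k \<in> carrier ?A"
    using pure_braids_aut[OF up] ext_aut[OF b'(1)] b'(3) BR.pull_closed[OF k] by auto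
  have gk: "gen k \<in> ?C" "gen (Suc n) \<in> ?C" using k by auto
  have "BR.pull n k (gen k) = gen (Suc n)" using pull_gen[of k n k] k by simp
  then have "\<beta> (gen k) = cj w' (gen (Suc n))"
    using aut_mult_apply[OF Aut.m_closed[OF aut(1,2)] aut(3) gk(1)] aut_mult_apply[OF aut(1,2) gk(2)]
      ext_last[OF b'(1)] b'(3) w' dec(1) by simp
  moreover obtain v where v: "v \<in> ?C" "\<beta> (gen k) = cj v (gen k)" using \<beta> k by (rule pure_braidsE)
  ultimately have "cj v (gen k) = cj w' (gen (Suc n))" by simp
  \<comment> \<open>Exponent sums are invariant under conjugation, so x_k and x_{n+1} can only be
    conjugate for k = n + 1, where \<open>pull\<close> is trivial.\<close>
  then have "expsum (Suc n) (gen k) = expsum (Suc n) (gen (Suc n))"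
    using v(1) w'(1) by (metis expsum_cj free_group_reduced reduced_gen)
  then have "k = Suc n" by (simp add: expsum_gen split: if_splits)
  then have eq: "\<beta> = u \<otimes>\<^bsub>?A\<^esub> b" using dec(1) aut by simp
  \<comment> \<open>The push part is invisible after killing x_{n+1}, so \<open>b'\<close> is
    \<beta> with the last strand forgotten and inherits the conjugators.\<close>
  have "\<exists>v\<in>carrier (free_group n). b' (gen i) = cj v (gen i)" if i: "i \<in> {1..n}" for i
  proof -
    have i': "i \<in> {1..Suc n}" and g: "gen i \<in> ?C" "gen i \<in> carrier (free_group n)" using i by auto
    obtain v where v: "v \<in> ?C" "\<beta> (gen i) = cj v (gen i)" using \<beta> i' by (rule pure_braidsE)
    have c: "b' (gen i) \<in> carrier (free_group n)" using whom_closed[OF aut_whom[OF b'(1)] g(2)] .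
    have "cj (kill n v) (gen i) = kill n (\<beta> (gen i))"
      using v whom_cj[OF kill_whom v(1) g(1)] kill_low[OF g(2)] by simp
    also have "\<dots> = kill n (u (b' (gen i)))"
      using aut_mult_apply[OF aut(1,2) g(1)] eq b'(3) ext_gen[OF b'(1) i] by simp
    also have "\<dots> = b' (gen i)" using uk[OF free_group_Suc[OF c]] kill_low[OF c] by simp
    finally show ?thesis using whom_closed[OF kill_whom v(1)] by metis
  qed
  then have "b' \<in> pure_braids n" using b' by (simp add: pure_braids_iff)
  then show ?thesis using that w eq b'(3) by blast
qed


section \<open>The Andreadakis filtration\<close>

declare lower_central.simps(3) [simp del]

section \<open>Congruence modulo a normal subgroup\<close>

definition modeq :: "('a, 'b) monoid_scheme \<Rightarrow> 'a set \<Rightarrow> 'a \<Rightarrow> 'a \<Rightarrow> bool"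
  where "modeq G N x y \<longleftrightarrow> x \<otimes>\<^bsub>G\<^esub> inv\<^bsub>G\<^esub> y \<in> N"

context group
begin

lemma modeq_refl: "\<lbrakk>subgroup N G; x \<in> carrier G\<rbrakk> \<Longrightarrow> modeq G N x x"
  by (simp add: modeq_def subgroup.one_closed)

lemma modeq_sym:
  assumes "subgroup N G" "x \<in> carrier G" "y \<in> carrier G" "modeq G N x y"
  shows "modeq G N y x"
  using subgroup.m_inv_closed[OF assms(1), of "x \<otimes> inv y"] assms
  by (simp add: modeq_def inv_mult_group)

lemma modeq_trans:
  assumes "subgroup N G" "x \<in> carrier G" "y \<in> carrier G" "z \<in> carrier G" "modeq G N x y" "modeq G N y z"
  shows "modeq G N x z"
  using subgroup.m_closed[OF assms(1), of "x \<otimes> inv y" "y \<otimes> inv z"] assms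
  by (simp add: modeq_def m_assoc)

lemma modeq_mult:
  assumes N: "N \<lhd> G" and c: "x \<in> carrier G" "x' \<in> carrier G" "y \<in> carrier G" "y' \<in> carrier G"
    and m: "modeq G N x x'" "modeq G N y y'"
  shows "modeq G N (x \<otimes> y) (x' \<otimes> y')"
proof -
  interpret N: normal N G by fact
  have "(x \<otimes> y) \<otimes> inv (x' \<otimes> y') = (x \<otimes> (y \<otimes> inv y') \<otimes> inv x) \<otimes> (x \<otimes> inv x')"
    using c by (simp add: word_simps)
  moreover have "(x \<otimes> (y \<otimes> inv y') \<otimes> inv x) \<otimes> (x \<otimes> inv x') \<in> N"
    using m N.inv_op_closed2[OF c(1)] by (simp add: modeq_def)
  ultimately show ?thesis by (simp add: modeq_def)
qed

lemma modeq_inv: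
  assumes N: "N \<lhd> G" and c: "x \<in> carrier G" "y \<in> carrier G" and m: "modeq G N x y"
  shows "modeq G N (inv x) (inv y)"
proof -
  interpret N: normal N G by fact
  have "inv x \<otimes> inv (inv y) = inv x \<otimes> inv (x \<otimes> inv y) \<otimes> x"
    using c by (simp add: word_simps)
  moreover have "\<dots> \<in> N"
    using m c N.inv_op_closed1[OF c(1), of "inv (x \<otimes> inv y)"] by (simp add: modeq_def)
  ultimately show ?thesis by (simp add: modeq_def)
qed

lemma modeq_commute:
  "\<lbrakk>x \<in> carrier G; y \<in> carrier G; comm G x y \<in> N\<rbrakk> \<Longrightarrow> modeq G N (x \<otimes> y) (y \<otimes> x)"
  by (simp add: modeq_def comm_def word_simps)

lemma rcoset_eq_iff:
  assumes N: "N \<lhd> G" and c: "x \<in> carrier G" "y \<in> carrier G"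
  shows "N #> x = N #> y \<longleftrightarrow> modeq G N x y"
proof -
  interpret N: normal N G by fact
  have "N #> x = N #> y \<longleftrightarrow> x \<in> N #> y"
    using rcos_self[OF c(1) N.subgroup_axioms] repr_independence[OF _ c(2) N.subgroup_axioms, of x] by auto
  also have "\<dots> \<longleftrightarrow> x \<otimes> inv y \<in> N"
  proof
    assume "x \<in> N #> y"
    then obtain h where "h \<in> N" "x = h \<otimes> y" by (auto simp: r_coset_def)
    then show "x \<otimes> inv y \<in> N" using c by (simp add: m_assoc)
  next
    assume h: "x \<otimes> inv y \<in> N"
    then have "x = (x \<otimes> inv y) \<otimes> y" using c by (simp add: m_assoc)
    then show "x \<in> N #> y" using h unfolding r_coset_def by blast
  qed
  finally show ?thesis by (simp add: modeq_def)
qed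

text \<open>Well-definedness of the graded bracket in degrees 1 and i; the two arguments are
  perturbed one after the other.\<close>

lemma comm_modeq:
  assumes i: "i \<ge> 1" and f: "f \<in> carrier G" and c: "c \<in> lcs G i" and a: "a \<in> lcs G 2" and d: "d \<in> lcs G (Suc i)"
  shows "modeq G (lcs G (Suc (Suc i))) (comm G (a \<otimes> f) (d \<otimes> c)) (comm G f c)"
proof -
  let ?N = "lcs G (Suc (Suc i))"
  interpret N: normal ?N G by (rule lcs_normal)
  have cl: "a \<in> carrier G" "c \<in> carrier G" "d \<in> carrier G" "a \<otimes> f \<in> carrier G" using a c d f by auto
  have fc: "comm G f c \<in> lcs G (Suc i)" "comm G (a \<otimes> f) c \<in> lcs G (Suc i)"
    using f c cl i by (simp_all add: comm_lcs_Suc)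
  have "comm G (a \<otimes> f) c \<otimes> inv (comm G f c)
      = comm G a (comm G f c) \<otimes> (comm G f c \<otimes> comm G a c \<otimes> inv (comm G f c))"
    using cl f by (simp add: comm_def word_simps)
  moreover have "comm G a c \<in> ?N" using comm_lcs[OF a c] by simp
  moreover have "comm G a (comm G f c) \<in> ?N"
    by (rule comm_lcs_Suc[OF cl(1) fc(1)]) simp
  ultimately have 1: "modeq G ?N (comm G (a \<otimes> f) c) (comm G f c)"
    using N.inv_op_closed2[of "comm G f c" "comm G a c"] cl f by (simp add: modeq_def)
  have "comm G (a \<otimes> f) (d \<otimes> c) \<otimes> inv (comm G (a \<otimes> f) c)
      = comm G (a \<otimes> f) d \<otimes> comm G d (comm G (a \<otimes> f) c)"
    using cl f by (simp add: comm_def word_simps)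
  moreover have "comm G (a \<otimes> f) d \<in> ?N" "comm G d (comm G (a \<otimes> f) c) \<in> ?N"
    using comm_lcs_Suc[OF cl(4) d] comm_lcs_Suc[OF cl(3) fc(2)] by simp_all
  ultimately have 2: "modeq G ?N (comm G (a \<otimes> f) (d \<otimes> c)) (comm G (a \<otimes> f) c)"
    by (simp add: modeq_def)
  show ?thesis
    using modeq_trans[OF N.subgroup_axioms _ _ _ 2 1] cl f by simp
qed

end

text \<open>Agreement modulo \<open>N\<close> is agreement of two homomorphisms into H/N, so it need
  only be checked on generators.\<close>

lemma equalizer_subgroup:
  assumes "group_hom G H f" "group_hom G H h" "N \<lhd> H"
  shows "subgroup {x \<in> carrier G. modeq H N (f x) (h x)} G"
proof -
  interpret f: group_hom G H f by fact
  interpret h: group_hom G H h by fact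
  interpret N: normal N H by fact
  show ?thesis
    using f.H.modeq_refl[OF N.subgroup_axioms] f.H.modeq_mult[OF assms(3)] f.H.modeq_inv[OF assms(3)]
    by unfold_locales auto
qed

lemma group_hom_whom: "f \<in> whom m n \<Longrightarrow> group_hom (free_group m) (free_group n) f"
  by (simp add: group_hom_def group_hom_axioms_def group_free_group)

lemma whom_lcs: "\<lbrakk>f \<in> whom m n; x \<in> lcs (free_group m) k\<rbrakk> \<Longrightarrow> f x \<in> lcs (free_group n) k"
  using group_hom.lower_central_image[OF group_hom_whom F.subgroup_self F.subgroup_self, of f m n k]
    whom_closed[of f m n] by blast

lemma whom_modeq:
  assumes f: "f \<in> whom m n" and c: "x \<in> carrier (free_group m)" "y \<in> carrier (free_group m)"
    and m: "modeq (free_group m) (lcs (free_group m) k) x y"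
  shows "modeq (free_group n) (lcs (free_group n) k) (f x) (f y)"
proof -
  interpret f: group_hom "free_group m" "free_group n" f using f by (rule group_hom_whom)
  have "f (x \<otimes>\<^bsub>free_group m\<^esub> inv\<^bsub>free_group m\<^esub> y) \<in> lcs (free_group n) k"
    using m whom_lcs[OF f] unfolding modeq_def by blast
  then show ?thesis
    unfolding modeq_def f.hom_mult[OF c(1) F.inv_closed[OF c(2)]] f.hom_inv[OF c(2)] .
qed

section \<open>The Andreadakis filtration and its commutators\<close>

lemma andreadakis_iff:
  "\<phi> \<in> andreadakis n j \<longleftrightarrow> \<phi> \<in> carrier (Aut_free n) \<and>
    (\<forall>i\<ge>1. \<forall>g\<in>lcs (free_group n) i. modeq (free_group n) (lcs (free_group n) (i + j)) (\<phi> g) g)"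
  by (simp add: andreadakis_def modeq_def)

lemma andreadakisD:
  "\<lbrakk>\<phi> \<in> andreadakis n j; i \<ge> 1; g \<in> lcs (free_group n) i\<rbrakk>
    \<Longrightarrow> modeq (free_group n) (lcs (free_group n) (i + j)) (\<phi> g) g"
  by (simp add: andreadakis_iff)

lemma andreadakis_subgroup: "subgroup (andreadakis n j) (Aut_free n)"
proof
  show "andreadakis n j \<subseteq> carrier (Aut_free n)" by (auto simp: andreadakis_iff)
  show "\<one>\<^bsub>Aut_free n\<^esub> \<in> andreadakis n j"
    unfolding andreadakis_iff
    using F.modeq_refl[OF F.lcs_subgroup] F.lcs_in_carrier by (auto simp: aut_one_apply)
next
  fix \<phi> \<psi> assume in_A: "\<phi> \<in> andreadakis n j" "\<psi> \<in> andreadakis n j"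
  then have aut: "\<phi> \<in> carrier (Aut_free n)" "\<psi> \<in> carrier (Aut_free n)" by (auto simp: andreadakis_iff)
  have "modeq (free_group n) (lcs (free_group n) (i + j)) ((\<phi> \<otimes>\<^bsub>Aut_free n\<^esub> \<psi>) g) g"
    if i: "i \<ge> 1" and g: "g \<in> lcs (free_group n) i" for i g
  proof -
    have gc: "g \<in> carrier (free_group n)" using g by (rule F.lcs_in_carrier)
    note c = whom_closed[OF aut_whom[OF aut(1)]] whom_closed[OF aut_whom[OF aut(2)]]
    have "modeq (free_group n) (lcs (free_group n) (i + j)) (\<phi> (\<psi> g)) (\<phi> g)"
      by (rule whom_modeq[OF aut_whom[OF aut(1)] c(2)[OF gc] gc andreadakisD[OF in_A(2) i g]])
    then have "modeq (free_group n) (lcs (free_group n) (i + j)) (\<phi> (\<psi> g)) g"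
      by (rule F.modeq_trans[OF F.lcs_subgroup c(1)[OF c(2)[OF gc]] c(1)[OF gc] gc _ andreadakisD[OF in_A(1) i g]])
    then show ?thesis by (simp add: aut_mult_apply[OF aut gc])
  qed
  then show "\<phi> \<otimes>\<^bsub>Aut_free n\<^esub> \<psi> \<in> andreadakis n j" using aut by (simp add: andreadakis_iff)
next
  fix \<phi> assume in_A: "\<phi> \<in> andreadakis n j"
  then have aut: "\<phi> \<in> carrier (Aut_free n)" by (auto simp: andreadakis_iff)
  let ?i = "inv\<^bsub>Aut_free n\<^esub> \<phi>"
  have iaut: "?i \<in> carrier (Aut_free n)" using aut by simp
  have "modeq (free_group n) (lcs (free_group n) (i + j)) (?i g) g"
    if i: "i \<ge> 1" and g: "g \<in> lcs (free_group n) i" for i g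
  proof -
    have gc: "g \<in> carrier (free_group n)" using g by (rule F.lcs_in_carrier)
    have pc: "\<phi> g \<in> carrier (free_group n)" using whom_closed[OF aut_whom[OF aut] gc] .
    have "modeq (free_group n) (lcs (free_group n) (i + j)) (?i (\<phi> g)) (?i g)"
      by (rule whom_modeq[OF aut_whom[OF iaut] pc gc andreadakisD[OF in_A i g]])
    then have "modeq (free_group n) (lcs (free_group n) (i + j)) g (?i g)"
      by (simp add: aut_inv_apply(1)[OF aut gc])
    then show ?thesis
      by (rule F.modeq_sym[OF F.lcs_subgroup gc whom_closed[OF aut_whom[OF iaut] gc]])
  qed
  then show "?i \<in> andreadakis n j" using iaut by (simp add: andreadakis_iff)
qed

lemma derived_eq_lcs: "derived (free_group n) (carrier (free_group n)) = lcs (free_group n) 2"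
proof -
  have "derived_set (free_group n) (carrier (free_group n))
      = {comm (free_group n) h k | h k. h \<in> carrier (free_group n) \<and> k \<in> carrier (free_group n)}"
    by (auto simp: comm_def)
  then show ?thesis
    unfolding derived_def numeral_2_eq_2 by (simp add: lower_central_Suc commutator_subgroup_comm)
qed

lemma IA_iff: "\<phi> \<in> IA n \<longleftrightarrow> \<phi> \<in> carrier (Aut_free n) \<and>
    (\<forall>w\<in>carrier (free_group n). modeq (free_group n) (lcs (free_group n) 2) (\<phi> w) w)"
proof (cases "\<phi> \<in> carrier (Aut_free n)")
  case True
  have "lcs (free_group n) 2 #>\<^bsub>free_group n\<^esub> \<phi> w = lcs (free_group n) 2 #>\<^bsub>free_group n\<^esub> w
      \<longleftrightarrow> modeq (free_group n) (lcs (free_group n) 2) (\<phi> w) w" if "w \<in> carrier (free_group n)" for w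
    by (rule F.rcoset_eq_iff[OF F.lcs_normal whom_closed[OF aut_whom[OF True] that] that])
  then show ?thesis using True by (simp add: IA_def derived_eq_lcs)
qed (simp add: IA_def)

text \<open>The graded ring of F_n is generated in degree 1, so an automorphism acting trivially
  there acts trivially in every degree; the induction step is \<open>comm_modeq\<close>.\<close>

theorem IA_eq_andreadakis_1: "IA n = andreadakis n 1"
proof
  show "andreadakis n 1 \<subseteq> IA n"
  proof
    fix \<phi> assume "\<phi> \<in> andreadakis n 1"
    then show "\<phi> \<in> IA n"
      using andreadakisD[of \<phi> n 1 1] by (simp add: andreadakis_iff IA_iff numeral_2_eq_2)
  qed
  show "IA n \<subseteq> andreadakis n 1"
  proof
    fix \<phi> assume \<phi>: "\<phi> \<in> IA n"
    let ?F = "free_group n"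
    have aut: "\<phi> \<in> carrier (Aut_free n)" using \<phi> by (simp add: IA_iff)
    note f = aut_whom[OF aut]
    interpret f: group_hom ?F ?F \<phi> using f by (rule group_hom_whom)
    have id: "group_hom ?F ?F (\<lambda>x. x)" by (rule group_hom_whom) (rule whom_id, simp)
    have key: "modeq ?F (lcs ?F (Suc (Suc i))) (\<phi> g) g" if "g \<in> lcs ?F (Suc i)" for i g
      using that
    proof (induction i arbitrary: g)
      case 0
      then show ?case using \<phi> by (simp add: IA_iff numeral_2_eq_2)
    next
      case (Suc i)
      let ?E = "{x \<in> carrier ?F. modeq ?F (lcs ?F (Suc (Suc (Suc i)))) (\<phi> x) x}"
      have sg: "subgroup ?E ?F"
        by (rule equalizer_subgroup[OF f.group_hom_axioms id F.lcs_normal])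
      have "{comm ?F h k | h k. h \<in> carrier ?F \<and> k \<in> lcs ?F (Suc i)} \<subseteq> ?E"
      proof clarify
        fix h k assume h: "h \<in> carrier ?F" and k: "k \<in> lcs ?F (Suc i)"
        have kc: "k \<in> carrier ?F" using k by (rule F.lcs_in_carrier)
        define a where "a = \<phi> h \<otimes>\<^bsub>?F\<^esub> inv\<^bsub>?F\<^esub> h"
        define d where "d = \<phi> k \<otimes>\<^bsub>?F\<^esub> inv\<^bsub>?F\<^esub> k"
        have a: "a \<in> lcs ?F 2" using \<phi> h by (simp add: IA_iff modeq_def a_def)
        have d: "d \<in> lcs ?F (Suc (Suc i))" using Suc.IH[OF k] by (simp add: modeq_def d_def)
        have eq: "\<phi> h = a \<otimes>\<^bsub>?F\<^esub> h" "\<phi> k = d \<otimes>\<^bsub>?F\<^esub> k"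
          unfolding a_def d_def using h kc f.hom_closed by (simp_all add: F.m_assoc del: mult_free_group one_free_group)
        have "\<phi> (comm ?F h k) = comm ?F (a \<otimes>\<^bsub>?F\<^esub> h) (d \<otimes>\<^bsub>?F\<^esub> k)"
          unfolding f.hom_comm[OF h kc] eq ..
        then show "comm ?F h k \<in> carrier ?F \<and> modeq ?F (lcs ?F (Suc (Suc (Suc i)))) (\<phi> (comm ?F h k)) (comm ?F h k)"
          using F.comm_modeq[OF _ h k a d] h kc by (simp del: mult_free_group)
      qed
      then have "lcs ?F (Suc (Suc i)) \<subseteq> ?E"
        using F.generate_subgroup_incl[OF _ sg] by (simp add: lower_central_Suc commutator_subgroup_comm)
      then show ?case using Suc.prems by blast
    qed
    have "modeq ?F (lcs ?F (i + 1)) (\<phi> g) g" if "i \<ge> 1" "g \<in> lcs ?F i" for i g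
      using key[of g "i - 1"] that by simp
    then show "\<phi> \<in> andreadakis n 1" unfolding andreadakis_iff using aut by blast
  qed
qed

text \<open>Put \<psi> g = a g and \<phi> g = b g. Modulo Gamma_{i+j+1} the automorphism \<phi>
  fixes \<open>a\<close> and \<psi> fixes \<open>b\<close>, so \<phi> \<psi> g is a b g and \<psi>
  \<phi> g is b a g. These agree because \<open>a\<close> already lies in Gamma_{i+j}.\<close>

lemma comm_andreadakis:
  assumes \<phi>: "\<phi> \<in> andreadakis n 1" and \<psi>: "\<psi> \<in> andreadakis n j"
  shows "comm (Aut_free n) \<phi> \<psi> \<in> andreadakis n (Suc j)"
proof -
  let ?F = "free_group n" and ?A = "Aut_free n"
  have aut: "\<phi> \<in> carrier ?A" "\<psi> \<in> carrier ?A" using assms by (auto simp: andreadakis_iff)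
  note fw = aut_whom[OF aut(1)] and gw = aut_whom[OF aut(2)]
  note fc = whom_closed[OF fw] and gc = whom_closed[OF gw]
  interpret f: group_hom ?F ?F \<phi> using fw by (rule group_hom_whom)
  interpret g: group_hom ?F ?F \<psi> using gw by (rule group_hom_whom)
  have key: "modeq ?F (lcs ?F (i + Suc j)) (\<phi> (\<psi> g)) (\<psi> (\<phi> g))" if i: "i \<ge> 1" and g: "g \<in> lcs ?F i" for i g
  proof -
    let ?N = "lcs ?F (i + Suc j)"
    have g': "g \<in> carrier ?F" using g by (rule F.lcs_in_carrier)
    define a where "a = \<psi> g \<otimes>\<^bsub>?F\<^esub> inv\<^bsub>?F\<^esub> g"
    define b where "b = \<phi> g \<otimes>\<^bsub>?F\<^esub> inv\<^bsub>?F\<^esub> g"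
    have a: "a \<in> lcs ?F (i + j)" using andreadakisD[OF \<psi> i g] by (simp add: modeq_def a_def)
    have b: "b \<in> lcs ?F (i + 1)" using andreadakisD[OF \<phi> i g] by (simp add: modeq_def b_def)
    have ab: "a \<in> carrier ?F" "b \<in> carrier ?F" using a b F.lcs_in_carrier by blast+
    have eq: "\<psi> g = a \<otimes>\<^bsub>?F\<^esub> g" "\<phi> g = b \<otimes>\<^bsub>?F\<^esub> g"
      unfolding a_def b_def using g' fc gc by (simp_all add: F.m_assoc del: mult_free_group one_free_group)
    have ma: "modeq ?F ?N (\<phi> a) a" using andreadakisD[OF \<phi> _ a] i by simp
    have mb: "modeq ?F ?N (\<psi> b) b" using andreadakisD[OF \<psi> _ b] i by simp
    have N: "?N \<lhd> ?F" and Ns: "subgroup ?N ?F" by (rule F.lcs_normal, rule F.lcs_subgroup)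
    have refl: "modeq ?F ?N g g" using Ns g' by (rule F.modeq_refl)
    have reflb: "modeq ?F ?N b b" using Ns ab(2) by (rule F.modeq_refl)
    have refla: "modeq ?F ?N a a" using Ns ab(1) by (rule F.modeq_refl)
    have "comm ?F b a \<in> ?N" using F.comm_lcs_Suc[OF ab(2) a] i by simp
    then have "comm ?F a b \<in> ?N" using F.comm_swap_mem[OF Ns] ab by blast
    then have ab': "modeq ?F ?N (a \<otimes>\<^bsub>?F\<^esub> b) (b \<otimes>\<^bsub>?F\<^esub> a)" using ab by (intro F.modeq_commute)
    have 1: "modeq ?F ?N (\<phi> a \<otimes>\<^bsub>?F\<^esub> b) (a \<otimes>\<^bsub>?F\<^esub> b)"
      using ab fc by (intro F.modeq_mult[OF N _ _ _ _ ma reflb])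
    have 2: "modeq ?F ?N (b \<otimes>\<^bsub>?F\<^esub> a) (\<psi> b \<otimes>\<^bsub>?F\<^esub> a)"
      using ab gc by (intro F.modeq_mult[OF N _ _ _ _ F.modeq_sym[OF Ns _ _ mb] refla])
    have c: "\<phi> a \<otimes>\<^bsub>?F\<^esub> b \<in> carrier ?F" "a \<otimes>\<^bsub>?F\<^esub> b \<in> carrier ?F" "b \<otimes>\<^bsub>?F\<^esub> a \<in> carrier ?F" "\<psi> b \<otimes>\<^bsub>?F\<^esub> a \<in> carrier ?F"
      using ab fc gc by (auto intro: F.m_closed simp del: mult_free_group)
    have "modeq ?F ?N (\<phi> a \<otimes>\<^bsub>?F\<^esub> b) (\<psi> b \<otimes>\<^bsub>?F\<^esub> a)"
      using F.modeq_trans[OF Ns c(1,3,4) F.modeq_trans[OF Ns c(1,2,3) 1 ab'] 2] .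
    then have 3: "modeq ?F ?N (\<phi> a \<otimes>\<^bsub>?F\<^esub> b \<otimes>\<^bsub>?F\<^esub> g) (\<psi> b \<otimes>\<^bsub>?F\<^esub> a \<otimes>\<^bsub>?F\<^esub> g)"
      by (rule F.modeq_mult[OF N c(1,4) g' g' _ refl])
    have "\<phi> (\<psi> g) = \<phi> a \<otimes>\<^bsub>?F\<^esub> \<phi> g" unfolding eq(1) by (rule f.hom_mult[OF ab(1) g'])
    also have "\<dots> = \<phi> a \<otimes>\<^bsub>?F\<^esub> b \<otimes>\<^bsub>?F\<^esub> g"
      unfolding eq(2) by (rule F.m_assoc[symmetric, OF fc[OF ab(1)] ab(2) g'])
    finally have 4: "\<phi> (\<psi> g) = \<phi> a \<otimes>\<^bsub>?F\<^esub> b \<otimes>\<^bsub>?F\<^esub> g" .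
    have "\<psi> (\<phi> g) = \<psi> b \<otimes>\<^bsub>?F\<^esub> \<psi> g" unfolding eq(2) by (rule g.hom_mult[OF ab(2) g'])
    also have "\<dots> = \<psi> b \<otimes>\<^bsub>?F\<^esub> a \<otimes>\<^bsub>?F\<^esub> g"
      unfolding eq(1) by (rule F.m_assoc[symmetric, OF gc[OF ab(2)] ab(1) g'])
    finally show ?thesis using 3 4 by simp
  qed
  have c: "comm ?A \<phi> \<psi> \<in> carrier ?A" using aut by simp
  have "modeq ?F (lcs ?F (i + Suc j)) (comm ?A \<phi> \<psi> g) g" if i: "i \<ge> 1" and g: "g \<in> lcs ?F i" for i g
  proof -
    have g': "g \<in> carrier ?F" using g by (rule F.lcs_in_carrier)
    have inv: "inv\<^bsub>?A\<^esub> \<phi> \<in> carrier ?A" "inv\<^bsub>?A\<^esub> \<psi> \<in> carrier ?A" using aut by auto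
    \<comment> \<open>With g = \<psi> \<phi> h the commutator applied to g is \<phi> \<psi> h, so
      the comparison above applies to h.\<close>
    define h where "h = (inv\<^bsub>?A\<^esub> \<phi>) ((inv\<^bsub>?A\<^esub> \<psi>) g)"
    have h: "h \<in> lcs ?F i"
      unfolding h_def by (rule whom_lcs[OF aut_whom[OF inv(1)] whom_lcs[OF aut_whom[OF inv(2)] g]])
    have pc: "(inv\<^bsub>?A\<^esub> \<psi>) g \<in> carrier ?F" using whom_closed[OF aut_whom[OF inv(2)] g'] .
    have 1: "\<psi> (\<phi> h) = g"
      unfolding h_def aut_inv_apply(2)[OF aut(1) pc] aut_inv_apply(2)[OF aut(2) g'] ..
    have "comm ?A \<phi> \<psi> g = \<phi> (\<psi> h)"
      unfolding comm_def h_def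
      using aut_mult_apply[OF Aut.m_closed[OF Aut.m_closed[OF aut] inv(1)] inv(2) g']
        aut_mult_apply[OF Aut.m_closed[OF aut] inv(1) pc]
        aut_mult_apply[OF aut whom_closed[OF aut_whom[OF inv(1)] pc]] by simp
    then show ?thesis using key[OF i h] 1 by simp
  qed
  then show ?thesis using c by (simp add: andreadakis_iff)
qed

theorem lower_central_IA_subset: "j \<ge> 1 \<Longrightarrow> lower_central (Aut_free n) (IA n) j \<subseteq> andreadakis n j"
proof (induction j rule: dec_induct)
  case base
  then show ?case by (simp add: IA_eq_andreadakis_1)
next
  case (step j)
  have "{comm (Aut_free n) h k | h k. h \<in> IA n \<and> k \<in> lower_central (Aut_free n) (IA n) j} \<subseteq> andreadakis n (Suc j)"
    using comm_andreadakis step.IH unfolding IA_eq_andreadakis_1 by blast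
  then show ?case
    using step by (simp add: lower_central_Suc commutator_subgroup_comm Aut.generate_subgroup_incl andreadakis_subgroup)
qed

lemma IA_subgroup: "subgroup (IA n) (Aut_free n)"
  unfolding IA_eq_andreadakis_1 by (rule andreadakis_subgroup)

lemma conj_auts_IA: "conj_auts n \<subseteq> IA n"
proof
  fix \<phi> assume \<phi>: "\<phi> \<in> conj_auts n"
  let ?F = "free_group n"
  have aut: "\<phi> \<in> carrier (Aut_free n)" using \<phi> by (simp add: conj_auts_def)
  have id: "group_hom ?F ?F (\<lambda>x. x)" by (rule group_hom_whom) (rule whom_id, simp)
  let ?E = "{x \<in> carrier ?F. modeq ?F (lcs ?F 2) (\<phi> x) x}"
  have sg: "subgroup ?E ?F"
    by (rule equalizer_subgroup[OF group_hom_whom[OF aut_whom[OF aut]] id F.lcs_normal])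
  have "gen ` {1..n} \<subseteq> ?E"
  proof
    fix x assume "x \<in> gen ` {1..n}"
    then obtain i where i: "i \<in> {1..n}" "x = gen i" by blast
    have x: "x \<in> carrier ?F" using i by simp
    obtain w where w: "w \<in> carrier ?F" "\<phi> x = cj w x" using \<phi> i unfolding conj_auts_def by blast
    have "comm ?F w x \<in> lcs ?F (Suc 1)" using w x by (intro F.comm_lcs_Suc) auto
    moreover have "comm ?F w x = \<phi> x \<otimes>\<^bsub>?F\<^esub> inv\<^bsub>?F\<^esub> x"
      unfolding comm_def w(2) inv_free_group_cj[OF w(1) x] ..
    ultimately show "x \<in> ?E" using x by (simp add: modeq_def numeral_2_eq_2)
  qed
  then have "generate ?F (gen ` {1..n}) \<subseteq> ?E" by (rule F.generate_subgroup_incl[OF _ sg])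
  then have "carrier ?F \<subseteq> ?E" by (simp only: generate_gens)
  then show "\<phi> \<in> IA n" using aut by (auto simp: IA_iff)
qed

lemma pure_braids_IA: "pure_braids n \<subseteq> IA n"
  using conj_auts_IA pure_braids_eq_Int by blast

lemma lower_central_subset_andreadakis:
  assumes "subgroup K (Aut_free n)" "K \<subseteq> IA n" "j \<ge> 1"
  shows "lower_central (Aut_free n) K j \<subseteq> andreadakis n j"
  using Aut.lower_central_mono[OF assms(1) IA_subgroup assms(2)] lower_central_IA_subset[OF assms(3)] by blast

lemma conj_eq_comm_free:
  "\<lbrakk>w \<in> carrier (free_group n); x \<in> carrier (free_group n)\<rbrakk>
    \<Longrightarrow> cj w x \<otimes>\<^bsub>free_group n\<^esub> inv\<^bsub>free_group n\<^esub> x = comm (free_group n) w x"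
  unfolding comm_def by (simp only: inv_free_group_cj)

text \<open>Killing x_{n+1} shows that the factor \<open>b\<close> of \<beta> inherits its depth, so
  induction on the number of strands applies to it. Dividing it out leaves a push of depth j, and
  its effect on x_{n+1} gives the depth of the loop, which \<open>push_hom\<close> turns into depth
  in the lower central series of P_{n+1}.\<close>

theorem pure_braids_andreadakis:
  assumes j: "j \<ge> 1"
  shows "pure_braids n \<inter> andreadakis n j \<subseteq> lower_central (Aut_free n) (pure_braids n) j"
proof (induction n)
  case 0
  show ?case
  proof
    fix \<phi> assume "\<phi> \<in> pure_braids 0 \<inter> andreadakis 0 j"
    then have "\<phi> \<in> carrier (Aut_free 0)" by (simp add: pure_braids_iff)
    then have "\<phi> = \<one>\<^bsub>Aut_free 0\<^esub>" by (rule aut_eqI[OF _ Aut.one_closed]) simp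
    then show "\<phi> \<in> lower_central (Aut_free 0) (pure_braids 0) j"
      using subgroup.one_closed[OF Aut.lower_central_subgroup[OF pure_braids_subgroup]] by simp
  qed
next
  case (Suc n)
  let ?F = "free_group n" and ?F' = "free_group (Suc n)" and ?A = "Aut_free (Suc n)" and ?P = "pure_braids (Suc n)"
  let ?L = "lower_central ?A ?P j"
  have Ls: "subgroup ?L ?A" by (rule Aut.lower_central_subgroup[OF pure_braids_subgroup])
  show ?case
  proof
    fix \<beta> assume \<beta>: "\<beta> \<in> ?P \<inter> andreadakis (Suc n) j"
    then obtain w b where w: "w \<in> carrier ?F" and b: "b \<in> pure_braids n" and dec: "\<beta> = push_hom n w \<otimes>\<^bsub>?A\<^esub> ext n b"
      using pure_braids_decompose by blast
    have baut: "b \<in> carrier (Aut_free n)" using b by (rule pure_braids_aut)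
    have eaut: "ext n b \<in> carrier ?A" using baut by (rule ext_aut)
    have along: "pushes_along n w (push_hom n w)" using w by (rule pushes_along_push)
    have paut: "push_hom n w \<in> carrier ?A" using along by (auto simp: pushes_along_def pure_braids_iff)
    have "modeq ?F (lcs ?F (i + j)) (b g) g" if i: "i \<ge> 1" and g: "g \<in> lcs ?F i" for i g
    proof -
      have g': "g \<in> carrier ?F" "g \<in> carrier ?F'" using F.lcs_in_carrier[OF g] free_group_Suc by auto
      have bg: "b g \<in> carrier ?F" using whom_closed[OF aut_whom[OF baut] g'(1)] .
      have "g \<in> lcs ?F' i" using whom_lcs[OF whom_id g, of "Suc n"] by simp
      then have "modeq ?F' (lcs ?F' (i + j)) (\<beta> g) g" using \<beta> i by (intro andreadakisD) auto
      moreover have "\<beta> g \<in> carrier ?F'" using \<beta> g'(2) whom_closed[OF aut_whom] by (auto simp: pure_braids_iff)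
      ultimately have "modeq ?F (lcs ?F (i + j)) (kill n (\<beta> g)) (kill n g)"
        using g'(2) by (intro whom_modeq[OF kill_whom])
      moreover have "kill n (\<beta> g) = b g"
        using aut_mult_apply[OF paut eaut g'(2)] dec ext_low[OF baut g'(1)] along free_group_Suc[OF bg] kill_low[OF bg]
        by (simp add: pushes_along_def)
      ultimately show ?thesis using kill_low[OF g'(1)] by simp
    qed
    then have "b \<in> andreadakis n j" using baut by (simp add: andreadakis_iff)
    then have "b \<in> lower_central (Aut_free n) (pure_braids n) j" using Suc b by blast
    moreover interpret e: group_hom "Aut_free n" ?A "ext n"
      using ext_hom by (simp add: group_hom_def group_hom_axioms_def Aut.is_group)
    have "ext n ` lower_central (Aut_free n) (pure_braids n) j \<subseteq> ?L"
      using ext_pure by (intro e.lower_central_image pure_braids_subgroup) auto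
    ultimately have eL: "ext n b \<in> ?L" by blast
    then have "ext n b \<in> andreadakis (Suc n) j"
      using lower_central_subset_andreadakis[OF pure_braids_subgroup pure_braids_IA j] by blast
    moreover have "push_hom n w = \<beta> \<otimes>\<^bsub>?A\<^esub> inv\<^bsub>?A\<^esub> (ext n b)"
      using dec paut eaut by (simp add: Aut.m_assoc)
    ultimately have pA: "push_hom n w \<in> andreadakis (Suc n) j"
      using \<beta> subgroup.m_closed[OF andreadakis_subgroup] subgroup.m_inv_closed[OF andreadakis_subgroup] by auto
    obtain w' where w': "w' \<in> carrier ?F'" "push_hom n w (gen (Suc n)) = cj w' (gen (Suc n))" "kill n w' = winv w"
      using along by (auto simp: pushes_along_def)
    have x: "gen (Suc n) \<in> carrier ?F'" by simp
    have "modeq ?F' (lcs ?F' (1 + j)) (push_hom n w (gen (Suc n))) (gen (Suc n))"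
      using pA x by (intro andreadakisD) auto
    then have "comm ?F' w' (gen (Suc n)) \<in> lcs ?F' (Suc j)"
      unfolding modeq_def w'(2) conj_eq_comm_free[OF w'(1) x] by simp
    then obtain e :: int where e: "w' \<star> gen (Suc n) [^]\<^bsub>?F'\<^esub> e \<in> lcs ?F' j"
      using centralizer_gen_mod_lcs[OF w'(1), of "Suc n" j] by auto
    have pc: "gen (Suc n) [^]\<^bsub>?F'\<^esub> e \<in> carrier ?F'" using x by simp
    interpret k: group_hom ?F' ?F "kill n" by (rule group_hom_whom[OF kill_whom])
    \<comment> \<open>The power left undetermined by the centralizer dies together with x_{n+1}, so
      the loop itself lies in Gamma_j.\<close>
    have "kill n (gen (Suc n) [^]\<^bsub>?F'\<^esub> e) = kill n (gen (Suc n)) [^]\<^bsub>?F\<^esub> e"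
      using k.hom_int_pow[OF x] by simp
    also have "\<dots> = []" using kill_gen[of "Suc n" n] F.int_pow_one[of n e] by simp
    finally have "kill n (w' \<star> gen (Suc n) [^]\<^bsub>?F'\<^esub> e) = winv w"
      using whom_wmult[OF kill_whom w'(1) pc] w' w by (simp add: free_group_reduced)
    then have "winv w \<in> lcs ?F j" using whom_lcs[OF kill_whom e] by simp
    then have "w \<in> lcs ?F j"
      using subgroup.m_inv_closed[OF F.lcs_subgroup, of "winv w" n j] w by (simp add: inv_free_group)
    moreover have "push_hom n ` lcs ?F j \<subseteq> ?L"
      using pushes_along_push
      by (intro group_hom.lower_central_image[OF group_hom_push] F.subgroup_self pure_braids_subgroup) (auto simp: pushes_along_def)
    ultimately have "push_hom n w \<in> ?L" by blast
    then show "\<beta> \<in> ?L" unfolding dec using eL by (rule subgroup.m_closed[OF Ls])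
  qed
qed


section \<open>Inner automorphisms\<close>

lemma reduced_boundary [simp]: "reduced (boundary n)"
  using boundary_closed by (rule free_group_reduced)

lemma inner_apply: "\<lbrakk>g \<in> carrier (free_group n); x \<in> carrier (free_group n)\<rbrakk> \<Longrightarrow> inner (free_group n) g x = cj g x"
  unfolding inner_def by (simp only: restrict_apply' inv_free_group_cj)

lemma inner_aut: 
  assumes g: "g \<in> carrier (free_group n)"
  shows "inner (free_group n) g \<in> carrier (Aut_free n)"
proof -
  let ?C = "carrier (free_group n)"
  have "inner (free_group n) g \<in> whom n n"
  proof (rule homI)
    fix x y assume xy: "x \<in> ?C" "y \<in> ?C"
    then show "inner (free_group n) g (x \<otimes>\<^bsub>free_group n\<^esub> y)
        = inner (free_group n) g x \<otimes>\<^bsub>free_group n\<^esub> inner (free_group n) g y"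
      using g inner_apply[OF g wmult_closed[OF xy]] by (simp add: inner_apply cj_wmult free_group_reduced)
  qed (use g in \<open>simp add: inner_apply\<close>)
  moreover have "bij_betw (inner (free_group n) g) ?C ?C"
    by (rule bij_betw_byWitness[of _ "cj (winv g)"]) (use g in \<open>auto simp: inner_apply free_group_reduced\<close>)
  moreover have "inner (free_group n) g \<in> extensional ?C" by (simp add: inner_def)
  ultimately show ?thesis by (simp add: aut_iff)
qed

lemma inner_hom: "inner (free_group n) \<in> hom (free_group n) (Aut_free n)"
proof (rule homI)
  fix g h assume gh: "g \<in> carrier (free_group n)" "h \<in> carrier (free_group n)"
  show "inner (free_group n) (g \<otimes>\<^bsub>free_group n\<^esub> h) = inner (free_group n) g \<otimes>\<^bsub>Aut_free n\<^esub> inner (free_group n) h"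
  proof (rule aut_eqI[OF inner_aut Aut.m_closed[OF inner_aut inner_aut]])
    fix i assume "i \<in> {1..n}"
    then have x: "gen i \<in> carrier (free_group n)" by simp
    show "inner (free_group n) (g \<otimes>\<^bsub>free_group n\<^esub> h) (gen i)
        = (inner (free_group n) g \<otimes>\<^bsub>Aut_free n\<^esub> inner (free_group n) h) (gen i)"
      using aut_mult_apply[OF inner_aut[OF gh(1)] inner_aut[OF gh(2)] x] gh x inner_apply[OF gh(2) x]
        inner_apply[OF gh(1) cj_closed[OF gh(2) x]] inner_apply[OF wmult_closed[OF gh] x]
      by (simp add: free_group_reduced)
  qed (use gh in auto)
qed (rule inner_aut)

lemma group_hom_inner: "group_hom (free_group n) (Aut_free n) (inner (free_group n))"
  using inner_hom by (simp add: group_hom_def group_hom_axioms_def group_free_group Aut.is_group)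

lemma inner_inv:
  "g \<in> carrier (free_group n) \<Longrightarrow> inner (free_group n) (winv g) = inv\<^bsub>Aut_free n\<^esub> (inner (free_group n) g)"
  using group_hom.hom_inv[OF group_hom_inner, of g n] by (simp add: inv_free_group)

lemma conj_inner:
  assumes \<phi>: "\<phi> \<in> carrier (Aut_free n)" and g: "g \<in> carrier (free_group n)"
  shows "\<phi> \<otimes>\<^bsub>Aut_free n\<^esub> inner (free_group n) g = inner (free_group n) (\<phi> g) \<otimes>\<^bsub>Aut_free n\<^esub> \<phi>"
proof -
  have pg: "\<phi> g \<in> carrier (free_group n)" using whom_closed[OF aut_whom[OF \<phi>] g] .
  show ?thesis
  proof (rule aut_eqI)
    fix i assume "i \<in> {1..n}"
    then have x: "gen i \<in> carrier (free_group n)" by simp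
    show "(\<phi> \<otimes>\<^bsub>Aut_free n\<^esub> inner (free_group n) g) (gen i) = (inner (free_group n) (\<phi> g) \<otimes>\<^bsub>Aut_free n\<^esub> \<phi>) (gen i)"
      unfolding aut_mult_apply[OF \<phi> inner_aut[OF g] x] aut_mult_apply[OF inner_aut[OF pg] \<phi> x]
        inner_apply[OF g x] inner_apply[OF pg whom_closed[OF aut_whom[OF \<phi>] x]]
      by (rule whom_cj[OF aut_whom[OF \<phi>] g x])
  qed (use \<phi> inner_aut[OF g] inner_aut[OF pg] in auto)
qed


section \<open>The group \<open>Inn(F\<^sub>n)P\<^sub>n\<close>\<close>

text \<open>Undoing the conjugation of \<partial>_n is also how an automorphism obtained by rotation
  becomes a pure braid again.\<close>

lemma inner_correction:
  assumes \<phi>: "\<phi> \<in> conj_auts n" and w: "w \<in> carrier (free_group n)" "\<phi> (boundary n) = cj w (boundary n)"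
  shows "inner (free_group n) (winv w) \<otimes>\<^bsub>Aut_free n\<^esub> \<phi> \<in> pure_braids n"
proof -
  have aut: "\<phi> \<in> carrier (Aut_free n)" using \<phi> by (simp add: conj_auts_def)
  have w': "winv w \<in> carrier (free_group n)" using w by simp
  have "inner (free_group n) (winv w) \<in> conj_auts n"
    using inner_aut[OF w'] w' inner_apply[OF w'] by (auto simp: conj_auts_def)
  then have "inner (free_group n) (winv w) \<otimes>\<^bsub>Aut_free n\<^esub> \<phi> \<in> conj_auts n"
    using \<phi> subgroup.m_closed[OF conj_auts_subgroup] by blast
  moreover have "(inner (free_group n) (winv w) \<otimes>\<^bsub>Aut_free n\<^esub> \<phi>) (boundary n) = boundary n"
    using aut_mult_apply[OF inner_aut[OF w'] aut boundary_closed] w boundary_closed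
      inner_apply[OF w' cj_closed[OF w(1) boundary_closed]]
    by (simp add: free_group_reduced)
  ultimately show ?thesis by (auto simp: pure_braids_iff conj_auts_def)
qed

lemma Inn_pure_braids_iff:
  "\<phi> \<in> Inn_pure_braids n \<longleftrightarrow> \<phi> \<in> conj_auts n \<and> (\<exists>w\<in>carrier (free_group n). \<phi> (boundary n) = cj w (boundary n))"
proof
  assume "\<phi> \<in> Inn_pure_braids n"
  then obtain g \<beta> where g: "g \<in> carrier (free_group n)" and \<beta>: "\<beta> \<in> pure_braids n"
    and \<phi>: "\<phi> = inner (free_group n) g \<otimes>\<^bsub>Aut_free n\<^esub> \<beta>"
    by (auto simp: Inn_pure_braids_def set_mult_def Inn_def)
  note aut = inner_aut[OF g] pure_braids_aut[OF \<beta>]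
  have "inner (free_group n) g \<in> conj_auts n"
    using aut g inner_apply[OF g] by (auto simp: conj_auts_def)
  moreover have "\<beta> \<in> conj_auts n" using \<beta> pure_braids_eq_Int by blast
  ultimately have "\<phi> \<in> conj_auts n" unfolding \<phi> by (rule subgroup.m_closed[OF conj_auts_subgroup])
  moreover have "\<phi> (boundary n) = cj g (boundary n)"
    using aut_mult_apply[OF aut boundary_closed] inner_apply[OF g boundary_closed] \<beta> by (simp add: \<phi> pure_braids_iff)
  ultimately show "\<phi> \<in> conj_auts n \<and> (\<exists>w\<in>carrier (free_group n). \<phi> (boundary n) = cj w (boundary n))"
    using g by blast
next
  assume \<phi>: "\<phi> \<in> conj_auts n \<and> (\<exists>w\<in>carrier (free_group n). \<phi> (boundary n) = cj w (boundary n))"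
  then obtain w where w: "w \<in> carrier (free_group n)" "\<phi> (boundary n) = cj w (boundary n)" by blast
  have aut: "\<phi> \<in> carrier (Aut_free n)" using \<phi> by (simp add: conj_auts_def)
  define \<beta> where "\<beta> = inner (free_group n) (winv w) \<otimes>\<^bsub>Aut_free n\<^esub> \<phi>"
  have \<beta>: "\<beta> \<in> pure_braids n" unfolding \<beta>_def using \<phi> w by (intro inner_correction) auto
  have "\<phi> = inner (free_group n) w \<otimes>\<^bsub>Aut_free n\<^esub> \<beta>"
    unfolding \<beta>_def inner_inv[OF w(1)] using aut inner_aut[OF w(1)] by simp
  then show "\<phi> \<in> Inn_pure_braids n"
    using \<beta> w unfolding Inn_pure_braids_def set_mult_def Inn_def by blast
qed

lemma Inn_pure_braids_subgroup: "subgroup (Inn_pure_braids n) (Aut_free n)"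
proof -
  have "Inn_pure_braids n = conj_auts n \<inter>
      {\<phi> \<in> carrier (Aut_free n). \<exists>w\<in>carrier (free_group n). \<phi> (boundary n) = cj w (boundary n)}"
    using Inn_pure_braids_iff by (auto simp: conj_auts_def)
  then show ?thesis
    using Aut.subgroups_Inter_pair[OF conj_auts_subgroup conj_class_subgroup[OF boundary_closed]] by simp
qed

lemma Inn_pure_braids_IA: "Inn_pure_braids n \<subseteq> IA n"
  using Inn_pure_braids_iff conj_auts_IA by blast

lemma inner_Inn_pure_braids:
  assumes "g \<in> carrier (free_group n)"
  shows "inner (free_group n) g \<in> Inn_pure_braids n"
  unfolding Inn_pure_braids_iff
  using inner_aut[OF assms] inner_apply[OF assms] assms boundary_closed by (auto simp: conj_auts_def)

lemma pure_braids_Inn_pure_braids: "pure_braids n \<subseteq> Inn_pure_braids n"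
proof
  fix \<beta> assume \<beta>: "\<beta> \<in> pure_braids n"
  then have "\<beta> (boundary n) = cj [] (boundary n)"
    using boundary_closed[of n] by (simp add: pure_braids_iff free_group_reduced)
  then show "\<beta> \<in> Inn_pure_braids n"
    using \<beta> Nil_closed[of n] pure_braids_eq_Int unfolding Inn_pure_braids_iff by blast
qed

text \<open>As x_{n+1} = \<partial>_n^-1 \<partial>_{n+1}, the elements x_1, ..., x_n,
  \<partial>_{n+1} form a basis. The resulting automorphism transports both centralizer statements
  from the last generator to the boundary.\<close>

lemma boundary_basis:
  obtains \<tau> where "\<tau> \<in> carrier (Aut_free (Suc n))" "\<tau> (gen (Suc n)) = boundary (Suc n)"
proof -
  let ?C = "carrier (free_group (Suc n))"
  let ?t = "\<lambda>i. if i = Suc n then boundary (Suc n) else gen i"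
  let ?t' = "\<lambda>i. if i = Suc n then winv (boundary n) \<star> gen (Suc n) else gen i"
  have b: "boundary n \<in> ?C" using boundary_closed free_group_Suc by blast
  have t: "?t i \<in> ?C" if "i \<in> {1..Suc n}" for i using that boundary_closed by simp
  have t': "?t' i \<in> ?C" if "i \<in> {1..Suc n}" for i using that b by simp
  have f: "lift (Suc n) (Suc n) ?t \<in> whom (Suc n) (Suc n)" using t by (rule lift_whom)
  have f': "lift (Suc n) (Suc n) ?t' \<in> whom (Suc n) (Suc n)" using t' by (rule lift_whom)
  have g1: "lift (Suc n) (Suc n) ?t (gen i) = ?t i" if "i \<in> {1..Suc n}" for i
    using t that by (rule lift_gen)
  have g2: "lift (Suc n) (Suc n) ?t' (gen i) = ?t' i" if "i \<in> {1..Suc n}" for i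
    using t' that by (rule lift_gen)
  note g = g1 g2
  have fb: "lift (Suc n) (Suc n) ?t (boundary n) = boundary n" "lift (Suc n) (Suc n) ?t' (boundary n) = boundary n"
    using whom_boundary_fix[OF f, of 0 n] whom_boundary_fix[OF f', of 0 n] whom_Nil[OF f] whom_Nil[OF f'] g by auto
  have "lift (Suc n) (Suc n) ?t \<in> carrier (Aut_free (Suc n))"
  proof (rule lift_aut[of _ _ ?t'])
    fix i assume i: "i \<in> {1..Suc n}"
    show "?t i \<in> ?C" "?t' i \<in> ?C" using t[OF i] t'[OF i] .
    show "lift (Suc n) (Suc n) ?t (?t' i) = gen i"
      using g(1)[OF i] whom_wmult[OF f winv_closed[OF b], of "gen (Suc n)"] whom_winv[OF f b] fb b
      by (auto simp: boundary_Suc free_group_reduced)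
    show "lift (Suc n) (Suc n) ?t' (?t i) = gen i"
      using g(2)[OF i] whom_wmult[OF f' b, of "gen (Suc n)"] fb b
      by (auto simp: boundary_Suc free_group_reduced)
  qed
  then show ?thesis using that g(1)[of "Suc n"] by simp
qed

lemma centralizer_boundary_mod_lcs:
  assumes n: "n \<ge> 1" and w: "w \<in> carrier (free_group n)"
    and c: "comm (free_group n) w (boundary n) \<in> lcs (free_group n) (Suc j)"
  shows "\<exists>e :: int. w \<star> boundary n [^]\<^bsub>free_group n\<^esub> e \<in> lcs (free_group n) j"
proof -
  let ?F = "free_group n"
  obtain \<tau> where \<tau>: "\<tau> \<in> carrier (Aut_free n)" "\<tau> (gen n) = boundary n"
    using boundary_basis[of "n - 1"] n by auto
  let ?i = "inv\<^bsub>Aut_free n\<^esub> \<tau>"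
  have iaut: "?i \<in> carrier (Aut_free n)" using \<tau> by simp
  interpret t: group_hom ?F ?F \<tau> by (rule group_hom_whom[OF aut_whom[OF \<tau>(1)]])
  interpret i: group_hom ?F ?F ?i by (rule group_hom_whom[OF aut_whom[OF iaut]])
  have x: "gen n \<in> carrier ?F" using n by simp
  have iw: "?i w \<in> carrier ?F" using w by simp
  have ib: "?i (boundary n) = gen n" by (rule aut_inv_eqI[OF \<tau> x])
  have "comm ?F (?i w) (gen n) \<in> lcs ?F (Suc j)"
    using whom_lcs[OF aut_whom[OF iaut] c] i.hom_comm[OF w boundary_closed] ib by simp
  then obtain e :: int where e: "?i w \<star> gen n [^]\<^bsub>?F\<^esub> e \<in> lcs ?F j"
    using centralizer_gen_mod_lcs[OF iw, of n j] n by auto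
  have "\<tau> (?i w \<star> gen n [^]\<^bsub>?F\<^esub> e) = w \<star> boundary n [^]\<^bsub>?F\<^esub> e"
    using t.hom_mult[OF iw F.int_pow_closed[OF x, of e]] t.hom_int_pow[OF x] aut_inv_apply(2)[OF \<tau>(1) w] \<tau>(2) by simp
  then show ?thesis using whom_lcs[OF aut_whom[OF \<tau>(1)] e] by auto
qed

lemma cj_int_pow_self:
  assumes "x \<in> carrier (free_group n)"
  shows "cj (x [^]\<^bsub>free_group n\<^esub> (e :: int)) x = x"
proof -
  have p: "x [^]\<^bsub>free_group n\<^esub> e \<in> carrier (free_group n)" using assms by simp
  note r = free_group_reduced[OF p] free_group_reduced[OF assms]
  have "x [^]\<^bsub>free_group n\<^esub> e \<star> x = x \<star> x [^]\<^bsub>free_group n\<^esub> e"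
    using F.int_pow_mult[OF assms, of e 1] F.int_pow_mult[OF assms, of 1 e] assms by (simp add: add.commute)
  then have "cj (x [^]\<^bsub>free_group n\<^esub> e) x = (x \<star> x [^]\<^bsub>free_group n\<^esub> e) \<star> winv (x [^]\<^bsub>free_group n\<^esub> e)"
    using r wmult_assoc[of x "winv (x [^]\<^bsub>free_group n\<^esub> e)" "x [^]\<^bsub>free_group n\<^esub> e"]
    by (simp add: cj_def)
  then show ?thesis using r by simp
qed

theorem Inn_pure_braids_andreadakis:
  assumes n: "n \<ge> 1" and j: "j \<ge> 1"
  shows "Inn_pure_braids n \<inter> andreadakis n j \<subseteq> lower_central (Aut_free n) (Inn_pure_braids n) j"
proof
  let ?F = "free_group n" and ?A = "Aut_free n" and ?L = "lower_central (Aut_free n) (Inn_pure_braids n) j"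
  note K = Inn_pure_braids_subgroup
  fix \<phi> assume \<phi>: "\<phi> \<in> Inn_pure_braids n \<inter> andreadakis n j"
  have aut: "\<phi> \<in> carrier ?A" using \<phi> subgroup.mem_carrier[OF K] by blast
  note b = boundary_closed[of n]
  obtain w where w: "w \<in> carrier ?F" "\<phi> (boundary n) = cj w (boundary n)" using \<phi> Inn_pure_braids_iff by blast
  have "modeq ?F (lcs ?F (1 + j)) (\<phi> (boundary n)) (boundary n)"
    using \<phi> b by (intro andreadakisD) auto
  then have "comm ?F w (boundary n) \<in> lcs ?F (Suc j)"
    unfolding modeq_def w(2) conj_eq_comm_free[OF w(1) b] by simp
  then obtain e :: int where e: "w \<star> boundary n [^]\<^bsub>?F\<^esub> e \<in> lcs ?F j"
    using centralizer_boundary_mod_lcs[OF n w(1)] by blast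
  \<comment> \<open>Powers of \<partial>_n commute with it, so \<open>v\<close> conjugates
    \<partial>_n to the same element as \<open>w\<close> but lies in Gamma_j. Its inner automorphism
    is then deep both in the lower central series and in the filtration, and can be divided
    out.\<close>
  define v where "v = w \<star> boundary n [^]\<^bsub>?F\<^esub> e"
  have p: "boundary n [^]\<^bsub>?F\<^esub> e \<in> carrier ?F" using b by simp
  have v: "v \<in> carrier ?F" using w p by (simp add: v_def)
  have \<phi>b: "\<phi> (boundary n) = cj v (boundary n)"
    using w cj_int_pow_self[OF b, of e]
      cj_cj[OF free_group_reduced[OF w(1)] free_group_reduced[OF p] reduced_boundary[of n]]
    by (simp add: v_def)
  have "inner ?F ` lcs ?F j \<subseteq> ?L"
    using inner_Inn_pure_braids by (intro group_hom.lower_central_image[OF group_hom_inner] F.subgroup_self K) auto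
  then have iL: "inner ?F v \<in> ?L" using e unfolding v_def by blast
  then have iA: "inner ?F v \<in> andreadakis n j"
    using lower_central_subset_andreadakis[OF K Inn_pure_braids_IA j] by blast
  define \<beta> where "\<beta> = inv\<^bsub>?A\<^esub> (inner ?F v) \<otimes>\<^bsub>?A\<^esub> \<phi>"
  have "\<beta> \<in> Inn_pure_braids n"
    unfolding \<beta>_def using \<phi> inner_Inn_pure_braids[OF v] subgroup.m_closed[OF K] subgroup.m_inv_closed[OF K] by blast
  moreover have "\<beta> (boundary n) = boundary n"
  proof -
    have v': "winv v \<in> carrier ?F" using v by simp
    show ?thesis
      unfolding \<beta>_def inner_inv[OF v, symmetric] aut_mult_apply[OF inner_aut[OF v'] aut b] \<phi>b
        inner_apply[OF v' cj_closed[OF v b]]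
      using v b by (simp add: free_group_reduced)
  qed
  ultimately have \<beta>P: "\<beta> \<in> pure_braids n"
    unfolding Inn_pure_braids_iff by (auto simp: pure_braids_iff conj_auts_def)
  have "\<beta> \<in> andreadakis n j"
    unfolding \<beta>_def using iA \<phi> subgroup.m_closed[OF andreadakis_subgroup] subgroup.m_inv_closed[OF andreadakis_subgroup] by blast
  then have "\<beta> \<in> lower_central ?A (pure_braids n) j" using \<beta>P pure_braids_andreadakis[OF j] by blast
  then have "\<beta> \<in> ?L" using Aut.lower_central_mono[OF pure_braids_subgroup K pure_braids_Inn_pure_braids] by blast
  moreover have "\<phi> = inner ?F v \<otimes>\<^bsub>?A\<^esub> \<beta>" unfolding \<beta>_def using aut inner_aut[OF v] by simp
  ultimately show "\<phi> \<in> ?L" using iL subgroup.m_closed[OF Aut.lower_central_subgroup[OF K]] by simp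
qed

theorem Inn_pure_braids_andreadakis_equality:
  assumes n: "n \<ge> 1"
  shows "andreadakis_equality n (Inn_pure_braids n)"
proof -
  note K = Inn_pure_braids_subgroup[of n] and KI = Inn_pure_braids_IA[of n]
  have comm_K: "comm (Aut_free n) h k \<in> Inn_pure_braids n" if "h \<in> Inn_pure_braids n" "k \<in> Inn_pure_braids n" for h k
    using that by (simp add: comm_def subgroup.m_closed[OF K] subgroup.m_inv_closed[OF K])
  have "lower_central (Aut_free n) (Inn_pure_braids n) j = Inn_pure_braids n \<inter> lower_central (Aut_free n) (IA n) j \<and>
      Inn_pure_braids n \<inter> lower_central (Aut_free n) (IA n) j = Inn_pure_braids n \<inter> andreadakis n j"
    if j: "j \<ge> 1" for j
  proof -
    have "lower_central (Aut_free n) (Inn_pure_braids n) j \<subseteq> Inn_pure_braids n"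
      using j
    proof (induction j rule: dec_induct)
      case (step j)
      have "{comm (Aut_free n) h k | h k. h \<in> Inn_pure_braids n \<and> k \<in> lower_central (Aut_free n) (Inn_pure_braids n) j}
          \<subseteq> Inn_pure_braids n"
        using step comm_K by blast
      then show ?case
        using step by (simp add: lower_central_Suc commutator_subgroup_comm Aut.generate_subgroup_incl K)
    qed simp
    then show ?thesis
      using Aut.lower_central_mono[OF K IA_subgroup KI, of j] lower_central_IA_subset[OF j, of n]
        Inn_pure_braids_andreadakis[OF n j] by blast
  qed
  then show ?thesis using K KI by (simp add: andreadakis_equality_def)
qed


section \<open>Magnus' isomorphism\<close>

lemma free_group_boundary_Suc: "boundary n \<in> carrier (free_group (Suc n))"
  using boundary_closed by (rule free_group_Suc)

text \<open>Gluing a disc to the boundary: the quotient by the normal closure of \<partial>_{n+1},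
  identified with F_n, where x_{n+1} becomes \<partial>_n^-1.\<close>

definition cap :: "nat \<Rightarrow> word \<Rightarrow> word"
  where "cap n = lift (Suc n) n (\<lambda>i. if i = Suc n then winv (boundary n) else gen i)"

lemma
  shows cap_whom: "cap n \<in> whom (Suc n) n"
    and cap_gen: "i \<in> {1..n} \<Longrightarrow> cap n (gen i) = gen i"
    and cap_last: "cap n (gen (Suc n)) = winv (boundary n)"
proof -
  have t: "(if i = Suc n then winv (boundary n) else gen i) \<in> carrier (free_group n)" if "i \<in> {1..Suc n}" for i
    using that boundary_closed by simp
  show "cap n \<in> whom (Suc n) n" unfolding cap_def using t by (rule lift_whom)
  have g: "cap n (gen i) = (if i = Suc n then winv (boundary n) else gen i)" if "i \<in> {1..Suc n}" for i
    unfolding cap_def using t that by (rule lift_gen)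
  show "i \<in> {1..n} \<Longrightarrow> cap n (gen i) = gen i" "cap n (gen (Suc n)) = winv (boundary n)"
    using g by auto
qed

lemma cap_low: "w \<in> carrier (free_group n) \<Longrightarrow> cap n w = w"
  by (rule whom_eqI[OF whom_compose[OF whom_id cap_whom] whom_id]) (auto simp: cap_gen)

lemma cap_boundary: "cap n (boundary (Suc n)) = []"
  using whom_wmult[OF cap_whom free_group_boundary_Suc, of "gen (Suc n)"] cap_low[OF boundary_closed] cap_last
  by (simp add: boundary_Suc)

lemma gen_last_eq: "gen (Suc n) = winv (boundary n) \<star> boundary (Suc n)"
  by (simp add: boundary_Suc)

text \<open>The induced action in closed form; \<open>induced_action_eq\<close> shows that it is the
  one selected by the description on cosets.\<close>

definition capped :: "nat \<Rightarrow> (word \<Rightarrow> word) \<Rightarrow> word \<Rightarrow> word"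
  where "capped n \<beta> = (\<lambda>w\<in>carrier (free_group n). cap n (\<beta> w))"

lemma capped_apply: "w \<in> carrier (free_group n) \<Longrightarrow> capped n \<beta> w = cap n (\<beta> w)"
  by (simp add: capped_def)

lemma capped_whom:
  assumes "\<beta> \<in> carrier (Aut_free (Suc n))"
  shows "capped n \<beta> \<in> whom n n"
  unfolding capped_def
  by (rule whom_restrict[OF whom_compose[OF whom_compose[OF whom_id aut_whom[OF assms]] cap_whom]]) simp

text \<open>A pure braid fixes \<partial>_{n+1} and so respects the kernel of \<open>cap\<close>.
  Among the generators only x_{n+1} needs an argument, through x_{n+1} = \<partial>_n^-1
  \<partial>_{n+1}.\<close>

lemma cap_pure:
  assumes \<beta>: "\<beta> \<in> pure_braids (Suc n)" and v: "v \<in> carrier (free_group (Suc n))"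
  shows "cap n (\<beta> v) = capped n \<beta> (cap n v)"
proof -
  have aut: "\<beta> \<in> carrier (Aut_free (Suc n))" using \<beta> by (rule pure_braids_aut)
  note c = capped_whom[OF aut] and b = aut_whom[OF aut]
  show ?thesis
  proof (rule whom_eqI[OF whom_compose[OF b cap_whom] whom_compose[OF cap_whom c] _ v])
    fix i assume i: "i \<in> {1..Suc n}"
    show "cap n (\<beta> (gen i)) = capped n \<beta> (cap n (gen i))"
    proof (cases "i = Suc n")
      case True
      have bb: "\<beta> (boundary n) \<in> carrier (free_group (Suc n))"
        using whom_closed[OF b free_group_boundary_Suc] .
      have "\<beta> (gen (Suc n)) = winv (\<beta> (boundary n)) \<star> boundary (Suc n)"
        using whom_wmult[OF b winv_closed[OF free_group_boundary_Suc] boundary_closed]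
          whom_winv[OF b free_group_boundary_Suc] \<beta> by (simp add: gen_last_eq pure_braids_iff)
      then have "cap n (\<beta> (gen (Suc n))) = winv (cap n (\<beta> (boundary n)))"
        using whom_wmult[OF cap_whom winv_closed[OF bb] boundary_closed] whom_winv[OF cap_whom bb] cap_boundary
          free_group_reduced[OF whom_closed[OF cap_whom bb]] by simp
      also have "\<dots> = capped n \<beta> (winv (boundary n))"
        using whom_winv[OF c boundary_closed] capped_apply[OF boundary_closed] by simp
      finally show ?thesis using True cap_last by simp
    next
      case False
      then have "i \<in> {1..n}" using i by auto
      then show ?thesis using cap_gen capped_apply[of "gen i" n] by simp
    qed
  qed
qed

lemma capped_one: "w \<in> carrier (free_group n) \<Longrightarrow> capped n \<one>\<^bsub>Aut_free (Suc n)\<^esub> w = w"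
  using aut_one_apply[OF free_group_Suc] cap_low by (simp add: capped_apply)

lemma capped_mult_apply:
  assumes \<alpha>: "\<alpha> \<in> pure_braids (Suc n)" and \<beta>: "\<beta> \<in> pure_braids (Suc n)" and w: "w \<in> carrier (free_group n)"
  shows "capped n (\<alpha> \<otimes>\<^bsub>Aut_free (Suc n)\<^esub> \<beta>) w = capped n \<alpha> (capped n \<beta> w)"
proof -
  note aut = pure_braids_aut[OF \<alpha>] pure_braids_aut[OF \<beta>]
  have "\<beta> w \<in> carrier (free_group (Suc n))" using whom_closed[OF aut_whom[OF aut(2)] free_group_Suc[OF w]] .
  then show ?thesis
    using aut_mult_apply[OF aut free_group_Suc[OF w]] cap_pure[OF \<alpha>] w by (simp add: capped_apply)
qed

lemma capped_aut:
  assumes \<beta>: "\<beta> \<in> pure_braids (Suc n)"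
  shows "capped n \<beta> \<in> carrier (Aut_free n)"
proof -
  let ?i = "inv\<^bsub>Aut_free (Suc n)\<^esub> \<beta>"
  have aut: "\<beta> \<in> carrier (Aut_free (Suc n))" using \<beta> by (rule pure_braids_aut)
  have i: "?i \<in> pure_braids (Suc n)" using subgroup.m_inv_closed[OF pure_braids_subgroup \<beta>] .
  have 1: "capped n \<beta> (capped n ?i w) = w" "capped n ?i (capped n \<beta> w) = w" if "w \<in> carrier (free_group n)" for w
    using capped_mult_apply[OF \<beta> i that] capped_mult_apply[OF i \<beta> that] capped_one[OF that] aut by simp_all
  have "bij_betw (capped n \<beta>) (carrier (free_group n)) (carrier (free_group n))"
    by (rule bij_betw_byWitness[of _ "capped n ?i"])
      (use 1 whom_closed[OF capped_whom[OF aut]] whom_closed[OF capped_whom[OF pure_braids_aut[OF i]]] in auto)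
  moreover have "capped n \<beta> \<in> extensional (carrier (free_group n))" by (simp add: capped_def)
  ultimately show ?thesis using capped_whom[OF aut] by (simp add: aut_iff)
qed

lemma capped_mult:
  assumes "\<alpha> \<in> pure_braids (Suc n)" "\<beta> \<in> pure_braids (Suc n)"
  shows "capped n (\<alpha> \<otimes>\<^bsub>Aut_free (Suc n)\<^esub> \<beta>) = capped n \<alpha> \<otimes>\<^bsub>Aut_free n\<^esub> capped n \<beta>"
proof (rule aut_eqI)
  fix i assume "i \<in> {1..n}"
  then have g: "gen i \<in> carrier (free_group n)" by simp
  show "capped n (\<alpha> \<otimes>\<^bsub>Aut_free (Suc n)\<^esub> \<beta>) (gen i) = (capped n \<alpha> \<otimes>\<^bsub>Aut_free n\<^esub> capped n \<beta>) (gen i)"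
    using capped_mult_apply[OF assms g] aut_mult_apply[OF capped_aut[OF assms(1)] capped_aut[OF assms(2)] g] by simp
qed (use assms capped_aut subgroup.m_closed[OF pure_braids_subgroup] in auto)

lemma (in group) normal_closure_normal:
  assumes "S \<subseteq> carrier G"
  shows "normal_closure G S \<lhd> G" "S \<subseteq> normal_closure G S"
proof -
  have car: "carrier G \<lhd> G" by (rule normal_invI) (auto simp: subgroup_self)
  show "normal_closure G S \<lhd> G"
  proof (rule normal_invI)
    show "subgroup (normal_closure G S) G"
      unfolding normal_closure_def
    proof (rule subgroups_Inter)
      fix H assume "H \<in> {N. N \<lhd> G \<and> S \<subseteq> N}"
      then show "subgroup H G" by (simp add: normal_imp_subgroup)
    qed (use car assms in blast)
    fix x h assume x: "x \<in> carrier G" and h: "h \<in> normal_closure G S"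
    have "x \<otimes> h \<otimes> inv x \<in> N" if "N \<lhd> G" "S \<subseteq> N" for N
      using that h by (intro normal.inv_op_closed2[OF that(1) x]) (auto simp: normal_closure_def)
    then show "x \<otimes> h \<otimes> inv x \<in> normal_closure G S" by (simp add: normal_closure_def)
  qed
  show "S \<subseteq> normal_closure G S" by (auto simp: normal_closure_def)
qed

text \<open>The normal closure is the kernel of \<open>cap\<close>. One inclusion is minimality; for
  the other, every element is congruent to its own capping, which on x_{n+1} reduces to x_{n+1}
  \<partial>_n being a conjugate of \<partial>_{n+1}.\<close>

lemma normal_closure_boundary:
  fixes n
  defines "N \<equiv> normal_closure (free_group (Suc n)) {boundary (Suc n)}"
  assumes v: "v \<in> carrier (free_group (Suc n))" and w: "w \<in> carrier (free_group (Suc n))"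
  shows "N #>\<^bsub>free_group (Suc n)\<^esub> v = N #>\<^bsub>free_group (Suc n)\<^esub> w \<longleftrightarrow> cap n v = cap n w"
proof -
  let ?F = "free_group (Suc n)"
  have N: "N \<lhd> ?F" "boundary (Suc n) \<in> N"
    unfolding N_def using F.normal_closure_normal[of "{boundary (Suc n)}" "Suc n"] boundary_closed by auto
  interpret N: normal N ?F by (rule N(1))
  interpret c: group_hom ?F "free_group n" "cap n" by (rule group_hom_whom[OF cap_whom])
  have "kernel ?F (free_group n) (cap n) \<lhd> ?F" by (rule c.normal_kernel)
  moreover have "boundary (Suc n) \<in> kernel ?F (free_group n) (cap n)"
    using cap_boundary boundary_closed by (simp add: kernel_def)
  ultimately have "N \<subseteq> kernel ?F (free_group n) (cap n)"
    unfolding N_def normal_closure_def by blast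
  then have ker: "cap n x = []" if "x \<in> N" for x using that by (auto simp: kernel_def)
  have mod: "modeq ?F N x (cap n x)" if x: "x \<in> carrier ?F" for x
  proof -
    let ?E = "{x \<in> carrier ?F. modeq ?F N x (cap n x)}"
    have ci: "group_hom ?F ?F (cap n)" by (rule group_hom_whom[OF whom_compose[OF cap_whom whom_id]]) simp
    have id: "group_hom ?F ?F (\<lambda>x. x)" by (rule group_hom_whom) (rule whom_id, simp)
    have sg: "subgroup ?E ?F" by (rule equalizer_subgroup[OF id ci N(1)])
    have "gen ` {1..Suc n} \<subseteq> ?E"
    proof
      fix y assume "y \<in> gen ` {1..Suc n}"
      then obtain i where i: "i \<in> {1..Suc n}" "y = gen i" by blast
      have y: "y \<in> carrier ?F" using i by simp
      show "y \<in> ?E"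
      proof (cases "i = Suc n")
        case True
        have b: "boundary n \<in> carrier ?F" by (rule free_group_boundary_Suc)
        have "y \<otimes>\<^bsub>?F\<^esub> inv\<^bsub>?F\<^esub> (cap n y) = inv\<^bsub>?F\<^esub> (boundary n) \<otimes>\<^bsub>?F\<^esub> boundary (Suc n) \<otimes>\<^bsub>?F\<^esub> boundary n"
          using True i b by (simp add: inv_free_group cap_last boundary_Suc)
        also have "\<dots> \<in> N" using N.inv_op_closed1[OF b N(2)] .
        finally show ?thesis using y by (simp add: modeq_def)
      next
        case False
        then have "cap n y = y" using i cap_gen[of i n] by auto
        then show ?thesis using y F.modeq_refl[OF N.subgroup_axioms y] by simp
      qed
    qed
    then have "generate ?F (gen ` {1..Suc n}) \<subseteq> ?E" by (rule F.generate_subgroup_incl[OF _ sg])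
    then have "carrier ?F \<subseteq> ?E" by (simp only: generate_gens)
    then show ?thesis using x by blast
  qed
  have cc: "cap n v \<in> carrier ?F" "cap n w \<in> carrier ?F"
    using whom_closed[OF cap_whom v] whom_closed[OF cap_whom w] free_group_Suc by auto
  have "modeq ?F N v w \<longleftrightarrow> cap n v = cap n w"
  proof
    assume "modeq ?F N v w"
    then have "cap n (v \<otimes>\<^bsub>?F\<^esub> inv\<^bsub>?F\<^esub> w) = []" unfolding modeq_def by (rule ker)
    then have "cap n v \<otimes>\<^bsub>free_group n\<^esub> inv\<^bsub>free_group n\<^esub> (cap n w) = \<one>\<^bsub>free_group n\<^esub>"
      using c.hom_mult[OF v F.inv_closed[OF w]] c.hom_inv[OF w] by simp
    then have "inv\<^bsub>free_group n\<^esub> (inv\<^bsub>free_group n\<^esub> (cap n w)) = cap n v"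
      using whom_closed[OF cap_whom v] whom_closed[OF cap_whom w] by (intro F.inv_equality) auto
    then show "cap n v = cap n w" using whom_closed[OF cap_whom w] by simp
  next
    assume eq: "cap n v = cap n w"
    have "modeq ?F N (cap n v) w"
      unfolding eq using F.modeq_sym[OF N.subgroup_axioms w cc(2) mod[OF w]] .
    then show "modeq ?F N v w"
      by (rule F.modeq_trans[OF N.subgroup_axioms v cc(1) w mod[OF v]])
  qed
  then show ?thesis using F.rcoset_eq_iff[OF N(1) v w] by simp
qed

lemma induced_action_eq:
  assumes \<beta>: "\<beta> \<in> pure_braids (Suc n)"
  shows "induced_action n \<beta> = capped n \<beta>"
proof -
  note b = aut_whom[OF pure_braids_aut[OF \<beta>]]
  have iff: "normal_closure (free_group (Suc n)) {boundary (Suc n)} #>\<^bsub>free_group (Suc n)\<^esub> \<phi> w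
        = normal_closure (free_group (Suc n)) {boundary (Suc n)} #>\<^bsub>free_group (Suc n)\<^esub> \<beta> w
      \<longleftrightarrow> \<phi> w = capped n \<beta> w"
    if \<phi>: "\<phi> \<in> carrier (Aut_free n)" and w: "w \<in> carrier (free_group n)" for \<phi> w
  proof -
    have pw: "\<phi> w \<in> carrier (free_group n)" using whom_closed[OF aut_whom[OF \<phi>] w] .
    show ?thesis
      using normal_closure_boundary[OF free_group_Suc[OF pw] whom_closed[OF b free_group_Suc[OF w]]] cap_low[OF pw]
      by (simp add: capped_apply[OF w])
  qed
  show ?thesis
    unfolding induced_action_def Let_def
  proof (rule the_equality)
    fix \<phi>
    assume \<phi>: "\<phi> \<in> carrier (Aut_free n) \<and> (\<forall>w\<in>carrier (free_group n).
      normal_closure (free_group (Suc n)) {boundary (Suc n)} #>\<^bsub>free_group (Suc n)\<^esub> \<phi> w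
        = normal_closure (free_group (Suc n)) {boundary (Suc n)} #>\<^bsub>free_group (Suc n)\<^esub> \<beta> w)"
    show "\<phi> = capped n \<beta>"
    proof (rule aut_eqI[OF _ capped_aut[OF \<beta>]])
      fix i assume "i \<in> {1..n}"
      then have "gen i \<in> carrier (free_group n)" by simp
      then show "\<phi> (gen i) = capped n \<beta> (gen i)" using iff[of \<phi> "gen i"] \<phi> by blast
    qed (use \<phi> in blast)
  qed (use iff[OF capped_aut[OF \<beta>]] capped_aut[OF \<beta>] in blast)
qed

lemma capped_Inn_pure_braids:
  assumes \<beta>: "\<beta> \<in> pure_braids (Suc n)"
  shows "capped n \<beta> \<in> Inn_pure_braids n"
proof -
  note b = aut_whom[OF pure_braids_aut[OF \<beta>]]
  have "\<exists>w\<in>carrier (free_group n). capped n \<beta> (gen i) = cj w (gen i)" if i: "i \<in> {1..n}" for i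
  proof -
    have i': "i \<in> {1..Suc n}" using i by auto
    then have g: "gen i \<in> carrier (free_group (Suc n))" by simp
    obtain w where w: "w \<in> carrier (free_group (Suc n))" "\<beta> (gen i) = cj w (gen i)" using \<beta> i' by (rule pure_braidsE)
    have "capped n \<beta> (gen i) = cj (cap n w) (gen i)"
      using i capped_apply[of "gen i" n \<beta>] w whom_cj[OF cap_whom w(1) g] cap_gen[OF i] by simp
    then show ?thesis using whom_closed[OF cap_whom w(1)] by blast
  qed
  \<comment> \<open>After capping, \<partial>_n^-1 is the image of x_{n+1}, which \<beta> sends to a
    conjugate.\<close>
  moreover have "\<exists>w\<in>carrier (free_group n). capped n \<beta> (boundary n) = cj w (boundary n)"
  proof -
    have x: "gen (Suc n) \<in> carrier (free_group (Suc n))" by simp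
    obtain w where w: "w \<in> carrier (free_group (Suc n))" "\<beta> (gen (Suc n)) = cj w (gen (Suc n))"
      using \<beta> by (rule pure_braidsE[of _ _ "Suc n"]) auto
    have cw: "cap n w \<in> carrier (free_group n)" using whom_closed[OF cap_whom w(1)] .
    have "capped n \<beta> (winv (boundary n)) = cap n (\<beta> (gen (Suc n)))"
      using cap_pure[OF \<beta> x] cap_last by simp
    also have "\<dots> = cj (cap n w) (winv (boundary n))"
      using w whom_cj[OF cap_whom w(1) x] cap_last by simp
    finally have "winv (capped n \<beta> (boundary n)) = winv (cj (cap n w) (boundary n))"
      using whom_winv[OF capped_whom[OF pure_braids_aut[OF \<beta>]] boundary_closed]
        cj_winv[OF free_group_reduced[OF cw] reduced_boundary[of n]] by simp
    then have "capped n \<beta> (boundary n) = cj (cap n w) (boundary n)" by (metis winv_winv)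
    then show ?thesis using cw by blast
  qed
  ultimately show ?thesis
    using capped_aut[OF \<beta>] by (simp add: Inn_pure_braids_iff conj_auts_def)
qed

lemma capped_ext:
  assumes \<beta>: "\<beta> \<in> pure_braids n"
  shows "capped n (ext n \<beta>) = \<beta>"
proof (rule aut_eqI[OF capped_aut[OF ext_pure[OF \<beta>]] pure_braids_aut[OF \<beta>]])
  fix i assume i: "i \<in> {1..n}"
  have "\<beta> (gen i) \<in> carrier (free_group n)"
    using i by (intro whom_closed[OF aut_whom[OF pure_braids_aut[OF \<beta>]]]) simp
  then show "capped n (ext n \<beta>) (gen i) = \<beta> (gen i)"
    using i ext_gen[OF pure_braids_aut[OF \<beta>] i] cap_low by (simp add: capped_apply)
qed


section \<open>Exact centralizers and combing coordinates\<close>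

lemma centralizer_gen_power:
  assumes k: "k \<in> {1..n}" and w: "w \<in> carrier (free_group n)" and c: "cj w (gen k) = gen k"
  shows "\<exists>m :: int. w = gen k [^]\<^bsub>free_group n\<^esub> m"
proof -
  have g: "gen k \<in> carrier (free_group n)" using k by simp
  have letter: "[(k, b)] = gen k [^]\<^bsub>free_group n\<^esub> (if b then 1 else - 1 :: int)" for b
    using g F.int_pow_neg[OF g, of 1] by (simp add: inv_free_group winv_gen) (simp add: gen_def)
  obtain e b where eb: "w = replicate e (k, b)" using centralizer_gen[OF free_group_reduced[OF w] c] by blast
  have "reduced (replicate e (k, b)) \<Longrightarrow> \<exists>m :: int. replicate e (k, b) = gen k [^]\<^bsub>free_group n\<^esub> m" for e
  proof (induction e)
    case 0
    show ?case by (intro exI[of _ 0]) simp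
  next
    case (Suc e)
    then obtain m :: int where m: "replicate e (k, b) = gen k [^]\<^bsub>free_group n\<^esub> m" by (auto simp: reduced_Cons)
    have "replicate (Suc e) (k, b) = [(k, b)] \<star> replicate e (k, b)"
      using Suc.prems by (simp add: push_reduced)
    also have "\<dots> = gen k [^]\<^bsub>free_group n\<^esub> ((if b then 1 else - 1) + m)"
      unfolding m letter F.int_pow_mult[OF g] by simp
    finally show ?case by blast
  qed
  then show ?thesis using eb free_group_reduced[OF w] by blast
qed

lemma centralizer_boundary:
  assumes n: "n \<ge> 1" and w: "w \<in> carrier (free_group n)" and c: "cj w (boundary n) = boundary n"
  shows "\<exists>m :: int. w = boundary n [^]\<^bsub>free_group n\<^esub> m"
proof -
  let ?F = "free_group n"
  obtain \<tau> where \<tau>: "\<tau> \<in> carrier (Aut_free n)" "\<tau> (gen n) = boundary n"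
    using boundary_basis[of "n - 1"] n by auto
  let ?i = "inv\<^bsub>Aut_free n\<^esub> \<tau>"
  have iaut: "?i \<in> carrier (Aut_free n)" using \<tau> by simp
  interpret t: group_hom ?F ?F \<tau> by (rule group_hom_whom[OF aut_whom[OF \<tau>(1)]])
  have x: "gen n \<in> carrier ?F" using n by simp
  have iw: "?i w \<in> carrier ?F" using whom_closed[OF aut_whom[OF iaut] w] .
  have ib: "?i (boundary n) = gen n" by (rule aut_inv_eqI[OF \<tau> x])
  have "cj (?i w) (gen n) = gen n"
    using whom_cj[OF aut_whom[OF iaut] w boundary_closed] c ib by simp
  then obtain m :: int where "?i w = gen n [^]\<^bsub>?F\<^esub> m" using centralizer_gen_power[of n n, OF _ iw] n by auto
  then have "w = \<tau> (gen n [^]\<^bsub>?F\<^esub> m)" using aut_inv_apply(2)[OF \<tau>(1) w] by simp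
  also have "\<dots> = boundary n [^]\<^bsub>?F\<^esub> m" using t.hom_int_pow[OF x] \<tau>(2) by simp
  finally show ?thesis by blast
qed

lemma kill_boundary: "kill n (boundary (Suc n)) = boundary n"
  using whom_wmult[OF kill_whom free_group_boundary_Suc, of "gen (Suc n)"] kill_low[OF boundary_closed] kill_gen[of "Suc n" n]
  by (simp add: boundary_Suc)

text \<open>The combing coordinates are readable from the action: the lower braid after killing
  x_{n+1}, the loop from any conjugator of x_{n+1}. Two such conjugators differ by a power of
  x_{n+1}, which is killed.\<close>

lemma pure_braids_decompose_explicit:
  assumes \<beta>: "\<beta> \<in> pure_braids (Suc n)" and v: "v \<in> carrier (free_group (Suc n))" "\<beta> (gen (Suc n)) = cj v (gen (Suc n))"
  obtains b where "b \<in> carrier (Aut_free n)" "\<And>y. y \<in> carrier (free_group n) \<Longrightarrow> b y = kill n (\<beta> y)"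
    "\<beta> = push_hom n (winv (kill n v)) \<otimes>\<^bsub>Aut_free (Suc n)\<^esub> ext n b"
proof -
  let ?C = "carrier (free_group (Suc n))" and ?x = "gen (Suc n)"
  obtain w b where w: "w \<in> carrier (free_group n)" and b: "b \<in> pure_braids n"
    and dec: "\<beta> = push_hom n w \<otimes>\<^bsub>Aut_free (Suc n)\<^esub> ext n b"
    using \<beta> by (rule pure_braids_decompose)
  have baut: "b \<in> carrier (Aut_free n)" using b by (rule pure_braids_aut)
  have eaut: "ext n b \<in> carrier (Aut_free (Suc n))" using baut by (rule ext_aut)
  have along: "pushes_along n w (push_hom n w)" using w by (rule pushes_along_push)
  then have paut: "push_hom n w \<in> carrier (Aut_free (Suc n))" by (auto simp: pushes_along_def pure_braids_iff)
  have x: "?x \<in> ?C" by simp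
  obtain w' where w': "w' \<in> ?C" "push_hom n w ?x = cj w' ?x" "kill n w' = winv w"
    using along by (auto simp: pushes_along_def)
  have 1: "b y = kill n (\<beta> y)" if y: "y \<in> carrier (free_group n)" for y
  proof -
    have b_y: "b y \<in> carrier (free_group n)" using whom_closed[OF aut_whom[OF baut] y] .
    show ?thesis
      using aut_mult_apply[OF paut eaut free_group_Suc[OF y]] ext_low[OF baut y] along free_group_Suc[OF b_y] kill_low[OF b_y]
      by (simp add: dec pushes_along_def)
  qed
  have "cj v ?x = cj w' ?x"
    using aut_mult_apply[OF paut eaut x] ext_last[OF baut] w' v dec by simp
  then have "cj (winv w') (cj v ?x) = cj (winv w') (cj w' ?x)" by simp
  then have "cj (winv w' \<star> v) ?x = ?x" using v w' by (simp add: free_group_reduced)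
  moreover have "winv w' \<star> v \<in> ?C" using v w' by simp
  ultimately obtain m :: int where m: "winv w' \<star> v = ?x [^]\<^bsub>free_group (Suc n)\<^esub> m"
    using centralizer_gen_power[of "Suc n" "Suc n"] by auto
  interpret k: group_hom "free_group (Suc n)" "free_group n" "kill n" by (rule group_hom_whom[OF kill_whom])
  have kv: "kill n v \<in> carrier (free_group n)" using whom_closed[OF kill_whom v(1)] .
  have "kill n (winv w' \<star> v) = []"
    unfolding m k.hom_int_pow[OF x] using kill_gen[of "Suc n" n] F.int_pow_one[of n m] by simp
  then have "w \<star> kill n v = []"
    using whom_wmult[OF kill_whom winv_closed[OF w'(1)] v(1)] whom_winv[OF kill_whom w'(1)] w'(3) by simp
  then have "kill n v = winv w" using w kv by (intro winv_unique) (auto simp: free_group_reduced)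
  then show ?thesis using that[OF baut 1] dec by simp
qed

text \<open>Equality of combing coordinates; this is how \<open>capped_kernel\<close> recognises a
  pure braid as an inner automorphism.\<close>

lemma pure_braids_unique:
  assumes "\<alpha> \<in> pure_braids (Suc n)" "\<beta> \<in> pure_braids (Suc n)"
    and "u \<in> carrier (free_group (Suc n))" "\<alpha> (gen (Suc n)) = cj u (gen (Suc n))"
    and "v \<in> carrier (free_group (Suc n))" "\<beta> (gen (Suc n)) = cj v (gen (Suc n))"
    and "kill n u = kill n v" and "\<And>y. y \<in> carrier (free_group n) \<Longrightarrow> kill n (\<alpha> y) = kill n (\<beta> y)"
  shows "\<alpha> = \<beta>"
proof -
  obtain a where a: "a \<in> carrier (Aut_free n)" "\<And>y. y \<in> carrier (free_group n) \<Longrightarrow> a y = kill n (\<alpha> y)"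
    "\<alpha> = push_hom n (winv (kill n u)) \<otimes>\<^bsub>Aut_free (Suc n)\<^esub> ext n a"
    using pure_braids_decompose_explicit[OF assms(1,3,4)] by blast
  obtain b where b: "b \<in> carrier (Aut_free n)" "\<And>y. y \<in> carrier (free_group n) \<Longrightarrow> b y = kill n (\<beta> y)"
    "\<beta> = push_hom n (winv (kill n v)) \<otimes>\<^bsub>Aut_free (Suc n)\<^esub> ext n b"
    using pure_braids_decompose_explicit[OF assms(2,5,6)] by blast
  have "a = b" by (rule aut_eqI[OF a(1) b(1)]) (use a(2) b(2) assms(8) in simp)
  then show ?thesis using a(3) b(3) assms(7) by simp
qed

text \<open>
  The rotation of the sphere with marked points \<open>x\<^sub>1, \<dots>, x\<^sub>n\<^sub>+\<^sub>1\<close> and \<open>\<partial>\<^sub>n\<^sub>+\<^sub>1\<^sup>-\<^sup>1\<close>. It exchanges killing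
  the last generator with capping the boundary, which transfers what is known on the former.
\<close>

definition rot :: "nat \<Rightarrow> word \<Rightarrow> word"
  where "rot n = lift (Suc n) (Suc n) (\<lambda>i. if i = Suc n then winv (boundary (Suc n)) else gen (Suc i))"

text \<open>The cycle x_1, ..., x_{n+1}, \<partial>_{n+1}^-1 has product 1 and is shifted by one
  step, the last element returning to x_1.\<close>

lemma
  shows rot_aut: "rot n \<in> carrier (Aut_free (Suc n))"
    and rot_gen: "i \<in> {1..n} \<Longrightarrow> rot n (gen i) = gen (Suc i)"
    and rot_last: "rot n (gen (Suc n)) = winv (boundary (Suc n))"
    and rot_boundary: "rot n (boundary (Suc n)) = winv (gen 1)"
proof -
  let ?C = "carrier (free_group (Suc n))" and ?d = "boundary (Suc n)"
  let ?t = "\<lambda>i. if i = Suc n then winv ?d else gen (Suc i)"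
  let ?t' = "\<lambda>i. if i = 1 then winv ?d else gen (i - 1)"
  have t: "?t i \<in> ?C" if "i \<in> {1..Suc n}" for i using that boundary_closed by auto
  have t': "?t' i \<in> ?C" if "i \<in> {1..Suc n}" for i using that boundary_closed by auto
  have f: "rot n \<in> whom (Suc n) (Suc n)" unfolding rot_def using t by (rule lift_whom)
  have f': "lift (Suc n) (Suc n) ?t' \<in> whom (Suc n) (Suc n)" using t' by (rule lift_whom)
  have g: "rot n (gen i) = ?t i" if "i \<in> {1..Suc n}" for i
    unfolding rot_def using t that by (rule lift_gen)
  have g': "lift (Suc n) (Suc n) ?t' (gen i) = ?t' i" if "i \<in> {1..Suc n}" for i
    using t' that by (rule lift_gen)
  have bc: "boundary k \<in> ?C" if "k \<le> Suc n" for k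
    using that boundary_closed[of k] free_group_mono[of k "Suc n"] by auto
  have fb: "k \<le> n \<Longrightarrow> rot n (boundary k) = winv (gen 1) \<star> boundary (Suc k)" for k
  proof (induction k)
    case 0
    then show ?case using whom_Nil[OF f] by (simp add: boundary_Suc)
  next
    case (Suc k)
    then show ?case
      using whom_wmult[OF f bc[of k], of "gen (Suc k)"] g[of "Suc k"] by (simp add: boundary_Suc)
  qed
  have fb': "k \<le> n \<Longrightarrow> lift (Suc n) (Suc n) ?t' (boundary (Suc k)) = winv ?d \<star> boundary k" for k
  proof (induction k)
    case 0
    then show ?case using g'[of 1] by (simp add: boundary_Suc)
  next
    case (Suc k)
    then show ?case
      using whom_wmult[OF f' bc[of "Suc k"], of "gen (Suc (Suc k))"] g'[of "Suc (Suc k)"]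
      by (simp add: boundary_Suc[of "Suc k"] boundary_Suc[of k])
  qed
  show d: "rot n ?d = winv (gen 1)"
    using whom_wmult[OF f bc[of n], of "gen (Suc n)"] g[of "Suc n"] fb[of n] by (simp add: boundary_Suc[of n])
  have d': "lift (Suc n) (Suc n) ?t' ?d = winv (gen (Suc n))"
    using fb'[of n] by (simp add: boundary_Suc[of n])
  show "i \<in> {1..n} \<Longrightarrow> rot n (gen i) = gen (Suc i)" "rot n (gen (Suc n)) = winv ?d"
    using g by auto
  have "lift (Suc n) (Suc n) ?t \<in> carrier (Aut_free (Suc n))"
  proof (rule lift_aut[of _ _ ?t'])
    fix i assume i: "i \<in> {1..Suc n}"
    show "?t i \<in> ?C" "?t' i \<in> ?C" using t[OF i] t'[OF i] .
    have "rot n (?t' i) = gen i"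
    proof (cases "i = 1")
      case False
      then obtain k where "i = Suc k" "k \<in> {1..n}" using i by (cases i) auto
      then show ?thesis using g[of k] by auto
    qed (use whom_winv[OF f boundary_closed] d in simp)
    then show "lift (Suc n) (Suc n) ?t (?t' i) = gen i" by (simp add: rot_def)
    show "lift (Suc n) (Suc n) ?t' (?t i) = gen i"
      using i g'[of "Suc i"] whom_winv[OF f' boundary_closed] d' by auto
  qed
  then show "rot n \<in> carrier (Aut_free (Suc n))" by (simp add: rot_def)
qed

abbreviation rot' :: "nat \<Rightarrow> word \<Rightarrow> word"
  where "rot' n \<equiv> inv\<^bsub>Aut_free (Suc n)\<^esub> (rot n)"

lemma rot'_aut: "rot' n \<in> carrier (Aut_free (Suc n))"
  using rot_aut by simp

lemma rot'_gen: "i \<in> {1..n} \<Longrightarrow> rot' n (gen (Suc i)) = gen i"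
  by (rule aut_inv_eqI[OF rot_aut rot_gen]) auto

lemma rot'_boundary: "rot' n (winv (boundary (Suc n))) = gen (Suc n)"
  by (rule aut_inv_eqI[OF rot_aut rot_last]) simp

lemma rot'_first: "rot' n (gen 1) = winv (boundary (Suc n))"
  using whom_winv[OF aut_whom[OF rot_aut] boundary_closed] rot_boundary
  by (intro aut_inv_eqI[OF rot_aut]) (auto simp: boundary_closed)

text \<open>\<open>rot n\<close> sends x_{n+1} to \<partial>_{n+1}^-1, which capping kills, so the
  composite factors through \<open>kill n\<close>.\<close>

lemma cap_rot:
  assumes v: "v \<in> carrier (free_group (Suc n))"
  shows "cap n (rot n v) = cap n (rot n (kill n v))"
proof -
  note r = aut_whom[OF rot_aut[of n]]
  have i: "(\<lambda>w. w) \<in> whom n (Suc n)" by (rule whom_id) simp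
  show ?thesis
  proof (rule whom_eqI[OF whom_compose[OF r cap_whom] whom_compose[OF whom_compose[OF kill_whom i] whom_compose[OF r cap_whom]] _ v])
    fix i assume "i \<in> {1..Suc n}"
    then show "cap n (rot n (gen i)) = cap n (rot n (kill n (gen i)))"
      using kill_gen[of i n] rot_last[of n] whom_winv[OF cap_whom boundary_closed] cap_boundary[of n] whom_Nil[OF r] whom_Nil[OF cap_whom]
      by auto
  qed
qed

text \<open>\<open>rot' n\<close> sends \<partial>_{n+1} to x_{n+1}^-1, which is killed, so the
  composite factors through \<open>cap n\<close>.\<close>

lemma kill_rot':
  assumes v: "v \<in> carrier (free_group (Suc n))"
  shows "kill n (rot' n v) = kill n (rot' n (cap n v))"
proof -
  note r = aut_whom[OF rot'_aut[of n]]
  let ?b = "boundary n" and ?d = "boundary (Suc n)"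
  have i: "(\<lambda>w. w) \<in> whom n (Suc n)" by (rule whom_id) simp
  show ?thesis
  proof (rule whom_eqI[OF whom_compose[OF r kill_whom] whom_compose[OF whom_compose[OF cap_whom i] whom_compose[OF r kill_whom]] _ v])
    fix i assume i: "i \<in> {1..Suc n}"
    note rk = whom_compose[OF r kill_whom[of n]]
    have "winv (kill n (rot' n ?d)) = []"
      using whom_winv[OF rk boundary_closed] rot'_boundary[of n] kill_gen[of "Suc n" n] by simp
    then have "kill n (rot' n ?d) = []" by simp
    then have "kill n (rot' n (gen (Suc n))) = kill n (rot' n (winv ?b))"
      using whom_wmult[OF rk winv_closed[OF free_group_boundary_Suc] boundary_closed]
        free_group_reduced[OF whom_closed[OF rk winv_closed[OF free_group_boundary_Suc]]]
      by (simp add: gen_last_eq)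
    then show "kill n (rot' n (gen i)) = kill n (rot' n (cap n (gen i)))"
      using i cap_last[of n] cap_gen[of i n] by (cases "i = Suc n") auto
  qed
qed

text \<open>A push acts trivially after killing x_{n+1}; rotated, it acts trivially after capping
  but conjugates \<partial>_{n+1}. The inner automorphism that restores \<partial>_{n+1} survives
  capping and becomes conjugation by \<open>m\<close>.\<close>

lemma capped_inner_surj:
  assumes m: "m \<in> carrier (free_group n)"
  obtains \<beta> where "\<beta> \<in> pure_braids (Suc n)" "capped n \<beta> = inner (free_group n) m"
proof -
  let ?F = "free_group (Suc n)" and ?A = "Aut_free (Suc n)" and ?C = "carrier (free_group (Suc n))"
  let ?x = "gen (Suc n)" and ?d = "boundary (Suc n)"
  \<comment> \<open>On F_n the map \<open>cap n\<close> after \<open>rot n\<close> is inverted by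
    \<open>kill n\<close> after \<open>rot' n\<close>; the loop is the preimage of
    \<open>m\<close>.\<close>
  define w where "w = kill n (rot' n m)"
  note rw = aut_whom[OF rot_aut[of n]] and r'w = aut_whom[OF rot'_aut[of n]]
  have m': "m \<in> ?C" using m by (rule free_group_Suc)
  have w: "w \<in> carrier (free_group n)"
    unfolding w_def by (rule whom_closed[OF kill_whom whom_closed[OF r'w m']])
  define u where "u = push_hom n w"
  have along: "pushes_along n w u" unfolding u_def using w by (rule pushes_along_push)
  then have u: "u \<in> pure_braids (Suc n)" and uk: "\<And>v. v \<in> ?C \<Longrightarrow> kill n (u v) = kill n v"
    by (auto simp: pushes_along_def)
  obtain w' where w': "w' \<in> ?C" "u ?x = cj w' ?x" "kill n w' = winv w"
    using along by (auto simp: pushes_along_def)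
  have uaut: "u \<in> carrier ?A" using u by (rule pure_braids_aut)
  note uw = aut_whom[OF uaut]
  have x: "?x \<in> ?C" by simp
  define \<gamma> where "\<gamma> = rot n \<otimes>\<^bsub>?A\<^esub> u \<otimes>\<^bsub>?A\<^esub> rot' n"
  have \<gamma>aut: "\<gamma> \<in> carrier ?A" unfolding \<gamma>_def using rot_aut[of n] uaut by simp
  have \<gamma>: "\<gamma> v = rot n (u (rot' n v))" if v: "v \<in> ?C" for v
    unfolding \<gamma>_def using aut_mult_apply[OF Aut.m_closed[OF rot_aut[of n] uaut] rot'_aut[of n] v]
      aut_mult_apply[OF rot_aut[of n] uaut whom_closed[OF r'w v]] by simp
  have "\<exists>y\<in>?C. \<gamma> (gen i) = cj y (gen i)" if i: "i \<in> {1..Suc n}" for i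
  proof (cases "i = 1")
    case True
    have "\<gamma> (gen 1) = rot n (u (winv ?d))" using \<gamma>[of "gen 1"] rot'_first[of n] by simp
    also have "\<dots> = gen 1"
      using whom_winv[OF uw boundary_closed] whom_winv[OF rw boundary_closed] u rot_boundary[of n]
      by (simp add: pure_braids_iff)
    finally show ?thesis using True by (intro bexI[of _ "[]"]) auto
  next
    case False
    then obtain k where k: "i = Suc k" "k \<in> {1..n}" using i by (cases i) auto
    have g: "gen k \<in> ?C" "gen i \<in> ?C" using k i by auto
    have k': "k \<in> {1..Suc n}" using k(2) by auto
    obtain y where y: "y \<in> ?C" "u (gen k) = cj y (gen k)" using u k' by (rule pure_braidsE)
    have "\<gamma> (gen i) = cj (rot n y) (gen i)"
      using \<gamma>[OF g(2)] rot'_gen[OF k(2)] y whom_cj[OF rw y(1) g(1)] rot_gen[OF k(2)] k(1) by simp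
    then show ?thesis using whom_closed[OF rw y(1)] by blast
  qed
  then have \<gamma>c: "\<gamma> \<in> conj_auts (Suc n)" using \<gamma>aut by (simp add: conj_auts_def)
  have rw': "rot n w' \<in> ?C" using whom_closed[OF rw w'(1)] .
  have "\<gamma> (winv ?d) = cj (rot n w') (winv ?d)"
    using \<gamma>[OF winv_closed[OF boundary_closed]] rot'_boundary[of n] w' whom_cj[OF rw w'(1) x] rot_last[of n] by simp
  then have "winv (\<gamma> ?d) = winv (cj (rot n w') ?d)"
    using whom_winv[OF aut_whom[OF \<gamma>aut] boundary_closed] cj_winv[OF free_group_reduced[OF rw'] reduced_boundary] by simp
  then have \<gamma>d: "\<gamma> ?d = cj (rot n w') ?d" by (metis winv_winv)
  define \<beta> where "\<beta> = inner ?F (winv (rot n w')) \<otimes>\<^bsub>?A\<^esub> \<gamma>"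
  have \<beta>: "\<beta> \<in> pure_braids (Suc n)" unfolding \<beta>_def by (rule inner_correction[OF \<gamma>c rw' \<gamma>d])
  have "cap n (rot n w') = cap n (rot n (winv w))"
    using cap_rot[OF w'(1)] w'(3) by simp
  also have "\<dots> = winv (cap n (rot n w))"
    using whom_winv[OF whom_compose[OF rw cap_whom] free_group_Suc[OF w]] by simp
  also have "cap n (rot n w) = cap n (rot n (rot' n m))"
    unfolding w_def using cap_rot[OF whom_closed[OF r'w m']] by simp
  also have "\<dots> = m" using aut_inv_apply(2)[OF rot_aut[of n] m'] cap_low[OF m] by simp
  finally have cw: "cap n (rot n w') = winv m" .
  have "capped n \<beta> = inner (free_group n) m"
  proof (rule aut_eqI[OF capped_aut[OF \<beta>] inner_aut[OF m]])
    fix i assume i: "i \<in> {1..n}"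
    have g: "gen i \<in> carrier (free_group n)" "gen i \<in> ?C" using i by auto
    have c: "u (rot' n (gen i)) \<in> ?C" "\<gamma> (gen i) \<in> ?C"
      using whom_closed[OF uw whom_closed[OF r'w g(2)]] whom_closed[OF aut_whom[OF \<gamma>aut] g(2)] by auto
    have "cap n (\<gamma> (gen i)) = cap n (rot n (kill n (u (rot' n (gen i)))))"
      using \<gamma>[OF g(2)] cap_rot[OF c(1)] by simp
    also have "\<dots> = cap n (rot n (rot' n (gen i)))"
      using uk[OF whom_closed[OF r'w g(2)]] cap_rot[OF whom_closed[OF r'w g(2)]] by simp
    also have "\<dots> = gen i" using aut_inv_apply(2)[OF rot_aut[of n] g(2)] cap_low[OF g(1)] by simp
    finally have "cap n (\<gamma> (gen i)) = gen i" .
    moreover have "\<beta> (gen i) = cj (winv (rot n w')) (\<gamma> (gen i))"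
      unfolding \<beta>_def using aut_mult_apply[OF inner_aut[OF winv_closed[OF rw']] \<gamma>aut g(2)]
        inner_apply[OF winv_closed[OF rw'] c(2)] by simp
    ultimately have "cap n (\<beta> (gen i)) = cj m (gen i)"
      using whom_cj[OF cap_whom winv_closed[OF rw'] c(2)] whom_winv[OF cap_whom rw'] cw by simp
    then show "capped n \<beta> (gen i) = inner (free_group n) m (gen i)"
      using capped_apply[OF g(1)] inner_apply[OF m g(1)] by simp
  qed
  then show ?thesis using that \<beta> by blast
qed

text \<open>The reverse passage: rotated back, \<beta> acts trivially after killing x_{n+1} and
  fixes x_{n+1}, but conjugates \<partial>_{n+1}. Restoring \<partial>_{n+1} gives a pure braid with
  the combing coordinates of conjugation by a power of \<partial>_{n+1}.\<close>

lemma capped_kernel: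
  assumes n: "n \<ge> 1" and \<beta>: "\<beta> \<in> pure_braids (Suc n)"
    and triv: "capped n \<beta> = \<one>\<^bsub>Aut_free n\<^esub>"
  shows "\<exists>m :: int. \<beta> = inner (free_group (Suc n)) (boundary (Suc n) [^]\<^bsub>free_group (Suc n)\<^esub> m)"
proof -
  let ?F = "free_group (Suc n)" and ?A = "Aut_free (Suc n)" and ?C = "carrier (free_group (Suc n))"
  let ?x = "gen (Suc n)" and ?d = "boundary (Suc n)"
  note rw = aut_whom[OF rot_aut[of n]] and r'w = aut_whom[OF rot'_aut[of n]]
  have \<beta>aut: "\<beta> \<in> carrier ?A" using \<beta> by (rule pure_braids_aut)
  note bw = aut_whom[OF \<beta>aut]
  have cap: "cap n (\<beta> v) = cap n v" if v: "v \<in> ?C" for v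
    using cap_pure[OF \<beta> v] triv aut_one_apply[OF whom_closed[OF cap_whom v]] by simp
  have x: "?x \<in> ?C" and x1: "gen 1 \<in> ?C" by auto
  define \<delta> where "\<delta> = rot' n \<otimes>\<^bsub>?A\<^esub> \<beta> \<otimes>\<^bsub>?A\<^esub> rot n"
  have \<delta>aut: "\<delta> \<in> carrier ?A" unfolding \<delta>_def using rot_aut[of n] rot'_aut[of n] \<beta>aut by simp
  have \<delta>: "\<delta> v = rot' n (\<beta> (rot n v))" if v: "v \<in> ?C" for v
    unfolding \<delta>_def using aut_mult_apply[OF Aut.m_closed[OF rot'_aut[of n] \<beta>aut] rot_aut[of n] v]
      aut_mult_apply[OF rot'_aut[of n] \<beta>aut whom_closed[OF rw v]] by simp
  have \<delta>x: "\<delta> ?x = ?x"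
    using \<delta>[OF x] rot_last[of n] whom_winv[OF bw boundary_closed] \<beta> rot'_boundary[of n] by (simp add: pure_braids_iff)
  have "\<exists>y\<in>?C. \<delta> (gen i) = cj y (gen i)" if i: "i \<in> {1..Suc n}" for i
  proof (cases "i = Suc n")
    case True
    then show ?thesis using \<delta>x by (intro bexI[of _ "[]"]) auto
  next
    case False
    then have i': "i \<in> {1..n}" "Suc i \<in> {1..Suc n}" using i by auto
    have g: "gen i \<in> ?C" "gen (Suc i) \<in> ?C" using i i' by auto
    obtain y where y: "y \<in> ?C" "\<beta> (gen (Suc i)) = cj y (gen (Suc i))" using \<beta> i'(2) by (rule pure_braidsE)
    have "\<delta> (gen i) = cj (rot' n y) (gen i)"
      using \<delta>[OF g(1)] rot_gen[OF i'(1)] y whom_cj[OF r'w y(1) g(2)] rot'_gen[OF i'(1)] by simp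
    then show ?thesis using whom_closed[OF r'w y(1)] by blast
  qed
  then have \<delta>c: "\<delta> \<in> conj_auts (Suc n)" using \<delta>aut by (simp add: conj_auts_def)
  obtain w1 where w1: "w1 \<in> ?C" "\<beta> (gen 1) = cj w1 (gen 1)" using \<beta> by (rule pure_braidsE[of _ _ 1]) auto
  define v where "v = rot' n w1"
  have v: "v \<in> ?C" unfolding v_def using whom_closed[OF r'w w1(1)] .
  have "rot' n (winv (gen 1)) = ?d"
    using whom_winv[OF r'w x1] rot'_first[of n] by simp
  moreover have "\<delta> ?d = rot' n (winv (\<beta> (gen 1)))"
    using \<delta>[OF boundary_closed] rot_boundary[of n] whom_winv[OF bw x1] by simp
  moreover have "winv (\<beta> (gen 1)) = cj w1 (winv (gen 1))"
    using w1 cj_winv[OF free_group_reduced[OF w1(1)], of "gen 1"] by simp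
  ultimately have \<delta>d: "\<delta> ?d = cj v ?d"
    using whom_cj[OF r'w w1(1) winv_closed[OF x1]] by (simp add: v_def)
  define \<gamma> where "\<gamma> = inner ?F (winv v) \<otimes>\<^bsub>?A\<^esub> \<delta>"
  have v': "winv v \<in> ?C" using v by simp
  have \<gamma>: "\<gamma> \<in> pure_braids (Suc n)" unfolding \<gamma>_def by (rule inner_correction[OF \<delta>c v \<delta>d])
  have \<gamma>_apply: "\<gamma> y = cj (winv v) (\<delta> y)" if y: "y \<in> ?C" for y
    unfolding \<gamma>_def using aut_mult_apply[OF inner_aut[OF v'] \<delta>aut y] inner_apply[OF v' whom_closed[OF aut_whom[OF \<delta>aut] y]] by simp
  have kill_\<delta>: "kill n (\<delta> y) = kill n y" if y: "y \<in> ?C" for y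
  proof -
    have "kill n (\<delta> y) = kill n (rot' n (cap n (\<beta> (rot n y))))"
      using \<delta>[OF y] kill_rot'[OF whom_closed[OF bw whom_closed[OF rw y]]] by simp
    also have "\<dots> = kill n (rot' n (rot n y))"
      using cap[OF whom_closed[OF rw y]] kill_rot'[OF whom_closed[OF rw y]] by simp
    also have "\<dots> = kill n y" using aut_inv_apply(1)[OF rot_aut[of n] y] by simp
    finally show ?thesis .
  qed
  have kv: "kill n v \<in> carrier (free_group n)" using whom_closed[OF kill_whom v] .
  have kill_\<gamma>: "kill n (\<gamma> y) = cj (winv (kill n v)) (kill n y)" if y: "y \<in> ?C" for y
    using \<gamma>_apply[OF y] whom_cj[OF kill_whom v' whom_closed[OF aut_whom[OF \<delta>aut] y]] whom_winv[OF kill_whom v] kill_\<delta>[OF y] by simp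
  \<comment> \<open>After killing, \<gamma> is conjugation by the image of the inverse of
    \<open>v\<close> and still fixes \<partial>_n, so that image is a power of \<partial>_n. This is
    where the exponent \<open>e\<close> comes from.\<close>
  have "cj (winv (kill n v)) (boundary n) = boundary n"
    using kill_\<gamma>[OF boundary_closed] \<gamma> kill_boundary[of n] by (simp add: pure_braids_iff)
  then obtain e :: int where e: "winv (kill n v) = boundary n [^]\<^bsub>free_group n\<^esub> e"
    using centralizer_boundary[OF n winv_closed[OF kv]] by blast
  define h where "h = ?d [^]\<^bsub>?F\<^esub> e"
  have h: "h \<in> ?C" unfolding h_def using boundary_closed[of "Suc n"] by simp
  interpret k: group_hom ?F "free_group n" "kill n" by (rule group_hom_whom[OF kill_whom])
  have kh: "kill n h = winv (kill n v)"
    unfolding h_def k.hom_int_pow[OF boundary_closed] kill_boundary e ..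
  have ih: "inner ?F h \<in> pure_braids (Suc n)"
    using inner_aut[OF h] inner_apply[OF h] h boundary_closed[of "Suc n"] cj_int_pow_self[OF boundary_closed, of "Suc n" e]
    by (auto simp: pure_braids_iff h_def)
  have "\<gamma> = inner ?F h"
  proof (rule pure_braids_unique[OF \<gamma> ih v' _ h])
    show "\<gamma> ?x = cj (winv v) ?x" using \<gamma>_apply[OF x] \<delta>x by simp
    show "inner ?F h ?x = cj h ?x" using h x by (rule inner_apply)
    show "kill n (winv v) = kill n h" using whom_winv[OF kill_whom v] kh by simp
    fix y assume "y \<in> carrier (free_group n)"
    then have y: "y \<in> ?C" by (rule free_group_Suc)
    show "kill n (\<gamma> y) = kill n (inner ?F h y)"
      using kill_\<gamma>[OF y] inner_apply[OF h y] whom_cj[OF kill_whom h y] kh by simp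
  qed
  then have \<delta>_inner: "\<delta> y = cj (v \<star> h) y" if y: "y \<in> ?C" for y
  proof -
    have \<delta>y: "\<delta> y \<in> ?C" using whom_closed[OF aut_whom[OF \<delta>aut] y] .
    have "cj v (cj (winv v) (\<delta> y)) = cj v (cj h y)"
      using \<gamma>_apply[OF y] inner_apply[OF h y] \<open>\<gamma> = inner ?F h\<close> by simp
    then show ?thesis
      using cj_cj[of v "winv v" "\<delta> y"] cj_cj[of v h y] free_group_reduced[OF v] free_group_reduced[OF h]
        free_group_reduced[OF y] free_group_reduced[OF \<delta>y] by simp
  qed
  define g where "g = rot n (v \<star> h)"
  have vh: "v \<star> h \<in> ?C" using v h by simp
  have g: "g \<in> ?C" unfolding g_def using whom_closed[OF rw vh] .
  have \<beta>_inner: "\<beta> y = cj g y" if y: "y \<in> ?C" for y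
  proof -
    have r'y: "rot' n y \<in> ?C" using whom_closed[OF r'w y] .
    have "\<beta> y = rot n (\<delta> (rot' n y))"
      using \<delta>[OF r'y] aut_inv_apply(2)[OF rot_aut[of n] y] aut_inv_apply(2)[OF rot_aut[of n] whom_closed[OF bw y]] by simp
    also have "\<dots> = cj g y"
      using \<delta>_inner[OF r'y] whom_cj[OF rw vh r'y] aut_inv_apply(2)[OF rot_aut[of n] y] by (simp add: g_def)
    finally show ?thesis .
  qed
  \<comment> \<open>By now \<beta> is conjugation by \<open>g\<close>; fixing \<partial>_{n+1} puts
    \<open>g\<close> into the centralizer of \<partial>_{n+1}.\<close>
  have "cj g ?d = ?d" using \<beta>_inner[OF boundary_closed] \<beta> by (simp add: pure_braids_iff)
  then obtain m :: int where "g = ?d [^]\<^bsub>?F\<^esub> m" using centralizer_boundary[OF _ g] by auto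
  moreover have "\<beta> = inner ?F g"
    by (rule aut_eqI[OF \<beta>aut inner_aut[OF g]]) (use \<beta>_inner inner_apply[OF g] in simp)
  ultimately show ?thesis by blast
qed

text \<open>Commuting with inner automorphisms makes \<phi>(x_i) and x_i differ by a central
  element, hence by a power of x_i. As \<phi>(x_i) is a conjugate of x_i, comparing exponent sums
  shows that the power is trivial. The exponent sums also cover n = 1, where F_1 is its own
  centre.\<close>

lemma center_capped:
  assumes n: "n \<ge> 1" and \<phi>: "\<phi> \<in> conj_auts n"
    and comm: "\<And>m. m \<in> carrier (free_group n) \<Longrightarrow>
      \<phi> \<otimes>\<^bsub>Aut_free n\<^esub> inner (free_group n) m = inner (free_group n) m \<otimes>\<^bsub>Aut_free n\<^esub> \<phi>"
  shows "\<phi> = \<one>\<^bsub>Aut_free n\<^esub>"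
proof -
  let ?C = "carrier (free_group n)"
  have aut: "\<phi> \<in> carrier (Aut_free n)" using \<phi> by (simp add: conj_auts_def)
  note w = aut_whom[OF aut]
  have "\<phi> (gen i) = gen i" if i: "i \<in> {1..n}" for i
  proof -
    have x: "gen i \<in> ?C" using i by simp
    define c where "c = winv (gen i) \<star> \<phi> (gen i)"
    have px: "\<phi> (gen i) \<in> ?C" using whom_closed[OF w x] .
    have c: "c \<in> ?C" unfolding c_def using x px by simp
    have "inner (free_group n) (\<phi> (gen i)) \<otimes>\<^bsub>Aut_free n\<^esub> \<phi> = inner (free_group n) (gen i) \<otimes>\<^bsub>Aut_free n\<^esub> \<phi>"
      using conj_inner[OF aut x] comm[OF x] by simp
    then have eq: "inner (free_group n) (\<phi> (gen i)) = inner (free_group n) (gen i)"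
      using aut inner_aut[OF px] inner_aut[OF x] by (simp add: Aut.right_cancel)
    have cc: "cj c y = y" if y: "y \<in> ?C" for y
    proof -
      have "cj (winv (gen i)) (cj (\<phi> (gen i)) y) = cj (winv (gen i)) (cj (gen i) y)"
        using inner_apply[OF px y] inner_apply[OF x y] eq by simp
      then show ?thesis
        using free_group_reduced[OF px] free_group_reduced[OF y] by (simp add: c_def)
    qed
    have pow: "\<exists>m :: int. c = gen k [^]\<^bsub>free_group n\<^esub> m" if "k \<in> {1..n}" for k
      using that c cc by (intro centralizer_gen_power) auto
    obtain m :: int where m: "c = gen i [^]\<^bsub>free_group n\<^esub> m" using pow[OF i] by blast
    obtain u where u: "u \<in> ?C" "\<phi> (gen i) = cj u (gen i)" using \<phi> i unfolding conj_auts_def by blast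
    have "expsum i c = 0"
      using expsum_mult[of i "gen i" c] expsum_cj[OF free_group_reduced[OF u(1)], of "gen i" i] u(2) free_group_reduced[OF px]
      by (simp add: c_def expsum_gen)
    then have "m = 0" using expsum_gen_pow[of i n m] i m by simp
    then have "c = []" using m by simp
    then have "gen i \<star> c = gen i" by simp
    then show ?thesis using free_group_reduced[OF px] by (simp add: c_def)
  qed
  then show ?thesis
    by (intro aut_eqI[OF aut Aut.one_closed]) (simp add: aut_one_apply)
qed

theorem theorem5p6:
  fixes n :: nat
  assumes "n \<ge> 1"
  shows "(\<lambda>cs. the_elem (induced_action n ` cs))
           \<in> iso (pure_braid_mod_center (Suc n)) (Aut_free n\<lparr>carrier := Inn_pure_braids n\<rparr>)
         \<and> andreadakis_equality n (Inn_pure_braids n)"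
proof
  let ?P = "pure_braid_group (Suc n)" and ?K = "Aut_free n\<lparr>carrier := Inn_pure_braids n\<rparr>"
  let ?A = "Aut_free (Suc n)" and ?F = "free_group (Suc n)"
  note Ps = pure_braids_subgroup[of "Suc n"] and Ks = Inn_pure_braids_subgroup[of n]
  have P: "group ?P" unfolding pure_braid_group_def by (rule Aut.subgroup_imp_group[OF Ps])
  have K: "group ?K" by (rule Aut.subgroup_imp_group[OF Ks])
  have Pc: "carrier ?P = pure_braids (Suc n)" "mult ?P = mult ?A" by (simp_all add: pure_braid_group_def)
  have hom: "induced_action n \<in> hom ?P ?K"
  proof (rule homI)
    fix \<alpha> \<beta> assume "\<alpha> \<in> carrier ?P" "\<beta> \<in> carrier ?P"
    then show "induced_action n (\<alpha> \<otimes>\<^bsub>?P\<^esub> \<beta>) = induced_action n \<alpha> \<otimes>\<^bsub>?K\<^esub> induced_action n \<beta>"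
      using subgroup.m_closed[OF Ps] by (simp add: Pc induced_action_eq capped_mult)
  qed (simp add: Pc induced_action_eq capped_Inn_pure_braids)
  interpret h: group_hom ?P ?K "induced_action n"
    using P K hom by (simp add: group_hom_def group_hom_axioms_def)
  \<comment> \<open>The inner factor comes from a rotated push, the pure factor from adding a
    strand.\<close>
  have surj: "induced_action n ` carrier ?P = carrier ?K"
  proof
    show "carrier ?K \<subseteq> induced_action n ` carrier ?P"
    proof
      fix \<phi> assume "\<phi> \<in> carrier ?K"
      then obtain m \<beta> where m: "m \<in> carrier (free_group n)" and \<beta>: "\<beta> \<in> pure_braids n"
        and \<phi>: "\<phi> = inner (free_group n) m \<otimes>\<^bsub>Aut_free n\<^esub> \<beta>"
        by (auto simp: Inn_pure_braids_def set_mult_def Inn_def)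
      obtain \<alpha> where \<alpha>: "\<alpha> \<in> pure_braids (Suc n)" "capped n \<alpha> = inner (free_group n) m"
        using m by (rule capped_inner_surj)
      have \<alpha>\<beta>: "\<alpha> \<otimes>\<^bsub>?A\<^esub> ext n \<beta> \<in> pure_braids (Suc n)"
        using \<alpha>(1) ext_pure[OF \<beta>] by (rule subgroup.m_closed[OF Ps])
      have "\<phi> = induced_action n (\<alpha> \<otimes>\<^bsub>?A\<^esub> ext n \<beta>)"
        using capped_mult[OF \<alpha>(1) ext_pure[OF \<beta>]] capped_ext[OF \<beta>] \<alpha>(2)
        by (simp add: \<phi> induced_action_eq[OF \<alpha>\<beta>])
      then show "\<phi> \<in> induced_action n ` carrier ?P" using \<alpha>\<beta> by (auto simp: Pc)
    qed
  qed (use h.hom_closed in blast)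
  have "kernel ?P ?K (induced_action n) = center ?P"
  proof
    show "kernel ?P ?K (induced_action n) \<subseteq> center ?P"
    proof
      fix \<beta> assume "\<beta> \<in> kernel ?P ?K (induced_action n)"
      then have \<beta>: "\<beta> \<in> pure_braids (Suc n)" "capped n \<beta> = \<one>\<^bsub>Aut_free n\<^esub>"
        by (auto simp: kernel_def Pc induced_action_eq)
      define d where "d = boundary (Suc n)"
      have d: "d \<in> carrier ?F" unfolding d_def by (rule boundary_closed)
      obtain m :: int where m: "\<beta> = inner ?F (d [^]\<^bsub>?F\<^esub> m)"
        using capped_kernel[OF assms \<beta>] unfolding d_def by blast
      \<comment> \<open>A kernel element is conjugation by a power of \<partial>_{n+1}, which every
        pure braid fixes.\<close>
      have "\<beta> \<otimes>\<^bsub>?A\<^esub> \<alpha> = \<alpha> \<otimes>\<^bsub>?A\<^esub> \<beta>" if \<alpha>: "\<alpha> \<in> pure_braids (Suc n)" for \<alpha>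
      proof -
        have aut: "\<alpha> \<in> carrier ?A" using \<alpha> by (rule pure_braids_aut)
        interpret a: group_hom ?F ?F \<alpha> by (rule group_hom_whom[OF aut_whom[OF aut]])
        have "\<alpha> (d [^]\<^bsub>?F\<^esub> m) = d [^]\<^bsub>?F\<^esub> m"
          using a.hom_int_pow[OF d] \<alpha> by (simp add: pure_braids_iff d_def)
        then show ?thesis using conj_inner[OF aut F.int_pow_closed[OF d, of m]] m by simp
      qed
      then show "\<beta> \<in> center ?P" using \<beta> by (simp add: center_def Pc)
    qed
    show "center ?P \<subseteq> kernel ?P ?K (induced_action n)"
    proof
      fix \<beta> assume \<beta>: "\<beta> \<in> center ?P"
      then have \<beta>P: "\<beta> \<in> pure_braids (Suc n)" and c: "\<And>\<alpha>. \<alpha> \<in> pure_braids (Suc n) \<Longrightarrow> \<beta> \<otimes>\<^bsub>?A\<^esub> \<alpha> = \<alpha> \<otimes>\<^bsub>?A\<^esub> \<beta>"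
        by (auto simp: center_def Pc)
      \<comment> \<open>Capping reaches every inner automorphism of F_n, so the image of a central
        braid commutes with all of them.\<close>
      have "capped n \<beta> = \<one>\<^bsub>Aut_free n\<^esub>"
      proof (rule center_capped[OF assms])
        show "capped n \<beta> \<in> conj_auts n" using capped_Inn_pure_braids[OF \<beta>P] Inn_pure_braids_iff by blast
        fix m assume m: "m \<in> carrier (free_group n)"
        obtain \<alpha> where \<alpha>: "\<alpha> \<in> pure_braids (Suc n)" "capped n \<alpha> = inner (free_group n) m"
          using m by (rule capped_inner_surj)
        show "capped n \<beta> \<otimes>\<^bsub>Aut_free n\<^esub> inner (free_group n) m = inner (free_group n) m \<otimes>\<^bsub>Aut_free n\<^esub> capped n \<beta>"
          using capped_mult[OF \<beta>P \<alpha>(1)] capped_mult[OF \<alpha>(1) \<beta>P] c[OF \<alpha>(1)] \<alpha>(2) by simp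
      qed
      then show "\<beta> \<in> kernel ?P ?K (induced_action n)"
        using \<beta>P by (simp add: kernel_def Pc induced_action_eq)
    qed
  qed
  then show "(\<lambda>cs. the_elem (induced_action n ` cs)) \<in> iso (pure_braid_mod_center (Suc n)) ?K"
    using h.FactGroup_iso_set[OF surj] by (simp add: pure_braid_mod_center_def)
  show "andreadakis_equality n (Inn_pure_braids n)"
    using assms by (rule Inn_pure_braids_andreadakis_equality)
qed

end
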